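(* Let $k,n,D\in\mathbb{N}$ and $T>0$. Let $V\in C^k([0,T]\times\mathbb{R}^n\times[0,1]^D;\mathbb{R}^n)$ and suppose there is $C>0$ with $|V(t,x,\eta)|\le C(1+|x|)$ for all $(t,x,\eta)\in[0,T]\times\mathbb{R}^n\times[0,1]^D$. Let $r>0$ and let $u_0\in W^{1,\infty}_{\mathrm{loc}}(\mathbb{R}^n)$ be $r$-approximable by NNs. Let $u(t,x,\eta)=u_0(X(0,t,x,\eta))$ denote the weak solution of the Cauchy problem $$\partial_t u(t,x,\eta)+V(t,x,\eta)\cdot\nabla_x u(t,x,\eta)=0,\qquad u(0,x,\eta)=u_0(x),$$ where $X$ is the characteristic flow of $V$. Set $d:=1+n+D$. Then for every compact $K\subset\mathbb{R}^n$ there exists a constant $c=c(n,r,d,k,|K|,T,\|V\|_{C^k},u_0)>0$ (depending only on the indicated quantities, in particular not on $\varepsilon$) such that for every $\varepsilon\in(0,1)$ there exists a NN $\Phi^{\overline u,\varepsilon}$ with $d$-dimensional input such that, for the restriction $\overline u:=u|_{[0,T]\times K\times[0,1]^D}$, (i) $L(\Phi^{\overline u,\varepsilon})\le c\cdot(\ln(1/\varepsilon)+1)$; (ii) $W(\Phi^{\overline u,\varepsilon})\le c\cdot(\varepsilon^{-1/r}+\varepsilon^{-d/k})\cdot(\ln(1/\varepsilon)+1)$; (iii) $\|\overline u-\mathrm{R}(\Phi^{\overline u,\varepsilon})\|_{L^\infty([0,T]\times K\times[0,1]^D)}<\varepsilon$.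
   Context: $\mathbb{N}=\{1,2,\dots\}$. $W^{1,\infty}_{\mathrm{loc}}(\mathbb{R}^n)$ is the space of functions whose restriction to every compact set has bounded weak derivatives of order at most $1$ (i.e. locally Lipschitz functions, identified with their continuous representative). Characteristic flow: under the assumptions on $V$, for every $(t,x,\eta)\in[0,T]\times\mathbb{R}^n\times[0,1]^D$ the system $\dot\gamma(s)=V(s,\gamma(s),\eta)$, $\gamma(t)=x$ has a unique solution $\gamma$ on $[0,T]$, and $X(s,t,x,\eta):=\gamma(s)$. Weak solution: for $u_0\in L^\infty(\mathbb{R}^n)$, a weak solution is $u\in L^\infty([0,T]\times\mathbb{R}^n\times[0,1]^D)$ such that for all $\varphi\in C^1_c([0,T)\times\mathbb{R}^n)$ and all $\eta\in[0,1]^D$, $$\int_0^T\int_{\mathbb{R}^n}u(t,x,\eta)\big[\partial_t\varphi(t,x)+V(t,x,\eta)\cdot\nabla_x\varphi(t,x)+\mathrm{div}_xV(t,x,\eta)\varphi(t,x)\big]\,dx\,dt+\int_{\mathbb{R}^n}u_0(x)\varphi(0,x)\,dx=0.$$ It is known that $u(t,x,\eta)=u_0(X(0,t,x,\eta))$ is a weak solution. Neural networks: for $m,L\in\mathbb{N}$, a neural network (NN) $\Phi$ with input dimension $m$ and $L$ layers is a sequence $\Phi=((A_1,b_1),\dots,(A_L,b_L))$ where, with $N_0=m$ and some $N_1,\dots,N_L\in\mathbb{N}$, each $A_\ell$ is a real $N_\ell\times\sum_{j=0}^{\ell-1}N_j$ matrix and $b_\ell\in\mathbb{R}^{N_\ell}$.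 With $\varrho(x)=\max\{0,x\}$ (ReLU, applied componentwise), its realisation $\mathrm{R}(\Phi):\mathbb{R}^m\to\mathbb{R}^{N_L}$ is $\mathrm{R}(\Phi)(x)=x_L$, where $x_0:=x$, $x_\ell:=\varrho(A_\ell[x_0^T|\dots|x_{\ell-1}^T]^T+b_\ell)$ for $\ell=1,\dots,L-1$, and $x_L:=A_L[x_0^T|\dots|x_{L-1}^T]^T+b_L$. $N_L$ is the output dimension, $L(\Phi):=L$ the number of layers, and $W(\Phi):=\sum_{j=1}^L(\|A_j\|_0+\|b_j\|_0)$ the number of weights, where $\|\cdot\|_0$ counts nonzero entries. NNs approximating scalar functions have output dimension $1$. Approximability: $f\in L^\infty(\mathbb{R}^n)$ is $r$-approximable by NNs ($r>0$) if for every compact $K\subset\mathbb{R}^n$ there is a constant $c=c(K,r,f)>0$ such that for every $\varepsilon\in(0,1)$ there is a NN $\Phi^{f,\varepsilon}$ (input dimension $n$) with $L(\Phi^{f,\varepsilon})\le c\cdot(\ln(1/\varepsilon)+1)$, $W(\Phi^{f,\varepsilon})\le c\,\varepsilon^{-1/r}$, and $\|f-\mathrm{R}(\Phi^{f,\varepsilon})\|_{L^\infty(K)}\le\varepsilon$. Norms: $|K|:=\max_{x\in K}|x|$; $\|g\|_{C^k(\Omega)}=\max_{|\alpha|\le k}\sup_{x\in\Omega}|D^\alpha g(x)|$; $\|V\|_{C^k}$ is taken over $[0,T]\times B_{G_0}(0)\times[0,1]^D$, where $B_{G_0}(0)\subset\mathbb{R}^n$ is the closed ball of radius $G_0:=(|K|+CT)\exp(CT)$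 about $0$. *)

theory Defs
  imports
    "HOL-Analysis.Analysis"
    "HOL-Probability.Essential_Supremum"
    "Jordan_Normal_Form.Matrix"
begin

section \<open>Functions of class C^k on closed domains\<close>

text \<open>Partial derivatives are taken within \<open>S\<close>, so that they are one-sided at boundary points.
  They are meaningful for \<open>S\<close> a product of nondegenerate intervals (possibly unbounded), where each
  axis-parallel line through a point of \<open>S\<close> meets \<open>S\<close> in a nondegenerate interval.\<close>

definition partial_within ::
    "'a::euclidean_space set \<Rightarrow> 'a \<Rightarrow> ('a \<Rightarrow> 'b::real_normed_vector) \<Rightarrow> 'a \<Rightarrow> 'b" where
  "partial_within S b f x =
     vector_derivative (\<lambda>h. f (x + h *\<^sub>R b)) (at 0 within {h. x + h *\<^sub>R b \<in> S})"

text \<open>A partial derivative of order \<open>m\<close> is indexed by the list of the \<open>m\<close> coordinate directions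
  along which one differentiates. For functions of class C^k, partial derivatives up to order
  \<open>k\<close> commute, so that the lists of length at most \<open>k\<close> give exactly the derivatives \<open>D\<^sup>\<alpha>\<close> for the
  multi-indices of order at most \<open>k\<close>.\<close>

fun iter_partial ::
    "'a::euclidean_space set \<Rightarrow> 'a list \<Rightarrow> ('a \<Rightarrow> 'b::real_normed_vector) \<Rightarrow> 'a \<Rightarrow> 'b" where
  "iter_partial S [] f = f"
| "iter_partial S (b # bs) f = partial_within S b (iter_partial S bs f)"

definition Ck_on ::
    "nat \<Rightarrow> 'a::euclidean_space set \<Rightarrow> ('a \<Rightarrow> 'b::real_normed_vector) \<Rightarrow> bool" where
  "Ck_on k S f \<longleftrightarrow>
     (\<forall>bs b x. set bs \<subseteq> Basis \<and> length bs < k \<and> b \<in> Basis \<and> x \<in> S \<longrightarrow>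
        (\<lambda>h. iter_partial S bs f (x + h *\<^sub>R b)) differentiable (at 0 within {h. x + h *\<^sub>R b \<in> S})) \<and>
     (\<forall>bs. set bs \<subseteq> Basis \<and> length bs \<le> k \<longrightarrow> continuous_on S (iter_partial S bs f))"

text \<open>The C^k norm over \<open>\<Omega> \<subseteq> S\<close>, with derivatives taken within \<open>S\<close>. It is only used for compact
  nonempty \<open>\<Omega>\<close>, where the suprema are finite for \<open>f\<close> of class C^k on \<open>S\<close>.\<close>

definition Ck_norm ::
    "nat \<Rightarrow> 'a::euclidean_space set \<Rightarrow> 'a set \<Rightarrow> ('a \<Rightarrow> 'b::real_normed_vector) \<Rightarrow> real" where
  "Ck_norm k S \<Omega> f =
     (MAX bs \<in> {bs. set bs \<subseteq> Basis \<and> length bs \<le> k}. SUP x\<in>\<Omega>. norm (iter_partial S bs f x))"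


section \<open>Function spaces\<close>

text \<open>Since \<^typ>\<open>ennreal\<close> has least element 0, the norm over a null set is 0. It is \<open>\<infinity>\<close> if the absolute
  value of \<open>f\<close> is not measurable on \<open>S\<close>.\<close>

definition Linf_norm :: "'a::euclidean_space set \<Rightarrow> ('a \<Rightarrow> real) \<Rightarrow> ennreal" where
  "Linf_norm S f = esssup (lebesgue_on S) (\<lambda>x. ennreal \<bar>f x\<bar>)"

definition in_Linf :: "('a::euclidean_space \<Rightarrow> real) \<Rightarrow> bool" where
  "in_Linf f \<longleftrightarrow> f \<in> borel_measurable lebesgue \<and> Linf_norm UNIV f < \<infinity>"

text \<open>Elements of \<open>W\<^sup>1\<^sup>,\<^sup>\<infinity>\<close>-loc, identified with their continuous representatives, are the locally
  Lipschitz functions.\<close>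

definition W1inf_loc :: "('a::euclidean_space \<Rightarrow> real) \<Rightarrow> bool" where
  "W1inf_loc f \<longleftrightarrow> (\<forall>K. compact K \<longrightarrow> (\<exists>B. B-lipschitz_on K f))"


section \<open>ReLU neural networks with skip connections\<close>

type_synonym neural_network = "(real mat \<times> real Matrix.vec) list"

definition is_nn :: "nat \<Rightarrow> nat \<Rightarrow> neural_network \<Rightarrow> bool" where
  "is_nn m out \<Phi> \<longleftrightarrow> m \<ge> 1 \<and> \<Phi> \<noteq> [] \<and>
     (\<forall>l < length \<Phi>. dim_vec (snd (\<Phi> ! l)) \<ge> 1 \<and>
        fst (\<Phi> ! l) \<in> carrier_mat (dim_vec (snd (\<Phi> ! l))) (m + (\<Sum>j<l. dim_vec (snd (\<Phi> ! j))))) \<and>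
     dim_vec (snd (last \<Phi>)) = out"

text \<open>The second argument is the concatenation of the input and the outputs of all previous layers.
  The equation for the empty list is irrelevant, as networks have at least one layer.\<close>

fun nn_run :: "neural_network \<Rightarrow> real Matrix.vec \<Rightarrow> real Matrix.vec" where
  "nn_run [] z = z"
| "nn_run [(A, b)] z = A *\<^sub>v z + b"
| "nn_run ((A, b) # \<Phi>) z = nn_run \<Phi> (z @\<^sub>v map_vec (max 0) (A *\<^sub>v z + b))"

text \<open>For networks with output dimension 1, as a scalar-valued function.\<close>

definition nn_real :: "neural_network \<Rightarrow> real Matrix.vec \<Rightarrow> real" where
  "nn_real \<Phi> z = vec_index (nn_run \<Phi> z) 0"

definition nn_layers :: "neural_network \<Rightarrow> nat" where
  "nn_layers \<Phi> = length \<Phi>"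

definition nnz_mat :: "real mat \<Rightarrow> nat" where
  "nnz_mat A = card {(i, j). i < dim_row A \<and> j < dim_col A \<and> A $$ (i, j) \<noteq> 0}"

definition nnz_vec :: "real Matrix.vec \<Rightarrow> nat" where
  "nnz_vec b = card {i. i < dim_vec b \<and> vec_index b i \<noteq> 0}"

definition nn_weights :: "neural_network \<Rightarrow> nat" where
  "nn_weights \<Phi> = (\<Sum>(A, b)\<leftarrow>\<Phi>. nnz_mat A + nnz_vec b)"

text \<open>Coordinates are listed in the order of a fixed enumeration of the index type; its choice is
  immaterial, since permuting the columns of the weight matrices compensates for any other one.\<close>

definition coords :: "real ^ 'n::finite \<Rightarrow> real list" where
  "coords x = map (\<lambda>i. vec_nth x (from_nat_into UNIV i)) [0..<CARD('n)]"

definition nn_input1 :: "real ^ 'n::finite \<Rightarrow> real Matrix.vec" where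
  "nn_input1 x = vec_of_list (coords x)"

definition nn_input3 ::
    "real \<times> (real ^ 'n::finite) \<times> (real ^ 'm::finite) \<Rightarrow> real Matrix.vec" where
  "nn_input3 = (\<lambda>(t, x, \<eta>). vec_of_list (t # coords x @ coords \<eta>))"

definition nn_approximable :: "real \<Rightarrow> (real ^ 'n::finite \<Rightarrow> real) \<Rightarrow> bool" where
  "nn_approximable r f \<longleftrightarrow> r > 0 \<and> in_Linf f \<and>
     (\<forall>K. compact K \<longrightarrow> (\<exists>c>0. \<forall>\<epsilon>. 0 < \<epsilon> \<and> \<epsilon> < 1 \<longrightarrow>
        (\<exists>\<Phi>. is_nn CARD('n) 1 \<Phi> \<and>
           real (nn_layers \<Phi>) \<le> c * (ln (1 / \<epsilon>) + 1) \<and>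
           real (nn_weights \<Phi>) \<le> c * \<epsilon> powr (- 1 / r) \<and>
           Linf_norm K (\<lambda>x. f x - nn_real \<Phi> (nn_input1 x)) \<le> ennreal \<epsilon>)))"


section \<open>Transport along the characteristic flow\<close>

type_synonym ('n, 'm) txe = "real \<times> (real ^ 'n) \<times> (real ^ 'm)"

definition param_cube :: "(real ^ 'm::finite) set" where
  "param_cube = cbox 0 1"

definition txe_domain ::
    "real \<Rightarrow> (real ^ 'n::finite) set \<Rightarrow> ('n, 'm::finite) txe set" where
  "txe_domain T A = {0..T} \<times> A \<times> param_cube"

definition is_characteristic ::
    "real \<Rightarrow> (('n::finite, 'm::finite) txe \<Rightarrow> real ^ 'n) \<Rightarrow> real \<Rightarrow> real ^ 'n \<Rightarrow> real ^ 'm \<Rightarrow>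
       (real \<Rightarrow> real ^ 'n) \<Rightarrow> bool" where
  "is_characteristic T V t x \<eta> \<gamma> \<longleftrightarrow> \<gamma> t = x \<and>
     (\<forall>s\<in>{0..T}. (\<gamma> has_vector_derivative V (s, \<gamma> s, \<eta>)) (at s within {0..T}))"

text \<open>The characteristic is unique only on \<open>{0..T}\<close> (functions on \<^typ>\<open>real\<close> are arbitrary elsewhere),
  so the description is applied to its value at \<open>s\<close>, for \<open>s\<close> in \<open>{0..T}\<close>.\<close>

definition char_flow ::
    "real \<Rightarrow> (('n::finite, 'm::finite) txe \<Rightarrow> real ^ 'n) \<Rightarrow> real \<Rightarrow> real \<Rightarrow> real ^ 'n \<Rightarrow> real ^ 'm \<Rightarrow>
       real ^ 'n" where
  "char_flow T V s t x \<eta> = (THE y. \<exists>\<gamma>. is_characteristic T V t x \<eta> \<gamma> \<and> \<gamma> s = y)"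

text \<open>The weak solution of \<open>\<partial>\<^sub>t u + V \<bullet> \<nabla>\<^sub>x u = 0\<close>, \<open>u (0, x, \<eta>) = u0 x\<close>, given by its representation along
  characteristics, which are traced back to time 0.\<close>

definition transport_solution ::
    "real \<Rightarrow> (('n::finite, 'm::finite) txe \<Rightarrow> real ^ 'n) \<Rightarrow> (real ^ 'n \<Rightarrow> real) \<Rightarrow>
       ('n, 'm) txe \<Rightarrow> real" where
  "transport_solution T V u0 = (\<lambda>(t, x, \<eta>). u0 (char_flow T V 0 t x \<eta>))"

text \<open>The maximum of the norm over a compact set; inserting 0 only matters for the empty set.\<close>

definition set_radius :: "(real ^ 'n::finite) set \<Rightarrow> real" where
  "set_radius K = (SUP x\<in>insert 0 K. norm x)"

definition G0 :: "real \<Rightarrow> real \<Rightarrow> real \<Rightarrow> real" where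
  "G0 T C \<kappa> = (\<kappa> + C * T) * exp (C * T)"

end

theory Submission
  imports Defs
begin

text \<open>The flow map \<open>X\<close> traced back to time 0 has, at scale \<open>h\<close> around every point, a polynomial approximation of
  degree less than \<open>k\<close> with error \<open>O(h ^ k)\<close>, with constants depending on the field only through its \<open>C^k\<close> norm. No
  smoothness theory of flows is needed: the explicit Euler scheme with the field replaced by its Taylor polynomials at
  the Euler points of the centre is a recursion on polynomials, whose coefficients stay bounded uniformly in the number
  of steps in a geometrically weighted \<open>l\<^sup>1\<close> norm; the polynomial is truncated only at the end, and the number of
  steps is chosen so large that the Euler error is below \<open>h ^ k\<close>. Gluing the local polynomials with a partition of unity
  and computing the products by the sawtooth approximation of squaring yields ReLU networks with \<open>\<epsilon> powr (- d / k)\<close>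
  weights up to a logarithm. Composing them with the network for \<open>u0\<close> gives the theorem, since \<open>u0\<close> is Lipschitz.\<close>

section \<open>ReLU networks as families of functions\<close>

text \<open>The obstacle is uniformity: the constant may see the field only through its norm over
  one ball, and derivatives at the faces of the domain are one-sided, which makes differentiating
  the flow itself awkward. The coefficient norm is submultiplicative, and an Euler increment carries
  a factor \<open>1 / N\<close>. The constant term of the Taylor polynomial cancels against the
  Euler increment of the centre, so the remaining increment is at least linear in the displacement
  or in the shift of the starting time. Each step thus enlarges the norm by a factor
  \<open>1 + O(1 / N)\<close>, all \<open>N\<close> steps together by at most a fixed exponential;
  the weight \<open>\<rho>\<close> is the inverse of that exponential. The rate stems from a grid of
  mesh about \<open>\<epsilon> powr (1 / k)\<close> in \<open>d\<close> dimensions. The logarithm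
  stems from the refinements that a product network needs, since each refinement divides its error
  by 4. A second obstacle: the network for \<open>u0\<close> is accurate only almost everywhere,
  while the approximate flow could map into the exceptional null set. Continuity of both functions
  removes it.\<close>

definition affine_over :: "('x \<Rightarrow> real) set \<Rightarrow> nat \<Rightarrow> ('x \<Rightarrow> real) \<Rightarrow> bool" where
  "affine_over F q f \<longleftrightarrow> (\<exists>S a b. finite S \<and> S \<subseteq> F \<and> card S + (if b = 0 then 0 else 1) \<le> q \<and>
     f = (\<lambda>x. (\<Sum>g\<in>S. a g * g x) + b))"

lemma affine_over_mono:
  assumes "affine_over F q f" "F \<subseteq> F'" "q \<le> q'"
  shows "affine_over F' q' f"
proof -
  from assms(1) obtain S a b where "finite S" "S \<subseteq> F" "card S + (if b = 0 then 0 else 1) \<le> q"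
     "f = (\<lambda>x. (\<Sum>g\<in>S. a g * g x) + b)" unfolding affine_over_def by blast
  with assms(2,3) show ?thesis unfolding affine_over_def
    by (intro exI[of _ S] exI[of _ a] exI[of _ b]) (auto simp del: split_paired_Ex)
qed

text \<open>A bias is charged only when it is nonzero, so the zero function is free. This later
  permits a dummy neuron in a layer that would otherwise be empty.\<close>

lemma affine_over_zero: "affine_over F 0 (\<lambda>x. 0)"
  unfolding affine_over_def by (intro exI[of _ "{}"] exI[of _ "\<lambda>_. 0"] exI[of _ 0]) auto

lemma affine_over_const: "affine_over F 1 (\<lambda>x. c)"
  unfolding affine_over_def by (intro exI[of _ "{}"] exI[of _ "\<lambda>_. 0"] exI[of _ c]) auto

lemma affine_over_member: "f \<in> F \<Longrightarrow> affine_over F 1 f"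
  unfolding affine_over_def by (intro exI[of _ "{f}"] exI[of _ "\<lambda>_. 1"] exI[of _ 0]) auto

lemma affine_over_scale:
  assumes "affine_over F q f"
  shows "affine_over F q (\<lambda>x. c * f x)"
proof -
  from assms obtain S a b where *: "finite S" "S \<subseteq> F" "card S + (if b = 0 then 0 else 1) \<le> q"
     "f = (\<lambda>x. (\<Sum>g\<in>S. a g * g x) + b)" unfolding affine_over_def by blast
  show ?thesis unfolding affine_over_def
    by (rule exI[of _ S], rule exI[of _ "\<lambda>g. c * a g"], rule exI[of _ "c * b"])
       (use * in \<open>auto simp: algebra_simps sum_distrib_left\<close>)
qed

text \<open>Coefficients of functions common to both combinations are added up, so a shared neuron
  occupies a single entry.\<close>

lemma affine_over_add:
  assumes "affine_over F p f" "affine_over F q g"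
  shows "affine_over F (p + q) (\<lambda>x. f x + g x)"
proof -
  from assms(1) obtain S a b where *: "finite S" "S \<subseteq> F" "card S + (if b = 0 then 0 else 1) \<le> p"
     "f = (\<lambda>x. (\<Sum>g\<in>S. a g * g x) + b)" unfolding affine_over_def by blast
  from assms(2) obtain S' a' b' where **: "finite S'" "S' \<subseteq> F" "card S' + (if b' = 0 then 0 else 1) \<le> q"
     "g = (\<lambda>x. (\<Sum>g\<in>S'. a' g * g x) + b')" unfolding affine_over_def by blast
  let ?a = "\<lambda>g. (if g \<in> S then a g else 0) + (if g \<in> S' then a' g else 0)"
  have "(\<Sum>g\<in>S \<union> S'. ?a g * g x) = (\<Sum>g\<in>S. a g * g x) + (\<Sum>g\<in>S'. a' g * g x)" for x
  proof -
    have "(\<Sum>g\<in>S \<union> S'. ?a g * g x) = (\<Sum>g\<in>S \<union> S'. if g \<in> S then a g * g x else 0)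
        + (\<Sum>g\<in>S \<union> S'. if g \<in> S' then a' g * g x else 0)"
      unfolding sum.distrib[symmetric] by (rule sum.cong) (auto simp: algebra_simps)
    also have "\<dots> = (\<Sum>g\<in>S. a g * g x) + (\<Sum>g\<in>S'. a' g * g x)"
      using *(1) **(1) by (simp add: sum.If_cases Int_absorb1 Int_commute)
    finally show ?thesis .
  qed
  moreover have "card (S \<union> S') \<le> card S + card S'" by (rule card_Un_le)
  ultimately show ?thesis unfolding affine_over_def
    by (intro exI[of _ "S \<union> S'"] exI[of _ ?a] exI[of _ "b + b'"])
       (use * ** in \<open>auto split: if_splits\<close>)
qed

lemma affine_over_sum:
  assumes "finite A" "\<And>i. i \<in> A \<Longrightarrow> affine_over F (q i) (f i)"
  shows "affine_over F (\<Sum>i\<in>A. q i) (\<lambda>x. \<Sum>i\<in>A. f i x)"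
  using assms by (induction A rule: finite_induct) (auto intro: affine_over_zero affine_over_add)

lemma affine_over_diff:
  assumes "affine_over F p f" "affine_over F q g"
  shows "affine_over F (p + q) (\<lambda>x. f x - g x)"
  using affine_over_add[OF assms(1) affine_over_scale[OF assms(2), of "-1"]] by simp

text \<open>\<open>F\<close> consists of the functions computed by the inputs and hidden neurons of a network with \<open>L\<close> hidden layers and
  at most \<open>W\<close> weights. As neurons are identified with the functions that they compute, putting networks side by side
  is union of families.\<close>

inductive relu_net :: "('x \<Rightarrow> real) set \<Rightarrow> nat \<Rightarrow> nat \<Rightarrow> ('x \<Rightarrow> real) set \<Rightarrow> bool"
  for I :: "('x \<Rightarrow> real) set" where
  input: "relu_net I 0 W I"
| layer: "relu_net I L W F \<Longrightarrow> finite G \<Longrightarrow>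
    (\<And>g. g \<in> G \<Longrightarrow> \<exists>f. affine_over F (w g) f \<and> g = (\<lambda>x. max 0 (f x))) \<Longrightarrow>
    W + sum w G \<le> W' \<Longrightarrow> relu_net I (Suc L) W' (F \<union> G)"

lemma relu_net_mono: "relu_net I L W F \<Longrightarrow> W \<le> W' \<Longrightarrow> relu_net I L W' F"
proof (induction arbitrary: W' rule: relu_net.induct)
  case (layer L W F G w W'')
  show ?case
    by (rule relu_net.layer[OF layer.hyps(1,2), of w]) (use layer.hyps(3,4) layer.prems in auto)
qed (rule relu_net.input)

lemma relu_net_inputs: "relu_net I L W F \<Longrightarrow> I \<subseteq> F"
  by (induction rule: relu_net.induct) auto

text \<open>A layer with \<open>G = {}\<close> carries no weights. Skip connections make this enough
  to align depths: no identity neurons have to pass values on.\<close>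

lemma relu_net_pad:
  assumes "relu_net I L W F" "L \<le> L'"
  shows "relu_net I L' W F"
  using assms(2)
proof (induction rule: dec_induct)
  case (step n)
  show ?case using relu_net.layer[OF step.IH, of "{}" "\<lambda>_. 0" W] by simp
qed (rule assms(1))

text \<open>The induction runs through the first network and inverts the second one layer by layer;
  networks of different depths are padded beforehand.\<close>

lemma relu_net_Un_same:
  assumes "relu_net I L W1 F1" "relu_net I L W2 F2"
  shows "relu_net I L (W1 + W2) (F1 \<union> F2)"
  using assms
proof (induction arbitrary: W2 F2 rule: relu_net.induct)
  case (input W)
  from input.prems show ?case
    by (cases) (auto intro: relu_net.input)
next
  case (layer L W F G w W')
  from layer.prems obtain W2' F2' G2 w2 where 2: "F2 = F2' \<union> G2" "relu_net I L W2' F2'" "finite G2"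
    "\<And>g. g \<in> G2 \<Longrightarrow> \<exists>f. affine_over F2' (w2 g) f \<and> g = (\<lambda>x. max 0 (f x))"
    "W2' + sum w2 G2 \<le> W2" by (cases) blast
  \<comment> \<open>A neuron present in both layers needs only one incoming row; it is charged what
    the first network pays.\<close>
  let ?w = "\<lambda>g. if g \<in> G then w g else w2 g"
  have "sum ?w (G \<union> G2) = sum ?w (G \<union> (G2 - G))" by (rule sum.cong) auto
  also have "\<dots> = sum ?w G + sum ?w (G2 - G)"
    using layer.hyps(2) 2(3) by (intro sum.union_disjoint) auto
  also have "sum ?w G = sum w G" by (rule sum.cong) auto
  also have "sum ?w (G2 - G) = sum w2 (G2 - G)" by (rule sum.cong) auto
  also have "\<dots> \<le> sum w2 G2" using 2(3) by (intro sum_mono2) auto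
  finally have s: "sum ?w (G \<union> G2) \<le> sum w G + sum w2 G2" by simp
  have "relu_net I (Suc L) (W' + W2) ((F \<union> F2') \<union> (G \<union> G2))"
  proof (rule relu_net.layer[where w = ?w])
    show "relu_net I L (W + W2') (F \<union> F2')" by (rule layer.IH[OF 2(2)])
    show "finite (G \<union> G2)" using layer.hyps(2) 2(3) by simp
    show "\<exists>f. affine_over (F \<union> F2') (?w g) f \<and> g = (\<lambda>x. max 0 (f x))" if "g \<in> G \<union> G2" for g
    proof (cases "g \<in> G")
      case True
      with layer.hyps(3)[OF True] show ?thesis by (auto intro: affine_over_mono)
    next
      case False
      with that 2(4)[of g] show ?thesis by (auto intro: affine_over_mono)
    qed
    show "W + W2' + sum ?w (G \<union> G2) \<le> W' + W2"
      using s layer.hyps(4) 2(5) by linarith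
  qed
  then show ?case using 2(1) by (simp add: Un_ac)
qed

lemma relu_net_UN:
  assumes "finite A" "\<And>i. i \<in> A \<Longrightarrow> relu_net I L (W i) (F i)"
  shows "relu_net I L (\<Sum>i\<in>A. W i) (I \<union> (\<Union>i\<in>A. F i))"
  using assms
proof (induction A rule: finite_induct)
  case empty
  show ?case using relu_net_pad[OF relu_net.input[of I 0], of L] by simp
next
  case (insert i A)
  then have "relu_net I L (W i + (\<Sum>i\<in>A. W i)) (F i \<union> (I \<union> (\<Union>i\<in>A. F i)))"
    by (intro relu_net_Un_same) auto
  then show ?case using insert by (simp add: Un_ac)
qed

lemma relu_net_extend:
  assumes "relu_net I L W F" "affine_over F q f"
  shows "relu_net I (Suc L) (W + q) (insert (\<lambda>x. max 0 (f x)) F)"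
  using relu_net.layer[OF assms(1), of "{\<lambda>x. max 0 (f x)}" "\<lambda>_. q" "W + q"] assms(2) by auto

section \<open>From families of functions to lists of weight matrices, and back\<close>

lemma vec_of_list_append: "vec_of_list xs @\<^sub>v vec_of_list ys = vec_of_list (xs @ ys)"
  by (intro eq_vecI) (auto simp: vec_of_list_index nth_append)

lemma index_mult_mat_vec_list:
  assumes "A \<in> carrier_mat r (length zs)" "i < r" "dim_vec b = r"
  shows "vec_index (A *\<^sub>v vec_of_list zs + b) i = (\<Sum>j<length zs. A $$ (i, j) * zs ! j) + vec_index b i"
  using assms by (auto simp: scalar_prod_def vec_of_list_index atLeast0LessThan intro!: sum.cong)

text \<open>With skip connections, the tail of a network is itself a network, on the input enlarged
  by the outputs of the first layer. This matches the recursion of \<open>nn_run\<close> and allows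
  induction on the list of layers.\<close>

lemma is_nn_Cons:
  assumes "\<Phi> \<noteq> []"
  shows "is_nn m out ((A, b) # \<Phi>) \<longleftrightarrow>
    m \<ge> 1 \<and> dim_vec b \<ge> 1 \<and> A \<in> carrier_mat (dim_vec b) m \<and> is_nn (m + dim_vec b) out \<Phi>"
    (is "?L = ?R")
proof -
  have s: "(\<Sum>j<Suc l. dim_vec (snd (((A, b) # \<Phi>) ! j))) = dim_vec b + (\<Sum>j<l. dim_vec (snd (\<Phi> ! j)))" for l
    by (subst sum.lessThan_Suc_shift) simp
  show ?thesis
    unfolding is_nn_def length_Cons All_less_Suc2 using assms by (auto simp: s add.assoc[symmetric] simp del: sum.lessThan_Suc)
qed

lemma nn_weights_Cons [simp]: "nn_weights ((A, b) # \<Phi>) = nnz_mat A + nnz_vec b + nn_weights \<Phi>"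
  by (simp add: nn_weights_def)

lemma nn_weights_append [simp]: "nn_weights (\<Phi> @ \<Psi>) = nn_weights \<Phi> + nn_weights \<Psi>"
  by (simp add: nn_weights_def)

lemma nn_weights_Nil [simp]: "nn_weights [] = 0"
  by (simp add: nn_weights_def)

lemma nnz_mat_rows:
  "nnz_mat A = (\<Sum>i<dim_row A. card {j. j < dim_col A \<and> A $$ (i, j) \<noteq> 0})"
proof -
  have "{(i, j). i < dim_row A \<and> j < dim_col A \<and> A $$ (i, j) \<noteq> 0} =
     (SIGMA i:{..<dim_row A}. {j. j < dim_col A \<and> A $$ (i, j) \<noteq> 0})" by auto
  then show ?thesis unfolding nnz_mat_def by simp
qed

lemma nnz_vec_rows: "nnz_vec b = (\<Sum>i<dim_vec b. if vec_index b i = 0 then 0 else 1)"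
proof -
  have "{i. i < dim_vec b \<and> vec_index b i \<noteq> 0} = {..<dim_vec b} \<inter> {i. vec_index b i \<noteq> 0}" by auto
  then have "nnz_vec b = (\<Sum>i\<in>{..<dim_vec b} \<inter> {i. vec_index b i \<noteq> 0}. 1)"
    unfolding nnz_vec_def by simp
  also have "\<dots> = (\<Sum>i<dim_vec b. if vec_index b i \<noteq> 0 then 1 else 0)"
    by (subst sum.inter_restrict) (auto intro: sum.cong)
  finally show ?thesis by (auto intro: sum.cong)
qed

lemma nn_run_append_layer:
  assumes "\<Phi> \<noteq> []"
  shows "nn_run ((A, b) # \<Phi>) z = nn_run \<Phi> (z @\<^sub>v map_vec (max 0) (A *\<^sub>v z + b))"
  using assms by (cases \<Phi>) auto

lemma affine_over_row:
  assumes "affine_over F q f" "F \<subseteq> set gs"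
  shows "\<exists>r \<beta>. (\<forall>x. (\<Sum>j<length gs. r j * (gs ! j) x) + \<beta> = f x) \<and>
    card {j. j < length gs \<and> r j \<noteq> 0} + (if \<beta> = 0 then 0 else 1) \<le> q"
proof -
  from assms obtain S a b where *: "finite S" "S \<subseteq> set gs" "card S + (if b = 0 then 0 else 1) \<le> q"
     "f = (\<lambda>x. (\<Sum>g\<in>S. a g * g x) + b)" unfolding affine_over_def by blast
  have "\<forall>g\<in>S. \<exists>j<length gs. gs ! j = g" using *(2) by (auto simp: in_set_conv_nth)
  \<comment> \<open>The list \<open>gs\<close> may contain repetitions. One position is selected for
    each function, and all other entries of the row are zero.\<close>
  then obtain idx where idx: "\<And>g. g \<in> S \<Longrightarrow> idx g < length gs \<and> gs ! idx g = g" by metis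
  have inj: "inj_on idx S" using idx by (metis inj_onI)
  define r where "r j = (if j \<in> idx ` S then a (gs ! j) else 0)" for j
  have "(\<Sum>j<length gs. r j * (gs ! j) x) = (\<Sum>g\<in>S. a g * g x)" for x
  proof -
    have "(\<Sum>j<length gs. r j * (gs ! j) x) = (\<Sum>j\<in>idx ` S. r j * (gs ! j) x)"
      by (rule sum.mono_neutral_right) (use idx in \<open>auto simp: r_def\<close>)
    also have "\<dots> = (\<Sum>g\<in>S. a g * g x)"
      by (subst sum.reindex[OF inj]) (use idx in \<open>auto simp: r_def intro!: sum.cong\<close>)
    finally show ?thesis .
  qed
  moreover have "card {j. j < length gs \<and> r j \<noteq> 0} \<le> card (idx ` S)"
    by (rule card_mono) (use *(1) in \<open>auto simp: r_def split: if_splits\<close>)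
  moreover have "card (idx ` S) \<le> card S" using *(1) by (rule card_image_le)
  ultimately show ?thesis using * by (intro exI[of _ r] exI[of _ b]) auto
qed

lemma affine_layer_matrix:
  fixes gs fs :: "('x \<Rightarrow> real) list"
  assumes "F \<subseteq> set gs" "\<And>i. i < length fs \<Longrightarrow> affine_over F (q i) (fs ! i)"
  shows "\<exists>A b. dim_vec b = length fs \<and> A \<in> carrier_mat (length fs) (length gs) \<and>
    nnz_mat A + nnz_vec b \<le> (\<Sum>i<length fs. q i) \<and>
    (\<forall>x. A *\<^sub>v vec_of_list (map (\<lambda>g. g x) gs) + b = vec_of_list (map (\<lambda>f. f x) fs))"
proof -
  \<comment> \<open>Row and bias are packed into one pair, so that one choice per row yields
    both.\<close>
  define P where "P i p \<longleftrightarrow> (\<forall>x. (\<Sum>j<length gs. fst p j * (gs ! j) x) + snd p = (fs ! i) x) \<and>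
    card {j. j < length gs \<and> fst p j \<noteq> 0} + (if snd p = 0 then 0 else 1) \<le> q i" for i and p :: "(nat \<Rightarrow> real) \<times> real"
  have P0: "\<exists>p. P i p" if "i < length fs" for i
    using affine_over_row[OF assms(2)[OF that] assms(1)] unfolding P_def by auto
  have P: "P i (SOME p. P i p)" if "i < length fs" for i
    by (rule someI_ex[OF P0[OF that]])
  define r where "r i = fst (SOME p. P i p)" for i
  define \<beta> where "\<beta> i = snd (SOME p. P i p)" for i
  have r: "\<And>i x. i < length fs \<Longrightarrow> (\<Sum>j<length gs. r i j * (gs ! j) x) + \<beta> i = (fs ! i) x"
    "\<And>i. i < length fs \<Longrightarrow> card {j. j < length gs \<and> r i j \<noteq> 0} + (if \<beta> i = 0 then 0 else 1) \<le> q i"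
    using P unfolding r_def \<beta>_def P_def by blast+
  let ?A = "mat (length fs) (length gs) (\<lambda>(i, j). r i j)"
  let ?b = "Matrix.vec (length fs) \<beta>"
  have "nnz_mat ?A + nnz_vec ?b = (\<Sum>i<length fs. card {j. j < length gs \<and> ?A $$ (i, j) \<noteq> 0}
      + (if vec_index ?b i = 0 then 0 else 1))"
    unfolding nnz_mat_rows nnz_vec_rows sum.distrib by simp
  also have "\<dots> \<le> (\<Sum>i<length fs. q i)"
  proof (rule sum_mono)
    fix i assume "i \<in> {..<length fs}"
    then have i: "i < length fs" by simp
    have "{j. j < length gs \<and> ?A $$ (i, j) \<noteq> 0} = {j. j < length gs \<and> r i j \<noteq> 0}" using i by auto
    then show "card {j. j < length gs \<and> ?A $$ (i, j) \<noteq> 0} + (if vec_index ?b i = 0 then 0 else 1) \<le> q i"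
      using r(2)[OF i] i by simp
  qed
  moreover have "?A *\<^sub>v vec_of_list (map (\<lambda>g. g x) gs) + ?b = vec_of_list (map (\<lambda>f. f x) fs)" for x
  proof (rule eq_vecI)
    fix i assume "i < dim_vec (vec_of_list (map (\<lambda>f. f x) fs))"
    then have i: "i < length fs" by simp
    have "vec_index (?A *\<^sub>v vec_of_list (map (\<lambda>g. g x) gs) + ?b) i =
       (\<Sum>j<length (map (\<lambda>g. g x) gs). ?A $$ (i, j) * map (\<lambda>g. g x) gs ! j) + vec_index ?b i"
      by (rule index_mult_mat_vec_list[of _ "length fs"]) (use i in auto)
    also have "\<dots> = (\<Sum>j<length gs. r i j * (gs ! j) x) + \<beta> i" using i by simp
    finally show "vec_index (?A *\<^sub>v vec_of_list (map (\<lambda>g. g x) gs) + ?b) i =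
       vec_index (vec_of_list (map (\<lambda>f. f x) fs)) i" using r(1)[OF i] i by (simp add: vec_of_list_index)
  qed simp
  ultimately show ?thesis by (intro exI[of _ ?A] exI[of _ ?b]) auto
qed

text \<open>Hidden layers alone are not a network, since the last layer of a network is affine. The
  claim is therefore phrased with an arbitrary continuation \<open>\<Phi>\<close> that reads the
  values of all functions collected so far.\<close>

lemma relu_net_hidden_layers:
  fixes inps :: "('x \<Rightarrow> real) list"
  assumes "relu_net (set inps) L W F" "inps \<noteq> []"
  shows "\<exists>\<Psi> gs. gs \<noteq> [] \<and> F \<subseteq> set gs \<and> length \<Psi> = L \<and> nn_weights \<Psi> \<le> W \<and>
    (\<forall>\<Phi>. is_nn (length gs) 1 \<Phi> \<longrightarrow> is_nn (length inps) 1 (\<Psi> @ \<Phi>) \<and>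
      (\<forall>x. nn_real (\<Psi> @ \<Phi>) (vec_of_list (map (\<lambda>g. g x) inps)) =
           nn_real \<Phi> (vec_of_list (map (\<lambda>g. g x) gs))))"
  using assms
proof (induction rule: relu_net.induct)
  case (input W)
  then show ?case by (intro exI[of _ "[]"] exI[of _ inps]) auto
next
  case (layer L W F G w W')
  from layer.IH[OF layer.prems] obtain \<Psi> gs where IH: "gs \<noteq> []" "F \<subseteq> set gs" "length \<Psi> = L" "nn_weights \<Psi> \<le> W"
    "\<And>\<Phi>. is_nn (length gs) 1 \<Phi> \<Longrightarrow> is_nn (length inps) 1 (\<Psi> @ \<Phi>)"
    "\<And>\<Phi> x. is_nn (length gs) 1 \<Phi> \<Longrightarrow> nn_real (\<Psi> @ \<Phi>) (vec_of_list (map (\<lambda>g. g x) inps)) =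
           nn_real \<Phi> (vec_of_list (map (\<lambda>g. g x) gs))" by blast
  from layer.hyps(2) obtain hs where hs: "set hs = G" "distinct hs" using finite_distinct_list by blast
  from layer.hyps(3) obtain \<phi> where \<phi>: "\<And>g. g \<in> G \<Longrightarrow> affine_over F (w g) (\<phi> g)"
     "\<And>g. g \<in> G \<Longrightarrow> g = (\<lambda>x. max 0 (\<phi> g x))" by metis
  \<comment> \<open>\<open>is_nn\<close> demands at least one neuron per layer, but \<open>G\<close>
    may be empty. The appended zero function fills the gap with a zero row, hence without
    weights.\<close>
  define fs where "fs = map \<phi> hs @ [\<lambda>x. 0]"
  define q where "q i = (if i < length hs then w (hs ! i) else 0)" for i
  have lfs: "length fs = Suc (length hs)" by (simp add: fs_def)
  have aff: "affine_over F (q i) (fs ! i)" if "i < length fs" for i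
    using that \<phi>(1) hs(1) by (auto simp: fs_def q_def nth_append affine_over_zero)
  from affine_layer_matrix[OF IH(2) aff] obtain A b where Ab: "dim_vec b = length fs"
    "A \<in> carrier_mat (length fs) (length gs)" "nnz_mat A + nnz_vec b \<le> (\<Sum>i<length fs. q i)"
    "\<And>x. A *\<^sub>v vec_of_list (map (\<lambda>g. g x) gs) + b = vec_of_list (map (\<lambda>f. f x) fs)" by blast
  have q: "(\<Sum>i<length fs. q i) = sum w G"
  proof -
    have "(\<Sum>i<length fs. q i) = (\<Sum>i<length hs. w (hs ! i))"
      unfolding lfs by (simp add: q_def)
    also have "\<dots> = sum_list (map w hs)" by (simp add: sum_list_sum_nth atLeast0LessThan)
    also have "\<dots> = sum w G" using hs by (simp add: sum_list_distinct_conv_sum_set)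
    finally show ?thesis .
  qed
  define gs' where "gs' = gs @ hs @ [\<lambda>x. 0]"
  have relu: "map_vec (max 0) (vec_of_list (map (\<lambda>f. f x) fs)) = vec_of_list (map (\<lambda>g. g x) (hs @ [\<lambda>x. 0]))" for x
  proof (rule eq_vecI)
    fix i assume "i < dim_vec (vec_of_list (map (\<lambda>g. g x) (hs @ [\<lambda>x. 0])))"
    then have i: "i < Suc (length hs)" by simp
    show "vec_index (map_vec (max 0) (vec_of_list (map (\<lambda>f. f x) fs))) i =
      vec_index (vec_of_list (map (\<lambda>g. g x) (hs @ [\<lambda>x. 0]))) i"
    proof (cases "i < length hs")
      case True
      have "(hs ! i) x = max 0 (\<phi> (hs ! i) x)" using \<phi>(2)[of "hs ! i"] True hs(1) by (metis nth_mem)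
      with True show ?thesis using i lfs by (simp add: vec_of_list_index fs_def nth_append)
    qed (use i lfs in \<open>simp add: vec_of_list_index fs_def nth_append\<close>)
  qed (simp add: lfs)
  have main: "is_nn (length inps) 1 ((\<Psi> @ [(A, b)]) @ \<Phi>) \<and>
      (\<forall>x. nn_real ((\<Psi> @ [(A, b)]) @ \<Phi>) (vec_of_list (map (\<lambda>g. g x) inps)) =
           nn_real \<Phi> (vec_of_list (map (\<lambda>g. g x) gs')))" if "is_nn (length gs') 1 \<Phi>" for \<Phi>
  proof -
    have ne: "\<Phi> \<noteq> []" using that by (auto simp: is_nn_def)
    have nn: "is_nn (length gs) 1 ((A, b) # \<Phi>)"
      unfolding is_nn_Cons[OF ne] using that Ab IH(1)
      by (auto simp: gs'_def lfs Suc_le_eq)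
    have "nn_real ((A, b) # \<Phi>) (vec_of_list (map (\<lambda>g. g x) gs)) = nn_real \<Phi> (vec_of_list (map (\<lambda>g. g x) gs'))" for x
      unfolding nn_real_def nn_run_append_layer[OF ne] Ab(4) relu vec_of_list_append
      by (simp add: gs'_def)
    then show ?thesis using IH(5,6)[OF nn] by simp
  qed
  show ?case
    by (intro exI[of _ "\<Psi> @ [(A, b)]"] exI[of _ gs'])
       (use main IH(1-4) Ab(3) q hs(1) layer.hyps(4) in \<open>auto simp: gs'_def\<close>)
qed

lemma relu_net_realise:
  fixes inps :: "('x \<Rightarrow> real) list"
  assumes "relu_net (set inps) L W F" "inps \<noteq> []" "affine_over F q f"
  shows "\<exists>\<Phi>. is_nn (length inps) 1 \<Phi> \<and> nn_layers \<Phi> = Suc L \<and> nn_weights \<Phi> \<le> W + q \<and>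
    (\<forall>x. nn_real \<Phi> (vec_of_list (map (\<lambda>g. g x) inps)) = f x)"
proof -
  from relu_net_hidden_layers[OF assms(1,2)] obtain \<Psi> gs where 1: "gs \<noteq> []" "F \<subseteq> set gs" "length \<Psi> = L" "nn_weights \<Psi> \<le> W"
    "\<And>\<Phi>. is_nn (length gs) 1 \<Phi> \<Longrightarrow> is_nn (length inps) 1 (\<Psi> @ \<Phi>)"
    "\<And>\<Phi> x. is_nn (length gs) 1 \<Phi> \<Longrightarrow> nn_real (\<Psi> @ \<Phi>) (vec_of_list (map (\<lambda>g. g x) inps)) =
           nn_real \<Phi> (vec_of_list (map (\<lambda>g. g x) gs))" by blast
  have "\<exists>A b. dim_vec b = length [f] \<and> A \<in> carrier_mat (length [f]) (length gs) \<and>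
    nnz_mat A + nnz_vec b \<le> (\<Sum>i<length [f]. q) \<and>
    (\<forall>x. A *\<^sub>v vec_of_list (map (\<lambda>g. g x) gs) + b = vec_of_list (map (\<lambda>f. f x) [f]))"
    by (rule affine_layer_matrix[OF 1(2)]) (use assms(3) in auto)
  then obtain A b where Ab: "dim_vec b = 1" "A \<in> carrier_mat 1 (length gs)" "nnz_mat A + nnz_vec b \<le> q"
    "\<And>x. A *\<^sub>v vec_of_list (map (\<lambda>g. g x) gs) + b = vec_of_list [f x]" by auto
  have nn: "is_nn (length gs) 1 [(A, b)]" using Ab 1(1) by (auto simp: is_nn_def Suc_le_eq)
  have "nn_real [(A, b)] (vec_of_list (map (\<lambda>g. g x) gs)) = f x" for x
    unfolding nn_real_def nn_run.simps Ab(4) by (simp add: vec_of_list_index)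
  then show ?thesis
    by (intro exI[of _ "\<Psi> @ [(A, b)]"]) (use 1(3-6) nn Ab(3) in \<open>auto simp: nn_layers_def\<close>)
qed

lemma affine_over_matrix_row:
  assumes "\<And>z. z \<in> set zs \<Longrightarrow> affine_over F 2 z"
  shows "affine_over F (2 * card {j. j < length zs \<and> r j \<noteq> 0} + (if \<beta> = 0 then 0 else 1))
     (\<lambda>x. (\<Sum>j<length zs. r j * (zs ! j) x) + \<beta>)"
proof -
  let ?J = "{j. j < length zs \<and> r j \<noteq> 0}"
  have 1: "affine_over F (\<Sum>j\<in>?J. 2) (\<lambda>x. \<Sum>j\<in>?J. r j * (zs ! j) x)"
    by (rule affine_over_sum) (simp, rule affine_over_scale, rule assms, simp)
  have 2: "(\<Sum>j\<in>?J. r j * (zs ! j) x) = (\<Sum>j<length zs. r j * (zs ! j) x)" for x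
    by (rule sum.mono_neutral_left) auto
  have "affine_over F (if \<beta> = 0 then 0 else 1) (\<lambda>x. \<beta>)"
    using affine_over_zero[of F] affine_over_const[of F \<beta>] by auto
  from affine_over_add[OF 1 this] show ?thesis unfolding 2 by (simp add: mult.commute)
qed

text \<open>Each input of \<open>\<Phi>\<close> is an affine combination with budget 2. Through the
  skip connections every layer of \<open>\<Phi>\<close> may read these inputs, so they are
  substituted into all rows, which at most doubles the number of weights.\<close>

lemma relu_net_compose:
  assumes "relu_net I L W F" "is_nn (length zs) 1 \<Phi>" "\<And>z. z \<in> set zs \<Longrightarrow> affine_over F 2 z"
  shows "\<exists>F' f. relu_net I (L + nn_layers \<Phi>) (W + 2 * nn_weights \<Phi>) F' \<and> affine_over F' (2 * nn_weights \<Phi>) f \<and>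
    (\<forall>x. nn_real \<Phi> (vec_of_list (map (\<lambda>z. z x) zs)) = f x)"
  using assms
proof (induction \<Phi> arbitrary: L W F zs)
  case Nil
  then show ?case by (simp add: is_nn_def)
next
  case (Cons l \<Phi>)
  obtain A b where l: "l = (A, b)" by (cases l)
  define R where "R i = (\<lambda>x. (\<Sum>j<length zs. A $$ (i, j) * (zs ! j) x) + vec_index b i)" for i
  define p where "p i = 2 * card {j. j < length zs \<and> A $$ (i, j) \<noteq> 0} + (if vec_index b i = 0 then 0 else 1)" for i
  have aff: "affine_over F (p i) (R i)" for i
    unfolding p_def R_def by (rule affine_over_matrix_row) (rule Cons.prems(3))
  have car: "A \<in> carrier_mat (dim_vec b) (length zs)" "dim_vec b \<ge> 1"
    using Cons.prems(2) unfolding l is_nn_def by auto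
  have val: "vec_index (A *\<^sub>v vec_of_list (map (\<lambda>z. z x) zs) + b) i = R i x" if "i < dim_vec b" for i x
    using index_mult_mat_vec_list[of A "dim_vec b" "map (\<lambda>z. z x) zs" i b] car(1) that by (simp add: R_def)
  have psum: "(\<Sum>i<dim_vec b. p i) \<le> 2 * (nnz_mat A + nnz_vec b)"
  proof -
    have "(\<Sum>i<dim_vec b. p i) = 2 * nnz_mat A + nnz_vec b"
      unfolding p_def sum.distrib nnz_mat_rows nnz_vec_rows using car(1) by (simp add: sum_distrib_left)
    then show ?thesis by simp
  qed
  show ?case
  proof (cases "\<Phi> = []")
    case True
    have b1: "dim_vec b = 1" using Cons.prems(2) unfolding l True is_nn_def by simp
    have "affine_over F (2 * nn_weights (l # \<Phi>)) (R 0)"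
      by (rule affine_over_mono[OF aff[of 0]]) (use psum b1 in \<open>auto simp: l True\<close>)
    moreover have "nn_real (l # \<Phi>) (vec_of_list (map (\<lambda>z. z x) zs)) = R 0 x" for x
      using val[of 0 x] b1 by (simp add: l True nn_real_def)
    \<comment> \<open>The output layer is affine and creates no hidden neurons; padding keeps the
      depth count uniform with the other case.\<close>
    moreover have "relu_net I (L + nn_layers (l # \<Phi>)) (W + 2 * nn_weights (l # \<Phi>)) F"
      by (rule relu_net_mono[OF relu_net_pad[OF Cons.prems(1)]]) (auto simp: nn_layers_def)
    ultimately show ?thesis by blast
  next
    case False
    define hs where "hs = map (\<lambda>i x. max 0 (R i x)) [0..<dim_vec b]"
    let ?G = "(\<lambda>i x. max 0 (R i x)) ` {..<dim_vec b}"
    have Gex: "\<forall>g\<in>?G. \<exists>i<dim_vec b. g = (\<lambda>x. max 0 (R i x))" by auto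
    \<comment> \<open>Different rows can compute the same function and then collapse to one element
      of \<open>?G\<close>. Choosing one row index for each function keeps the total charge below
      the sum over all rows.\<close>
    then obtain \<iota> where \<iota>: "\<And>g. g \<in> ?G \<Longrightarrow> \<iota> g < dim_vec b \<and> g = (\<lambda>x. max 0 (R (\<iota> g) x))" by metis
    have inj: "inj_on \<iota> ?G"
    proof (rule inj_onI)
      fix g h assume gh: "g \<in> ?G" "h \<in> ?G" "\<iota> g = \<iota> h"
      have "g = (\<lambda>x. max 0 (R (\<iota> h) x))" using \<iota>[OF gh(1)] gh(3) by simp
      also have "\<dots> = h" using \<iota>[OF gh(2)] by simp
      finally show "g = h" .
    qed
    have "sum (\<lambda>g. p (\<iota> g)) ?G = sum p (\<iota> ` ?G)" using sum.reindex[OF inj, of p] by simp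
    also have "\<dots> \<le> (\<Sum>i<dim_vec b. p i)" by (rule sum_mono2) (use \<iota> in auto)
    finally have s: "sum (\<lambda>g. p (\<iota> g)) ?G \<le> 2 * (nnz_mat A + nnz_vec b)" using psum by linarith
    have net: "relu_net I (Suc L) (W + 2 * (nnz_mat A + nnz_vec b)) (F \<union> ?G)"
      by (rule relu_net.layer[OF Cons.prems(1), where w = "\<lambda>g. p (\<iota> g)"], simp)
         (use aff \<iota> in blast, use s in simp)
    have nn: "is_nn (length (zs @ hs)) 1 \<Phi>"
      using Cons.prems(2) unfolding l is_nn_Cons[OF False] by (simp add: hs_def)
    have mem: "affine_over (F \<union> ?G) 2 z" if "z \<in> set (zs @ hs)" for z
    proof (cases "z \<in> set zs")
      case True
      then show ?thesis using Cons.prems(3) by (auto intro: affine_over_mono)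
    next
      case False
      then have "z \<in> F \<union> ?G" using that by (auto simp: hs_def)
      from affine_over_member[OF this] show ?thesis by (auto intro: affine_over_mono)
    qed
    have relu: "map_vec (max 0) (A *\<^sub>v vec_of_list (map (\<lambda>z. z x) zs) + b) = vec_of_list (map (\<lambda>z. z x) hs)" for x
    proof (rule eq_vecI)
      fix i assume "i < dim_vec (vec_of_list (map (\<lambda>z. z x) hs))"
      then have i: "i < dim_vec b" by (simp add: hs_def)
      have "vec_index (map_vec (max 0) (A *\<^sub>v vec_of_list (map (\<lambda>z. z x) zs) + b)) i =
          max 0 (vec_index (A *\<^sub>v vec_of_list (map (\<lambda>z. z x) zs) + b) i)"
        by (rule index_map_vec(1)) (use i in simp)
      also have "\<dots> = max 0 (R i x)" unfolding val[OF i] ..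
      also have "\<dots> = vec_index (vec_of_list (map (\<lambda>z. z x) hs)) i"
        using i by (simp add: hs_def vec_of_list_index del: vec_of_list_map)
      finally show "vec_index (map_vec (max 0) (A *\<^sub>v vec_of_list (map (\<lambda>z. z x) zs) + b)) i =
          vec_index (vec_of_list (map (\<lambda>z. z x) hs)) i" .
    qed (simp add: hs_def)
    have run: "nn_real (l # \<Phi>) (vec_of_list (map (\<lambda>z. z x) zs)) = nn_real \<Phi> (vec_of_list (map (\<lambda>z. z x) (zs @ hs)))" for x
      unfolding nn_real_def l nn_run_append_layer[OF False] relu vec_of_list_append by simp
    from Cons.IH[OF net nn mem] obtain F' f where F': "relu_net I (Suc L + nn_layers \<Phi>)
        (W + 2 * (nnz_mat A + nnz_vec b) + 2 * nn_weights \<Phi>) F'" "affine_over F' (2 * nn_weights \<Phi>) f"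
      "\<And>x. nn_real \<Phi> (vec_of_list (map (\<lambda>z. z x) (zs @ hs))) = f x" by blast
    have "affine_over F' (2 * nn_weights (l # \<Phi>)) f"
      by (rule affine_over_mono[OF F'(2)]) (simp_all add: l)
    moreover have "relu_net I (L + nn_layers (l # \<Phi>)) (W + 2 * nn_weights (l # \<Phi>)) F'"
      using F'(1) by (simp add: l nn_layers_def algebra_simps)
    moreover have "\<forall>x. nn_real (l # \<Phi>) (vec_of_list (map (\<lambda>z. z x) zs)) = f x"
      using run F'(3) by metis
    ultimately show ?thesis by blast
  qed
qed

section \<open>Networks for products\<close>

text \<open>Sawtooth approximation. The invariant is \<open>g - f^2 = (1/4)^s * (h - h^2)\<close>,
  where \<open>h\<close> is the \<open>s\<close>-fold tent map applied to \<open>f\<close>.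
  Subtracting a quarter of the next tent value from \<open>h - h^2\<close> leaves a quarter of the
  same expression for that value. As \<open>h - h^2\<close> lies between 0 and 1/4, the square is
  approximated from above. A round adds two neurons with 2 + 3 weights, and \<open>g\<close>
  collects all tent values by skip connections.\<close>

lemma relu_net_square:
  assumes "relu_net I L W F" "affine_over F q f" "\<And>x. x \<in> \<Omega> \<Longrightarrow> 0 \<le> f x \<and> f x \<le> 1"
  shows "\<exists>F' g. F \<subseteq> F' \<and> relu_net I (L + 1 + 2 * s) (W + q + 5 * s) F' \<and> affine_over F' (2 * s + 1) g \<and>
    (\<forall>x\<in>\<Omega>. 0 \<le> g x \<and> g x \<le> 1 \<and> 0 \<le> g x - (f x)\<^sup>2 \<and> g x - (f x)\<^sup>2 \<le> (1/4) ^ Suc s)"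
proof -
  have scaled: "p * d - 1/4 * p * k = 1/4 * p * r" if "d - k / 4 = r / 4" for p d k r :: real
  proof -
    have "p * d - 1/4 * p * k = p * (d - k / 4)" by (simp add: algebra_simps)
    then show ?thesis unfolding that by simp
  qed
  have ind: "\<exists>F' g h. F \<subseteq> F' \<and> relu_net I (L + 1 + 2 * s) (W + q + 5 * s) F' \<and> affine_over F' (2 * s + 1) g \<and>
    affine_over F' 2 h \<and>
    (\<forall>x\<in>\<Omega>. 0 \<le> h x \<and> h x \<le> 1 \<and> g x \<le> f x \<and> g x - (f x)\<^sup>2 = (1/4) ^ s * (h x - (h x)\<^sup>2))" for s
  proof (induction s)
    case 0
    let ?g = "\<lambda>x. max 0 (f x)"
    have "relu_net I (Suc L) (W + q) (insert ?g F)" by (rule relu_net_extend[OF assms(1,2)])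
    moreover have "affine_over (insert ?g F) 1 ?g" by (rule affine_over_member) simp
    moreover from this have "affine_over (insert ?g F) 2 ?g" by (rule affine_over_mono) auto
    ultimately show ?case
      by (intro exI[of _ "insert ?g F"] exI[of _ ?g]) (use assms(3) in auto)
  next
    case (Suc s)
    then obtain F' g h where IH: "F \<subseteq> F'" "relu_net I (L + 1 + 2 * s) (W + q + 5 * s) F'"
      "affine_over F' (2 * s + 1) g" "affine_over F' 2 h"
      "\<And>x. x \<in> \<Omega> \<Longrightarrow> 0 \<le> h x \<and> h x \<le> 1 \<and> g x \<le> f x \<and> g x - (f x)\<^sup>2 = (1/4) ^ s * (h x - (h x)\<^sup>2)"
      by blast
    define r1 where "r1 = (\<lambda>x. max 0 (h x))"
    define r2 where "r2 = (\<lambda>x. max 0 (h x - 1/2))"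
    define F1 where "F1 = insert r1 F'"
    define F2 where "F2 = insert r2 F1"
    have n1: "relu_net I (Suc (L + 1 + 2 * s)) (W + q + 5 * s + 2) F1"
      unfolding F1_def r1_def by (rule relu_net_extend[OF IH(2,4)])
    have "affine_over F1 (2 + 1) (\<lambda>x. h x - 1/2)"
      by (intro affine_over_diff affine_over_const affine_over_mono[OF IH(4)]) (auto simp: F1_def)
    then have n2: "relu_net I (Suc (Suc (L + 1 + 2 * s))) (W + q + 5 * s + 2 + 3) F2"
      unfolding F2_def r2_def by (intro relu_net_extend[OF n1]) simp
    \<comment> \<open>The tent map: slope 2 up to 1/2, slope -2 beyond.\<close>
    let ?h = "\<lambda>x. 2 * r1 x - 4 * r2 x"
    have "affine_over F2 (1 + 1) ?h"
      by (intro affine_over_diff affine_over_scale affine_over_member) (auto simp: F2_def F1_def)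
    then have h: "affine_over F2 2 ?h" by (simp add: numeral_2_eq_2)
    have "affine_over F2 (2 * s + 1 + 2) (\<lambda>x. g x - (1/4)^Suc s * ?h x)"
      by (intro affine_over_diff affine_over_scale[OF h] affine_over_mono[OF IH(3)]) (auto simp: F2_def F1_def)
    moreover have "0 \<le> ?h x \<and> ?h x \<le> 1 \<and> g x - (1/4)^Suc s * ?h x \<le> f x \<and>
      g x - (1/4)^Suc s * ?h x - (f x)\<^sup>2 = (1/4) ^ Suc s * (?h x - (?h x)\<^sup>2)" if "x \<in> \<Omega>" for x
    proof -
      note * = IH(5)[OF that]
      have b: "0 \<le> ?h x \<and> ?h x \<le> 1" using * by (auto simp: r1_def r2_def max_def)
      have "(0::real) \<le> (1/4)^Suc s" by simp
      then have "0 \<le> (1/4)^Suc s * ?h x" using b by (intro mult_nonneg_nonneg) auto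
      then have "g x - (1/4)^Suc s * ?h x \<le> f x" using * by linarith
      moreover have "h x - (h x)\<^sup>2 - ?h x / 4 = (?h x - (?h x)\<^sup>2) / 4"
      proof (cases "h x \<le> 1/2")
        case True
        then have "?h x = 2 * h x" using * by (simp add: r1_def r2_def)
        then show ?thesis by (simp only:) (simp add: power2_eq_square field_simps)
      next
        case False
        then have "?h x = 2 - 2 * h x" using * by (simp add: r1_def r2_def)
        then show ?thesis by (simp only:) (simp add: power2_eq_square field_simps)
      qed
      then have "(1/4)^s * (h x - (h x)\<^sup>2) - (1/4)^Suc s * ?h x = (1/4) ^ Suc s * (?h x - (?h x)\<^sup>2)"
        unfolding power_Suc by (rule scaled)
      ultimately show ?thesis using b * by auto
    qed
    ultimately show ?case using n2 h IH(1)
      by (intro exI[of _ F2] exI[of _ "\<lambda>x. g x - (1/4)^Suc s * ?h x"] exI[of _ ?h])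
         (auto simp: F2_def F1_def algebra_simps)
  qed
  from ind[of s] obtain F' g h where *: "F \<subseteq> F'" "relu_net I (L + 1 + 2 * s) (W + q + 5 * s) F'"
     "affine_over F' (2 * s + 1) g"
    "\<And>x. x \<in> \<Omega> \<Longrightarrow> 0 \<le> h x \<and> h x \<le> 1 \<and> g x \<le> f x \<and> g x - (f x)\<^sup>2 = (1/4) ^ s * (h x - (h x)\<^sup>2)"
    by blast
  have "0 \<le> g x \<and> g x \<le> 1 \<and> 0 \<le> g x - (f x)\<^sup>2 \<and> g x - (f x)\<^sup>2 \<le> (1/4) ^ Suc s" if x: "x \<in> \<Omega>" for x
  proof -
    note h = *(4)[OF x]
    have 1: "0 \<le> h x - (h x)\<^sup>2" using h by (simp add: power2_eq_square mult_left_le_one_le)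
    have "0 \<le> (h x - 1/2)\<^sup>2" by simp
    then have 2: "h x - (h x)\<^sup>2 \<le> 1/4" by (simp add: power2_eq_square algebra_simps)
    have 3: "0 \<le> g x - (f x)\<^sup>2" using h 1 by simp
    have "g x - (f x)\<^sup>2 \<le> (1/4)^s * (1/4)" using h mult_left_mono[OF 2, of "(1/4)^s"] by simp
    moreover have "0 \<le> (f x)\<^sup>2" by simp
    then have "0 \<le> g x" using 3 by linarith
    moreover have "g x \<le> 1" using h assms(3)[OF x] by linarith
    ultimately show ?thesis using 3 by simp
  qed
  with * show ?thesis by blast
qed

text \<open>Polarisation: the product is the difference of the squares of half the sum and half the
  difference. Absolute values bring both into the unit interval. Both squares are overestimated by
  at most \<open>(1/4) ^ Suc s\<close>, so the two errors partly cancel instead of adding up; and a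
  difference of two numbers in the unit interval again has modulus at most 1, which permits
  iteration.\<close>

lemma relu_net_product:
  assumes "relu_net I L W F" "affine_over F p f" "affine_over F q g"
    and bnd: "\<And>x. x \<in> \<Omega> \<Longrightarrow> \<bar>f x\<bar> \<le> 1" "\<And>x. x \<in> \<Omega> \<Longrightarrow> \<bar>g x\<bar> \<le> 1"
  shows "\<exists>F' h. F \<subseteq> F' \<and> relu_net I (L + 6 + 4 * s) (W + 4 * (p + q) + 4 + 10 * s) F' \<and>
    affine_over F' (4 * s + 2) h \<and> (\<forall>x\<in>\<Omega>. \<bar>h x\<bar> \<le> 1 \<and> \<bar>h x - f x * g x\<bar> \<le> (1/4) ^ Suc s)"
proof -
  define u where "u = (\<lambda>x. (1/2) * (f x + g x))"
  define v where "v = (\<lambda>x. (1/2) * (f x - g x))"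
  have u: "affine_over F (p + q) u" unfolding u_def by (intro affine_over_scale affine_over_add assms(2,3))
  have v: "affine_over F (p + q) v" unfolding v_def by (intro affine_over_scale affine_over_diff assms(2,3))
  have abs_net: "\<exists>F'. F \<subseteq> F' \<and> relu_net I (L + 2) (W + 2 * k) F' \<and> affine_over F' 2 (\<lambda>x. \<bar>w x\<bar>)"
    if "relu_net I L W F" "affine_over F k w" for w :: "'a \<Rightarrow> real" and k L W F
  proof -
    let ?F1 = "insert (\<lambda>x. max 0 (w x)) F" 
    let ?F2 = "insert (\<lambda>x. max 0 ((-1) * w x)) ?F1"
    have "relu_net I (Suc L) (W + k) ?F1" by (rule relu_net_extend[OF that])
    moreover have "affine_over ?F1 k (\<lambda>x. (-1) * w x)"
      by (rule affine_over_mono[OF affine_over_scale[OF that(2)]]) auto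
    ultimately have n: "relu_net I (Suc (Suc L)) (W + k + k) ?F2" by (rule relu_net_extend)
    have "affine_over ?F2 (1 + 1) (\<lambda>x. max 0 (w x) + max 0 ((-1) * w x))"
      by (intro affine_over_add affine_over_member) auto
    moreover have "(\<lambda>x. max 0 (w x) + max 0 ((-1) * w x)) = (\<lambda>x. \<bar>w x\<bar>)" by (auto simp: max_def abs_if)
    ultimately have "affine_over ?F2 2 (\<lambda>x. \<bar>w x\<bar>)" by (simp add: numeral_2_eq_2)
    with n show ?thesis
      by (intro exI[of _ ?F2]) (auto simp: mult_2 simp flip: add.assoc)
  qed
  from abs_net[OF assms(1) u] obtain F1 where F1: "F \<subseteq> F1" "relu_net I (L + 2) (W + 2 * (p + q)) F1"
    "affine_over F1 2 (\<lambda>x. \<bar>u x\<bar>)" by blast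
  from abs_net[OF F1(2) affine_over_mono[OF v F1(1) order_refl]]
  obtain F2 where F2: "F1 \<subseteq> F2" "relu_net I (L + 2 + 2) (W + 2 * (p + q) + 2 * (p + q)) F2"
    "affine_over F2 2 (\<lambda>x. \<bar>v x\<bar>)" by blast
  have "\<exists>F' g. F2 \<subseteq> F' \<and> relu_net I ((L + 2 + 2) + 1 + 2 * s) ((W + 2 * (p + q) + 2 * (p + q)) + 2 + 5 * s) F' \<and>
     affine_over F' (2 * s + 1) g \<and>
    (\<forall>x\<in>\<Omega>. 0 \<le> g x \<and> g x \<le> 1 \<and> 0 \<le> g x - (\<bar>u x\<bar>)\<^sup>2 \<and> g x - (\<bar>u x\<bar>)\<^sup>2 \<le> (1/4) ^ Suc s)"
    by (rule relu_net_square[OF F2(2) affine_over_mono[OF F1(3) F2(1) order_refl]])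
       (use bnd in \<open>auto simp: u_def abs_le_iff\<close>, (smt (verit))+)
  then obtain F3 U where F3: "F2 \<subseteq> F3"
    "relu_net I ((L + 2 + 2) + 1 + 2 * s) ((W + 2 * (p + q) + 2 * (p + q)) + 2 + 5 * s) F3"
    "affine_over F3 (2 * s + 1) U"
    "\<And>x. x \<in> \<Omega> \<Longrightarrow> 0 \<le> U x \<and> U x \<le> 1 \<and> 0 \<le> U x - (\<bar>u x\<bar>)\<^sup>2 \<and> U x - (\<bar>u x\<bar>)\<^sup>2 \<le> (1/4) ^ Suc s" by blast
  have "\<exists>F' g. F3 \<subseteq> F' \<and> relu_net I (((L + 2 + 2) + 1 + 2 * s) + 1 + 2 * s)
      (((W + 2 * (p + q) + 2 * (p + q)) + 2 + 5 * s) + 2 + 5 * s) F' \<and>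
     affine_over F' (2 * s + 1) g \<and>
    (\<forall>x\<in>\<Omega>. 0 \<le> g x \<and> g x \<le> 1 \<and> 0 \<le> g x - (\<bar>v x\<bar>)\<^sup>2 \<and> g x - (\<bar>v x\<bar>)\<^sup>2 \<le> (1/4) ^ Suc s)"
    by (rule relu_net_square[OF F3(2) affine_over_mono[OF F2(3) F3(1) order_refl]])
       (use bnd in \<open>auto simp: v_def abs_le_iff\<close>, (smt (verit))+)
  then obtain F4 V where F4: "F3 \<subseteq> F4" "relu_net I (((L + 2 + 2) + 1 + 2 * s) + 1 + 2 * s)
      (((W + 2 * (p + q) + 2 * (p + q)) + 2 + 5 * s) + 2 + 5 * s) F4"
    "affine_over F4 (2 * s + 1) V"
    "\<And>x. x \<in> \<Omega> \<Longrightarrow> 0 \<le> V x \<and> V x \<le> 1 \<and> 0 \<le> V x - (\<bar>v x\<bar>)\<^sup>2 \<and> V x - (\<bar>v x\<bar>)\<^sup>2 \<le> (1/4) ^ Suc s" by blast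
  have "affine_over F4 (2 * s + 1 + (2 * s + 1)) (\<lambda>x. U x - V x)"
    by (rule affine_over_diff[OF affine_over_mono[OF F3(3) F4(1) order_refl] F4(3)])
  moreover have "2 * s + 1 + (2 * s + 1) = 4 * s + 2" by simp
  moreover have "\<bar>U x - V x\<bar> \<le> 1 \<and> \<bar>(U x - V x) - f x * g x\<bar> \<le> (1/4) ^ Suc s" if "x \<in> \<Omega>" for x
  proof -
    have "f x * g x = (\<bar>u x\<bar>)\<^sup>2 - (\<bar>v x\<bar>)\<^sup>2"
      by (simp add: u_def v_def power2_eq_square field_simps)
    then show ?thesis using F3(4)[OF that] F4(4)[OF that] unfolding abs_le_iff by linarith
  qed
  moreover have "relu_net I (L + 6 + 4 * s) (W + 4 * (p + q) + 4 + 10 * s) F4"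
    using F4(2) by (simp add: algebra_simps numeral_eq_Suc)
  ultimately show ?thesis using F1(1) F2(1) F3(1) F4(1)
    by (intro exI[of _ F4] exI[of _ "\<lambda>x. U x - V x"]) auto
qed

text \<open>All factors and all partial results have modulus at most 1, so errors add up without
  amplification. The charge for one more factor is that of \<open>relu_net_product\<close> with
  fan-ins \<open>q\<close> and \<open>4 * s + 3\<close>.\<close>

lemma relu_net_prod_list:
  assumes "relu_net I L W F"
    and "\<And>f. f \<in> set fs \<Longrightarrow> affine_over F q f" "\<And>f x. f \<in> set fs \<Longrightarrow> x \<in> \<Omega> \<Longrightarrow> \<bar>f x\<bar> \<le> 1"
  shows "\<exists>F' h. F \<subseteq> F' \<and> relu_net I (L + length fs * (6 + 4 * s)) (W + length fs * (26 * s + 16 + 4 * q)) F' \<and>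
    affine_over F' (4 * s + 3) h \<and>
    (\<forall>x\<in>\<Omega>. \<bar>h x\<bar> \<le> 1 \<and> \<bar>h x - (\<Prod>f\<leftarrow>fs. f x)\<bar> \<le> length fs * (1/4) ^ Suc s)"
  using assms(2,3)
proof (induction fs)
  case Nil
  have "affine_over F (4 * s + 3) (\<lambda>x. 1)" by (rule affine_over_mono[OF affine_over_const]) auto
  then show ?case using assms(1) by (intro exI[of _ F] exI[of _ "\<lambda>x. 1"]) auto
next
  case (Cons f fs)
  then obtain F1 h where IH: "F \<subseteq> F1"
    "relu_net I (L + length fs * (6 + 4 * s)) (W + length fs * (26 * s + 16 + 4 * q)) F1"
    "affine_over F1 (4 * s + 3) h"
    "\<And>x. x\<in>\<Omega> \<Longrightarrow> \<bar>h x\<bar> \<le> 1 \<and> \<bar>h x - (\<Prod>f\<leftarrow>fs. f x)\<bar> \<le> length fs * (1/4) ^ Suc s"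
    by (auto 0 3 simp del: power_Suc)
  have "affine_over F1 q f" using Cons.prems(1) IH(1) by (auto intro: affine_over_mono)
  from relu_net_product[OF IH(2) this IH(3), of \<Omega> s] obtain F2 g where F2: "F1 \<subseteq> F2"
    "relu_net I (L + length fs * (6 + 4 * s) + 6 + 4 * s)
      (W + length fs * (26 * s + 16 + 4 * q) + 4 * (q + (4 * s + 3)) + 4 + 10 * s) F2"
    "affine_over F2 (4 * s + 2) g"
    "\<And>x. x\<in>\<Omega> \<Longrightarrow> \<bar>g x\<bar> \<le> 1 \<and> \<bar>g x - f x * h x\<bar> \<le> (1/4) ^ Suc s"
    using Cons.prems(2) IH(4) by (auto simp del: power_Suc)
  have "\<bar>g x - (\<Prod>f\<leftarrow>f # fs. f x)\<bar> \<le> length (f # fs) * (1/4) ^ Suc s" if "x \<in> \<Omega>" for x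
  proof -
    have "\<bar>f x * h x - f x * (\<Prod>f\<leftarrow>fs. f x)\<bar> = \<bar>f x\<bar> * \<bar>h x - (\<Prod>f\<leftarrow>fs. f x)\<bar>"
      by (simp add: abs_mult[symmetric] algebra_simps)
    also have "\<dots> \<le> 1 * (length fs * (1/4) ^ Suc s)"
      using IH(4)[OF that] Cons.prems(2)[of f x] that by (intro mult_mono) auto
    finally have "\<bar>f x * h x - (\<Prod>f\<leftarrow>f # fs. f x)\<bar> \<le> length fs * (1/4) ^ Suc s" by simp
    moreover have "\<bar>g x - f x * h x\<bar> \<le> (1/4) ^ Suc s" using F2(4)[OF that] by simp
    moreover have "length (f # fs) * (1/4::real) ^ Suc s = length fs * (1/4) ^ Suc s + (1/4) ^ Suc s"
      by (simp add: algebra_simps)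
    ultimately show ?thesis by linarith
  qed
  moreover have "affine_over F2 (4 * s + 3) g" by (rule affine_over_mono[OF F2(3)]) auto
  moreover have "relu_net I (L + length (f # fs) * (6 + 4 * s)) (W + length (f # fs) * (26 * s + 16 + 4 * q)) F2"
    using F2(2) by (simp add: algebra_simps)
  ultimately show ?case using F2(1,4) IH(1)
    by (intro exI[of _ F2] exI[of _ g]) (auto simp del: power_Suc)
qed

section \<open>Networks for locally polynomial functions\<close>

text \<open>Words of basis vectors take the place of multi-indices, matching \<^const>\<open>iter_partial\<close>: one monomial is given by
  several words, and no symmetry of derivatives is used.\<close>

definition words :: "nat \<Rightarrow> 'a::euclidean_space list set" where
  "words k = {w. set w \<subseteq> Basis \<and> length w < k}"

definition word_monomial :: "'a::euclidean_space list \<Rightarrow> 'a \<Rightarrow> real" where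
  "word_monomial w v = (\<Prod>b\<leftarrow>w. v \<bullet> b)"

lemma word_monomial_simps [simp]: "word_monomial [] v = 1" "word_monomial (b # w) v = (v \<bullet> b) * word_monomial w v"
  "word_monomial (u @ w) v = word_monomial u v * word_monomial w v"
  by (simp_all add: word_monomial_def)

lemma finite_words [simp]: "finite (words k :: 'a::euclidean_space list set)"
proof -
  have "words k \<subseteq> {w::'a list. set w \<subseteq> Basis \<and> length w \<le> k}" by (auto simp: words_def)
  then show ?thesis by (rule finite_subset) (rule finite_lists_length_le, simp)
qed

text \<open>The coefficients need a bound as well as the error, because in the network they multiply
  the errors of the approximate monomials. Neighbourhoods are cubes, to fit the grid, and the centre
  must lie in \<open>\<Omega>\<close>.\<close>

definition locally_polynomial ::
    "nat \<Rightarrow> real \<Rightarrow> real \<Rightarrow> 'a::euclidean_space set \<Rightarrow> ('a \<Rightarrow> real) \<Rightarrow> bool" where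
  "locally_polynomial k A h \<Omega> f \<longleftrightarrow> (\<forall>c\<in>\<Omega>. \<exists>a. (\<forall>w\<in>words k. \<bar>a w\<bar> \<le> A) \<and>
     (\<forall>p\<in>\<Omega>. (\<forall>b\<in>Basis. \<bar>(p - c) \<bullet> b\<bar> \<le> h) \<longrightarrow>
        \<bar>f p - (\<Sum>w\<in>words k. a w * word_monomial w (p - c))\<bar> \<le> A * h ^ k))"

section \<open>Hat functions and the partition of unity on a grid\<close>

definition hat :: "real \<Rightarrow> real" where
  "hat t = max 0 (1 - \<bar>t\<bar>)"

lemma hat_relu: "hat t = max 0 (t + 1) - 2 * max 0 t + max 0 (t - 1)"
  by (auto simp: hat_def max_def abs_if)

lemma hat_bounds: "0 \<le> hat t" "hat t \<le> 1" "\<bar>hat t\<bar> \<le> 1"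
  by (auto simp: hat_def)

text \<open>Only the hats at the floor of \<open>t\<close> and at its successor can be nonzero at
  \<open>t\<close>, and these two are linear interpolation weights. The margin 1 in the hypothesis
  keeps both indices in the range.\<close>

lemma sum_hat:
  fixes J :: int and t :: real
  assumes "\<bar>t\<bar> \<le> J - 1"
  shows "(\<Sum>j\<in>{-J..J}. hat (t - of_int j)) = 1"
proof -
  let ?m = "\<lfloor>t\<rfloor>"
  have fl: "of_int ?m \<le> t" "t < of_int ?m + 1" by linarith+
  have rg: "?m \<ge> -J" "?m + 1 \<le> J" using assms fl by linarith+
  have "(\<Sum>j\<in>{-J..J}. hat (t - of_int j)) = (\<Sum>j\<in>{?m, ?m + 1}. hat (t - of_int j))"
  proof (rule sum.mono_neutral_right)
    show "\<forall>i\<in>{- J..J} - {?m, ?m + 1}. hat (t - of_int i) = 0"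
    proof
      fix i assume "i \<in> {- J..J} - {?m, ?m + 1}"
      then have "i \<le> ?m - 1 \<or> i \<ge> ?m + 2" by auto
      then have "of_int i \<le> t - 1 \<or> of_int i \<ge> t + 1" using fl by linarith
      then show "hat (t - of_int i) = 0" by (auto simp: hat_def)
    qed
  qed (use rg in auto)
  also have "\<dots> = hat (t - of_int ?m) + hat (t - of_int ?m - 1)" by (simp add: algebra_simps)
  also have "\<dots> = 1" unfolding hat_def using fl by linarith
  finally show ?thesis .
qed

text \<open>The three neurons of a hat are put on consecutive layers. This is wasteful in depth but
  harmless, since the number of hats is the fixed dimension.\<close>

lemma relu_net_hats:
  assumes "\<And>b. b \<in> set bs \<Longrightarrow> affine_over I 2 (t b)"
  shows "\<exists>F. relu_net I (3 * length bs) (9 * length bs) F \<and> (\<forall>b\<in>set bs. affine_over F 3 (\<lambda>x. hat (t b x)))"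
  using assms
proof (induction bs)
  case Nil
  show ?case using relu_net.input[of I 0] by auto
next
  case (Cons b bs)
  then obtain F where F: "relu_net I (3 * length bs) (9 * length bs) F"
    "\<And>b. b \<in> set bs \<Longrightarrow> affine_over F 3 (\<lambda>x. hat (t b x))" by auto
  have t: "affine_over F' 3 (\<lambda>x. t b x + r)" if "F \<subseteq> F'" for F' r
  proof -
    have "affine_over F' (2 + 1) (\<lambda>x. t b x + r)"
      by (rule affine_over_add[OF _ affine_over_const], rule affine_over_mono[of I 2])
         (use Cons.prems relu_net_inputs[OF F(1)] that in auto)
    then show ?thesis by simp
  qed
  let ?r = "\<lambda>r x. max 0 (t b x + r)"
  let ?F1 = "insert (?r 1) F" and ?F2 = "insert (?r 0) (insert (?r 1) F)"
  let ?F3 = "insert (?r (- 1)) ?F2"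
  have "relu_net I (Suc (3 * length bs)) (9 * length bs + 3) ?F1"
    by (rule relu_net_extend[OF F(1) t]) auto
  then have "relu_net I (Suc (Suc (3 * length bs))) (9 * length bs + 3 + 3) ?F2"
    by (rule relu_net_extend[OF _ t]) auto
  then have n3: "relu_net I (Suc (Suc (Suc (3 * length bs)))) (9 * length bs + 3 + 3 + 3) ?F3"
    by (rule relu_net_extend[OF _ t]) auto
  have "affine_over ?F3 (1 + 1 + 1) (\<lambda>x. ?r 1 x - 2 * ?r 0 x + ?r (-1) x)"
    by (intro affine_over_add affine_over_diff affine_over_scale affine_over_member) auto
  then have "affine_over ?F3 3 (\<lambda>x. hat (t b x))"
    by (simp add: hat_relu numeral_3_eq_3)
  moreover have "affine_over ?F3 3 (\<lambda>x. hat (t b' x))" if "b' \<in> set bs" for b'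
    by (rule affine_over_mono[OF F(2)[OF that]]) auto
  ultimately show ?case using n3
    by (intro exI[of _ ?F3]) (auto simp: algebra_simps eval_nat_numeral)
qed

text \<open>Factors of a product network must have modulus at most 1. Hats satisfy this, and
  coordinates of \<open>p - c\<close> do so after division by \<open>2 * R\<close>, as
  \<open>p\<close> and \<open>c\<close> both have coordinates of modulus at most \<open>R\<close>.
  The lost power of \<open>2 * R\<close> is restored later in the coefficient.\<close>

lemma relu_net_grid_term:
  fixes w :: "'a::euclidean_space list" and c :: 'a and m :: "'a \<Rightarrow> int"
  assumes I: "\<And>b. b \<in> Basis \<Longrightarrow> (\<lambda>p. p \<bullet> b) \<in> I"
    and w: "w \<in> words k" and c: "c \<in> \<Omega>" and R: "R > 0" "\<And>p b. p \<in> \<Omega> \<Longrightarrow> b \<in> Basis \<Longrightarrow> \<bar>p \<bullet> b\<bar> \<le> R"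
  shows "\<exists>F h. relu_net I (3 * DIM('a) + (DIM('a) + k) * (6 + 4 * s))
      (9 * DIM('a) + (DIM('a) + k) * (26 * s + 28)) F \<and> affine_over F (4 * s + 3) h \<and>
    (\<forall>p\<in>\<Omega>. \<bar>h p - (\<Prod>b\<in>Basis. hat (N * (p \<bullet> b) - of_int (m b))) * (word_monomial w (p - c) / (2 * R) ^ length w)\<bar>
       \<le> (DIM('a) + k) * (1/4) ^ Suc s)"
proof -
  obtain bs :: "'a list" where bs: "set bs = Basis" "distinct bs" using finite_distinct_list[OF finite_Basis] by blast
  have lbs: "length bs = DIM('a)" using distinct_card[OF bs(2)] bs(1) by simp
  define t where "t b = (\<lambda>p. N * (p \<bullet> b) - of_int (m b))" for b
  have aff: "affine_over I 2 (\<lambda>p. r * (p \<bullet> b) - z)" if "b \<in> Basis" for b r z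
    using affine_over_diff[OF affine_over_scale[OF affine_over_member[OF I[OF that]]] affine_over_const, of r z]
    by (simp add: numeral_2_eq_2)
  have "\<exists>F. relu_net I (3 * length bs) (9 * length bs) F \<and> (\<forall>b\<in>set bs. affine_over F 3 (\<lambda>x. hat (t b x)))"
    by (rule relu_net_hats) (use aff bs(1) in \<open>auto simp: t_def\<close>)
  then obtain F0 where F0: "relu_net I (3 * length bs) (9 * length bs) F0"
    "\<And>b. b \<in> Basis \<Longrightarrow> affine_over F0 3 (\<lambda>x. hat (t b x))" using bs(1) by auto
  define fs where "fs = map (\<lambda>b p. hat (t b p)) bs @ map (\<lambda>b p. (1 / (2 * R)) * (p \<bullet> b) - (c \<bullet> b) / (2 * R)) w"
  have wB: "set w \<subseteq> Basis" "length w < k" using w by (auto simp: words_def)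
  have a: "affine_over F0 3 f" if f: "f \<in> set fs" for f
  proof -
    from f consider b where "b \<in> Basis" "f = (\<lambda>p. hat (t b p))"
      | b where "b \<in> Basis" "f = (\<lambda>p. (1 / (2 * R)) * (p \<bullet> b) - (c \<bullet> b) / (2 * R))"
      using wB(1) bs(1) unfolding fs_def by auto
    then show ?thesis
    proof cases
      case 1 then show ?thesis using F0(2) by simp
    next
      case 2 then show ?thesis
        using affine_over_mono[OF aff[OF 2(1)] relu_net_inputs[OF F0(1)], of 3 "1 / (2 * R)" "c \<bullet> b / (2 * R)"] by simp
    qed
  qed
  have b: "\<bar>f p\<bar> \<le> 1" if f: "f \<in> set fs" "p \<in> \<Omega>" for f p
  proof -
    from f consider b where "b \<in> Basis" "f = (\<lambda>p. hat (t b p))"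
      | b where "b \<in> Basis" "f = (\<lambda>p. (1 / (2 * R)) * (p \<bullet> b) - (c \<bullet> b) / (2 * R))"
      using wB(1) bs(1) unfolding fs_def by auto
    then show ?thesis
    proof cases
      case 1 then show ?thesis using hat_bounds by simp
    next
      case 2
      have "\<bar>p \<bullet> b - c \<bullet> b\<bar> \<le> 2 * R" using R(2)[OF f(2) 2(1)] R(2)[OF c 2(1)] by linarith
      moreover have "f p = (p \<bullet> b - c \<bullet> b) / (2 * R)" using 2 by (simp add: diff_divide_distrib)
      ultimately show ?thesis using R(1) by (simp add: abs_divide)
    qed
  qed
  have "\<exists>F' h. F0 \<subseteq> F' \<and>
    relu_net I (3 * length bs + length fs * (6 + 4 * s)) (9 * length bs + length fs * (26 * s + 16 + 4 * 3)) F' \<and>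
    affine_over F' (4 * s + 3) h \<and>
    (\<forall>x\<in>\<Omega>. \<bar>h x\<bar> \<le> 1 \<and> \<bar>h x - (\<Prod>f\<leftarrow>fs. f x)\<bar> \<le> length fs * (1/4) ^ Suc s)"
    by (rule relu_net_prod_list[OF F0(1)]) (fact a, fact b)
  then obtain F h where F:
    "relu_net I (3 * length bs + length fs * (6 + 4 * s)) (9 * length bs + length fs * (26 * s + 16 + 4 * 3)) F"
    "affine_over F (4 * s + 3) h"
    "\<And>p. p \<in> \<Omega> \<Longrightarrow> \<bar>h p - (\<Prod>f\<leftarrow>fs. f p)\<bar> \<le> length fs * (1/4) ^ Suc s" by blast
  have lf: "length fs \<le> DIM('a) + k" using wB(2) lbs by (simp add: fs_def)
  have net: "relu_net I (3 * DIM('a) + (DIM('a) + k) * (6 + 4 * s))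
      (9 * DIM('a) + (DIM('a) + k) * (26 * s + 28)) F"
  proof (rule relu_net_mono[OF relu_net_pad[OF F(1)]])
    show "3 * length bs + length fs * (6 + 4 * s) \<le> 3 * DIM('a) + (DIM('a) + k) * (6 + 4 * s)"
      unfolding lbs by (intro add_left_mono mult_right_mono lf) simp
    have "length fs * (26 * s + 28) \<le> (DIM('a) + k) * (26 * s + 28)" by (intro mult_right_mono lf) simp
    then show "9 * length bs + length fs * (26 * s + 16 + 4 * 3) \<le> 9 * DIM('a) + (DIM('a) + k) * (26 * s + 28)"
      unfolding lbs by (simp add: add.commute)
  qed
  have mono_list: "(\<Prod>b\<leftarrow>w. (1 / (2 * R)) * (p \<bullet> b) - (c \<bullet> b) / (2 * R)) = word_monomial w (p - c) / (2 * R) ^ length w" for p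
    by (induction w) (auto simp: word_monomial_def inner_diff_left diff_divide_distrib[symmetric])
  have prod: "(\<Prod>f\<leftarrow>fs. f p) = (\<Prod>b\<in>Basis. hat (N * (p \<bullet> b) - of_int (m b))) * (word_monomial w (p - c) / (2 * R) ^ length w)" for p
  proof -
    have "(\<Prod>f\<leftarrow>fs. f p) = (\<Prod>b\<leftarrow>bs. hat (t b p)) * (\<Prod>b\<leftarrow>w. (1 / (2 * R)) * (p \<bullet> b) - (c \<bullet> b) / (2 * R))"
      by (simp add: fs_def o_def)
    also have "(\<Prod>b\<leftarrow>bs. hat (t b p)) = (\<Prod>b\<in>Basis. hat (t b p))"
      using prod.distinct_set_conv_list[OF bs(2), of "\<lambda>b. hat (t b p)"] bs(1) by simp
    finally show ?thesis unfolding mono_list by (simp add: t_def)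
  qed
  have "real (length fs) * (1/4) ^ Suc s \<le> (DIM('a) + k) * (1/4) ^ Suc s"
    by (rule mult_right_mono) (use lf in auto)
  with F(2,3) net show ?thesis unfolding prod by (meson order_trans)
qed

text \<open>The local polynomials are averaged with the partition of unity, so the local error
  \<open>A * (2 / N) ^ k\<close> survives unchanged. The second error term is the number of summands
  times the largest coefficient times the error of one product network.\<close>

lemma grid_approximation:
  fixes f :: "'a::euclidean_space \<Rightarrow> real"
  assumes I: "\<And>b. b \<in> Basis \<Longrightarrow> (\<lambda>p. p \<bullet> b) \<in> I"
    and R: "R \<ge> 1" "\<And>p b. p \<in> \<Omega> \<Longrightarrow> b \<in> Basis \<Longrightarrow> \<bar>p \<bullet> b\<bar> \<le> R"
    and A: "A \<ge> 0" and N: "N > (0::real)" and lp: "locally_polynomial k A (2 / N) \<Omega> f"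
    and n: "n = (2 * nat \<lceil>R * N\<rceil> + 3) ^ DIM('a) * card (words k :: 'a list set)"
  shows "\<exists>F g. relu_net I (3 * DIM('a) + (DIM('a) + k) * (6 + 4 * s))
      (n * (9 * DIM('a) + (DIM('a) + k) * (26 * s + 28))) F \<and> affine_over F (n * (4 * s + 3)) g \<and>
    (\<forall>p\<in>\<Omega>. \<bar>f p - g p\<bar> \<le> A * (2 / N) ^ k + n * (A * (2 * R) ^ k * ((DIM('a) + k) * (1/4) ^ Suc s)))"
proof -
  \<comment> \<open>The extra 1 provides the margin that \<open>sum_hat\<close> requires; it leads
    to \<open>2 * J + 1 = 2 * nat \<lceil>R * N\<rceil> + 3\<close> indices per axis.\<close>
  define J where "J = \<lceil>R * N\<rceil> + 1"
  have "0 < R * N" using R N by simp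
  then have J0: "J \<ge> 1" by (simp add: J_def)
  define Z where "Z = PiE (Basis :: 'a set) (\<lambda>_. {-J..J})"
  have finZ: "finite Z" unfolding Z_def by (rule finite_PiE) auto
  have cardZ: "card Z = (2 * nat \<lceil>R * N\<rceil> + 3) ^ DIM('a)"
  proof -
    have "card {-J..J} = 2 * nat \<lceil>R * N\<rceil> + 3" using J0 unfolding J_def by (simp add: nat_add_distrib)
    then show ?thesis unfolding Z_def by (simp add: card_PiE)
  qed
  define \<phi> where "\<phi> m p = (\<Prod>b\<in>Basis. hat (N * (p \<bullet> b) - of_int (m b)))" for m :: "'a \<Rightarrow> int" and p :: 'a
  have sum1: "(\<Sum>m\<in>Z. \<phi> m p) = 1" if p: "p \<in> \<Omega>" for p
  proof -
    have "(\<Sum>m\<in>Z. \<phi> m p) = (\<Prod>b\<in>(Basis::'a set). \<Sum>j\<in>{-J..J}. hat (N * (p \<bullet> b) - of_int j))"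
      unfolding Z_def \<phi>_def by (rule prod_sum_PiE[symmetric]) auto
    also have "\<dots> = (\<Prod>b\<in>(Basis::'a set). 1)"
    proof (rule prod.cong[OF refl], rule sum_hat)
      fix b :: 'a assume b: "b \<in> Basis"
      have "\<bar>N * (p \<bullet> b)\<bar> \<le> N * R" using R(2)[OF p b] N by (simp add: abs_mult)
      also have "\<dots> \<le> J - 1" unfolding J_def by (simp add: mult.commute)
      finally show "\<bar>N * (p \<bullet> b)\<bar> \<le> J - 1" by simp
    qed
    finally show ?thesis by simp
  qed
  have \<phi>0: "0 \<le> \<phi> m p" for m p unfolding \<phi>_def by (intro prod_nonneg) (auto simp: hat_bounds)
  define near where "near m c \<longleftrightarrow> c \<in> \<Omega> \<and> (\<forall>b\<in>Basis. \<bar>N * (c \<bullet> b) - of_int (m b)\<bar> \<le> 1)" for m :: "'a \<Rightarrow> int" and c :: 'a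
  \<comment> \<open>A grid point need not belong to \<open>\<Omega>\<close>, so the expansion point
    is some point of \<open>\<Omega>\<close> within \<open>1 / N\<close> of it. Any other point
    where the bump is nonzero is then within \<open>2 / N\<close> of the expansion point. Indices
    without such a point have a bump vanishing on \<open>\<Omega>\<close> and are dropped.\<close>
  define Z' where "Z' = {m\<in>Z. \<exists>c. near m c}"
  have near: "near m p" if "\<phi> m p \<noteq> 0" "p \<in> \<Omega>" for m p
  proof -
    have "\<bar>N * (p \<bullet> b) - of_int (m b)\<bar> \<le> 1" if "b \<in> Basis" for b
    proof -
      have "hat (N * (p \<bullet> b) - of_int (m b)) \<noteq> 0" using \<open>\<phi> m p \<noteq> 0\<close> that by (auto simp: \<phi>_def)
      then show ?thesis by (auto simp: hat_def max_def split: if_splits)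
    qed
    with that(2) show ?thesis by (simp add: near_def)
  qed
  have sum1': "(\<Sum>m\<in>Z'. \<phi> m p) = 1" if p: "p \<in> \<Omega>" for p
    unfolding sum1[OF p, symmetric]
    by (rule sum.mono_neutral_left) (use finZ near p in \<open>auto simp: Z'_def\<close>)
  have "\<forall>m. \<exists>c. m \<in> Z' \<longrightarrow> near m c" by (auto simp: Z'_def)
  then obtain c where c: "\<And>m. m \<in> Z' \<Longrightarrow> near m (c m)" by metis
  have c\<Omega>: "c m \<in> \<Omega>" if "m \<in> Z'" for m using c[OF that] by (simp add: near_def)
  define good where "good m a \<longleftrightarrow> (\<forall>w\<in>words k. \<bar>a w\<bar> \<le> A) \<and>
     (\<forall>p\<in>\<Omega>. (\<forall>b\<in>Basis. \<bar>(p - c m) \<bullet> b\<bar> \<le> 2 / N) \<longrightarrow>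
        \<bar>f p - (\<Sum>w\<in>words k. a w * word_monomial w (p - c m))\<bar> \<le> A * (2 / N) ^ k)" for m and a :: "'a list \<Rightarrow> real"
  have "\<forall>m. \<exists>a. m \<in> Z' \<longrightarrow> good m a"
    using lp c\<Omega> unfolding locally_polynomial_def good_def by blast
  then obtain a where a: "\<And>m. m \<in> Z' \<Longrightarrow> good m (a m)" by metis
  define P where "P m p = (\<Sum>w\<in>words k. a m w * word_monomial w (p - c m))" for m p
  have err1: "\<bar>f p - (\<Sum>m\<in>Z'. \<phi> m p * P m p)\<bar> \<le> A * (2 / N) ^ k" if p: "p \<in> \<Omega>" for p
  proof -
    have "f p - (\<Sum>m\<in>Z'. \<phi> m p * P m p) = (\<Sum>m\<in>Z'. \<phi> m p * (f p - P m p))"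
      using sum1'[OF p] by (simp add: right_diff_distrib sum_subtractf sum_distrib_right[symmetric])
    also have "\<bar>\<dots>\<bar> \<le> (\<Sum>m\<in>Z'. \<phi> m p * (A * (2 / N) ^ k))"
    proof (rule order_trans[OF sum_abs], rule sum_mono)
      fix m assume m: "m \<in> Z'"
      show "\<bar>\<phi> m p * (f p - P m p)\<bar> \<le> \<phi> m p * (A * (2 / N) ^ k)"
      proof (cases "\<phi> m p = 0")
        case False
        have "\<bar>(p - c m) \<bullet> b\<bar> \<le> 2 / N" if b: "b \<in> Basis" for b
        proof -
          have "\<bar>N * ((p - c m) \<bullet> b)\<bar> \<le> 2"
            using near[OF False p] c[OF m] b unfolding near_def inner_diff_left right_diff_distrib by fastforce
          then show ?thesis using N by (simp add: abs_mult field_simps)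
        qed
        then have "\<bar>f p - P m p\<bar> \<le> A * (2 / N) ^ k"
          using a[OF m] p unfolding good_def P_def by blast
        then show ?thesis using \<phi>0[of m p] by (simp add: abs_mult mult_left_mono)
      qed simp
    qed
    also have "\<dots> = A * (2 / N) ^ k" using sum1'[OF p] by (simp add: sum_distrib_right[symmetric])
    finally show ?thesis .
  qed
  define IX where "IX = Z' \<times> (words k :: 'a list set)"
  have finIX: "finite IX" unfolding IX_def using finZ by (auto simp: Z'_def)
  have cardIX: "card IX \<le> n"
  proof -
    have "card Z' \<le> card Z" unfolding Z'_def by (rule card_mono[OF finZ]) auto
    then show ?thesis unfolding IX_def n card_cartesian_product cardZ by (rule mult_right_mono) simp
  qed
  let ?L = "3 * DIM('a) + (DIM('a) + k) * (6 + 4 * s)"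
  let ?W = "9 * DIM('a) + (DIM('a) + k) * (26 * s + 28)"
  define T where "T i p = \<phi> (fst i) p * (word_monomial (snd i) (p - c (fst i)) / (2 * R) ^ length (snd i))" for i p
  have "\<forall>i. \<exists>F h. i \<in> IX \<longrightarrow> relu_net I ?L ?W F \<and> affine_over F (4 * s + 3) h \<and>
    (\<forall>p\<in>\<Omega>. \<bar>h p - T i p\<bar> \<le> (DIM('a) + k) * (1/4) ^ Suc s)"
  proof
    fix i
    show "\<exists>F h. i \<in> IX \<longrightarrow> relu_net I ?L ?W F \<and> affine_over F (4 * s + 3) h \<and>
      (\<forall>p\<in>\<Omega>. \<bar>h p - T i p\<bar> \<le> (DIM('a) + k) * (1/4) ^ Suc s)"
    proof (cases "i \<in> IX")
      case True
      then have "snd i \<in> words k" "c (fst i) \<in> \<Omega>" using c\<Omega> by (auto simp: IX_def)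
      from relu_net_grid_term[OF I this, of R s N "fst i"] R show ?thesis
        unfolding T_def \<phi>_def by fastforce
    qed simp
  qed
  then obtain F h where Fh: "\<And>i. i \<in> IX \<Longrightarrow> relu_net I ?L ?W (F i)" "\<And>i. i \<in> IX \<Longrightarrow> affine_over (F i) (4 * s + 3) (h i)"
    "\<And>i p. i \<in> IX \<Longrightarrow> p \<in> \<Omega> \<Longrightarrow> \<bar>h i p - T i p\<bar> \<le> (DIM('a) + k) * (1/4) ^ Suc s" by metis
  define \<beta> where "\<beta> i = a (fst i) (snd i) * (2 * R) ^ length (snd i)" for i
  let ?F = "I \<union> (\<Union>i\<in>IX. F i)"
  define g where "g = (\<lambda>p. \<Sum>i\<in>IX. \<beta> i * h i p)"
  have "relu_net I ?L (\<Sum>i\<in>IX. ?W) ?F" by (rule relu_net_UN[OF finIX Fh(1)])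
  then have net: "relu_net I ?L (n * ?W) ?F"
    by (rule relu_net_mono) (simp only: sum_constant of_nat_id, rule mult_right_mono[OF cardIX], simp)
  have "affine_over ?F (\<Sum>i\<in>IX. 4 * s + 3) g" unfolding g_def
    by (rule affine_over_sum[OF finIX], rule affine_over_scale, rule affine_over_mono[OF Fh(2)]) auto
  then have aff: "affine_over ?F (n * (4 * s + 3)) g"
    by (rule affine_over_mono[OF _ order_refl]) (simp only: sum_constant of_nat_id, rule mult_right_mono[OF cardIX], simp)
  have sumT: "(\<Sum>m\<in>Z'. \<phi> m p * P m p) = (\<Sum>i\<in>IX. \<beta> i * T i p)" for p
  proof -
    have "(\<Sum>m\<in>Z'. \<phi> m p * P m p) = (\<Sum>m\<in>Z'. \<Sum>w\<in>words k. \<beta> (m, w) * T (m, w) p)"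
      unfolding P_def sum_distrib_left
      by (intro sum.cong refl) (use R(1) in \<open>simp add: \<beta>_def T_def\<close>)
    also have "\<dots> = (\<Sum>i\<in>IX. \<beta> i * T i p)" unfolding IX_def
      by (subst sum.cartesian_product) (simp add: case_prod_beta)
    finally show ?thesis .
  qed
  let ?e = "(DIM('a) + k) * (1/4::real) ^ Suc s"
  have \<beta>: "\<bar>\<beta> i\<bar> \<le> A * (2 * R) ^ k" if i: "i \<in> IX" for i
  proof -
    have "\<bar>a (fst i) (snd i)\<bar> \<le> A" using a[of "fst i"] i unfolding good_def IX_def by auto
    moreover have "(2 * R) ^ length (snd i) \<le> (2 * R) ^ k"
      by (rule power_increasing) (use i R(1) in \<open>auto simp: IX_def words_def\<close>)
    ultimately show ?thesis unfolding \<beta>_def abs_mult using R(1) A by (intro mult_mono) auto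
  qed
  have "\<bar>f p - g p\<bar> \<le> A * (2 / N) ^ k + n * (A * (2 * R) ^ k * ?e)" if p: "p \<in> \<Omega>" for p
  proof -
    have "\<bar>(\<Sum>i\<in>IX. \<beta> i * T i p) - g p\<bar> = \<bar>\<Sum>i\<in>IX. \<beta> i * (T i p - h i p)\<bar>"
      unfolding g_def by (simp add: sum_subtractf right_diff_distrib)
    also have "\<dots> \<le> (\<Sum>i\<in>IX. A * (2 * R) ^ k * ?e)"
    proof (rule order_trans[OF sum_abs], rule sum_mono)
      fix i assume i: "i \<in> IX"
      show "\<bar>\<beta> i * (T i p - h i p)\<bar> \<le> A * (2 * R) ^ k * ?e" unfolding abs_mult
        by (rule mult_mono[OF \<beta>[OF i]]) (use Fh(3)[OF i p] A R(1) in \<open>auto simp: abs_minus_commute\<close>)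
    qed
    also have "\<dots> = card IX * (A * (2 * R) ^ k * ?e)" by simp
    also have "\<dots> \<le> n * (A * (2 * R) ^ k * ?e)"
      by (rule mult_right_mono) (use cardIX A R(1) in auto)
    finally show ?thesis using err1[OF p] unfolding sumT by linarith
  qed
  with net aff show ?thesis by blast
qed

text \<open>The two error terms of \<open>grid_approximation\<close> are each made at most
  \<open>\<epsilon> / 2\<close>: the mesh controls the first, the depth \<open>s\<close> the second.
  The constant precedes the quantifiers over \<open>I\<close>, \<open>\<Omega>\<close> and
  \<open>f\<close>, so that it serves all fields and all components of the flow.\<close>

lemma approximation_rate:
  fixes A \<rho> R :: real and k :: nat
  assumes k: "k \<ge> 1" and A: "A \<ge> 0" and \<rho>: "\<rho> > 0" and R: "R \<ge> 1"
  shows "\<exists>C>0. \<forall>(I :: ('a::euclidean_space \<Rightarrow> real) set) (\<Omega> :: 'a set) f \<epsilon>.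
    (\<forall>b\<in>Basis. (\<lambda>p. p \<bullet> b) \<in> I) \<longrightarrow> (\<forall>p\<in>\<Omega>. \<forall>b\<in>Basis. \<bar>p \<bullet> b\<bar> \<le> R) \<longrightarrow>
    (\<forall>h. 0 < h \<and> h \<le> \<rho> \<longrightarrow> locally_polynomial k A h \<Omega> f) \<longrightarrow> 0 < \<epsilon> \<longrightarrow> \<epsilon> < 1 \<longrightarrow>
    (\<exists>L W F q g. relu_net I L W F \<and> affine_over F q g \<and> real L \<le> C * (ln (1 / \<epsilon>) + 1) \<and>
      real (W + q) \<le> C * \<epsilon> powr (- real DIM('a) / real k) * (ln (1 / \<epsilon>) + 1) \<and>
      (\<forall>p\<in>\<Omega>. \<bar>f p - g p\<bar> \<le> \<epsilon>))"
proof -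
  define d where "d = DIM('a)"
  \<comment> \<open>Chosen such that \<open>A * y \<le> 1/2\<close> and also
    \<open>y \<le> 1\<close>, whence \<open>y ^ k \<le> y\<close>. The bound
    \<open>2 / C0 \<le> y\<close> then gives \<open>A * (2 / C0) ^ k \<le> 1/2\<close>.\<close>
  define y where "y = 1 / max 1 (2 * A)"
  define C0 where "C0 = max (2 / \<rho>) (2 / y)"
  define \<omega> where "\<omega> = card (words k :: 'a list set)"
  define C1 where "C1 = ((2 * R + 5) * C0) ^ d * \<omega>"
  define B where "B = A * (2 * R) ^ k * (d + k)"
  \<comment> \<open>The total product error is at most \<open>C1 * X * B\<close> times
    \<open>(1/4) ^ Suc s\<close>, and a last factor at most \<open>\<epsilon> / (D * X)\<close>
    makes it at most \<open>\<epsilon> / 2\<close>. The summand 1 keeps \<open>D\<close> positive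
    when \<open>B\<close> is 0.\<close>
  define D where "D = 2 * C1 * (B + 1)"
  define C3 where "C3 = \<bar>ln D\<bar> + 2 + d / k"
  define CL where "CL = 3 * d + (d + k) * (6 + 4 * C3)"
  define CW where "CW = 9 * d + (d + k) * (26 * C3 + 28) + 4 * C3 + 3"
  have y: "0 < y" "y \<le> 1" "A * y \<le> 1 / 2" by (auto simp: y_def max_def field_simps)
  have C0: "C0 \<ge> 2" "2 / C0 \<le> \<rho>" "2 / C0 \<le> y"
  proof -
    have "2 \<le> 2 / y" using y by (simp add: field_simps)
    then show C02: "C0 \<ge> 2" by (simp add: C0_def)
    have "2 / \<rho> \<le> C0" "2 / y \<le> C0" by (simp_all add: C0_def)
    then show "2 / C0 \<le> \<rho>" "2 / C0 \<le> y" using \<rho> y C02 by (simp_all add: field_simps)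
  qed
  have "[] \<in> (words k :: 'a list set)" using k by (simp add: words_def)
  then have \<omega>: "\<omega> > 0" unfolding \<omega>_def by (auto simp: card_gt_0_iff)
  have C1: "C1 > 0" unfolding C1_def using R C0 \<omega> by simp
  have B: "B \<ge> 0" unfolding B_def using A R by simp
  have D: "D > 0" unfolding D_def using C1 B by simp
  have C3: "C3 \<ge> 0" by (simp add: C3_def)
  have CL: "CL \<ge> 0" "CW \<ge> 0" using C3 by (simp_all add: CL_def CW_def)
  show ?thesis
  proof (rule exI[of _ "CL + C1 * CW + 1"], intro conjI allI impI)
    show "CL + C1 * CW + 1 > 0" using CL C1 by (simp add: add_nonneg_pos)
  next
    fix I :: "('a \<Rightarrow> real) set" and \<Omega> :: "'a set" and f and \<epsilon> :: real
    assume I: "\<forall>b\<in>Basis. (\<lambda>p. p \<bullet> b) \<in> I" and bd: "\<forall>p\<in>\<Omega>. \<forall>b\<in>Basis. \<bar>p \<bullet> b\<bar> \<le> R"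
      and lp: "\<forall>h. 0 < h \<and> h \<le> \<rho> \<longrightarrow> locally_polynomial k A h \<Omega> f" and \<epsilon>: "0 < \<epsilon>" "\<epsilon> < 1"
    define E where "E = ln (1 / \<epsilon>)"
    have E: "E \<ge> 0" using \<epsilon> by (simp add: E_def)
    have \<epsilon>E: "\<epsilon> = exp (- E)" using \<epsilon> by (simp add: E_def ln_div)
    define X where "X = \<epsilon> powr (- real d / real k)"
    have X: "X = exp (d / k * E)" using \<epsilon> by (simp add: X_def powr_def E_def ln_div)
    have X0: "X > 0" by (simp add: X)
    \<comment> \<open>The mesh \<open>1 / N\<close> is proportional to
      \<open>\<epsilon> powr (1 / k)\<close>: then \<open>(2 / N) ^ k\<close> is a multiple of
      \<open>\<epsilon>\<close>, and the number of grid terms is at most a multiple of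
      \<open>X\<close>.\<close>
    define N where "N = C0 * exp (E / k)"
    have N1: "N \<ge> C0" unfolding N_def using C0 E by simp
    have h: "2 / N \<le> 2 / C0" using N1 C0 by (simp add: frac_le)
    have Nk: "(2 / N) ^ k = (2 / C0) ^ k * \<epsilon>"
      using k by (simp add: N_def power_divide power_mult_distrib exp_of_nat_mult[symmetric] \<epsilon>E exp_minus field_simps)
    have "(2 / C0) ^ k \<le> y ^ k" using C0 by (intro power_mono) auto
    also have "\<dots> \<le> y ^ 1" using y k by (intro power_decreasing) auto
    finally have "A * (2 / C0) ^ k \<le> A * y" using A by (simp add: mult_left_mono)
    then have "A * (2 / C0) ^ k \<le> 1 / 2" using y(3) by linarith
    then have e1: "A * (2 / N) ^ k \<le> \<epsilon> / 2" unfolding Nk using mult_right_mono[of _ "1/2" \<epsilon>] \<epsilon> by (simp add: mult.assoc[symmetric])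
    define n where "n = (2 * nat \<lceil>R * N\<rceil> + 3) ^ d * \<omega>"
    have "real (2 * nat \<lceil>R * N\<rceil> + 3) \<le> (2 * R + 5) * N"
    proof -
      have "0 \<le> R * N" using R N1 C0 by simp
      then have "real (nat \<lceil>R * N\<rceil>) \<le> R * N + 1" by linarith
      then have "real (2 * nat \<lceil>R * N\<rceil> + 3) \<le> 2 * (R * N) + 5" by simp
      also have "\<dots> \<le> 2 * (R * N) + 5 * N" using N1 C0 by simp
      finally show ?thesis by (simp add: algebra_simps)
    qed
    then have "real (2 * nat \<lceil>R * N\<rceil> + 3) ^ d \<le> ((2 * R + 5) * N) ^ d" by (rule power_mono) simp
    also have "\<dots> = ((2 * R + 5) * C0) ^ d * exp (E / k) ^ d"
      unfolding N_def power_mult_distrib by (simp add: mult.assoc)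
    also have "exp (E / k) ^ d = X" unfolding X by (simp add: exp_of_nat_mult[symmetric])
    finally have n: "n \<le> C1 * X" unfolding n_def C1_def using \<omega>
      by (simp add: algebra_simps mult_left_mono)
    \<comment> \<open>Solves \<open>exp (- s) \<le> \<epsilon> / (D * X)\<close>; the part
      \<open>d / k\<close> of the factor pays for the number of summands.\<close>
    define s where "s = nat \<lceil>ln D + (1 + d / k) * E\<rceil>"
    have s1: "real s \<ge> ln D + (1 + d / k) * E" unfolding s_def by linarith
    have "real s \<le> max 0 (ln D + (1 + d / k) * E) + 1" unfolding s_def by linarith
    also have "\<dots> \<le> \<bar>ln D\<bar> + (1 + d / k) * E + 1" using E by (auto simp: max_def)
    also have "\<dots> \<le> C3 * (E + 1)"
    proof -
      have "0 \<le> \<bar>ln D\<bar> * E" using E by simp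
      then have "\<bar>ln D\<bar> + (1 + d / k) * E + 1 \<le> (\<bar>ln D\<bar> + (1 + d / k) * E + 1) + (\<bar>ln D\<bar> * E + E + 1 + d / k)"
        using E \<open>0 \<le> \<bar>ln D\<bar> * E\<close> by simp
      also have "\<dots> = C3 * (E + 1)" by (simp add: C3_def algebra_simps add_divide_distrib)
      finally show ?thesis .
    qed
    finally have s2: "real s \<le> C3 * (E + 1)" .
    have "(1/4::real) ^ Suc s \<le> (1/4) ^ s" by simp
    also have "\<dots> \<le> exp (- 1) ^ s"
    proof (rule power_mono)
      have "exp (1::real) \<le> 4" using exp_le by simp
      then show "(1/4::real) \<le> exp (- 1)" by (simp add: exp_minus field_simps)
    qed simp
    also have "\<dots> = exp (- real s)" by (simp add: exp_of_nat_mult[symmetric])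
    also have "\<dots> \<le> exp (- (ln D + (1 + d / k) * E))" using s1 by simp
    also have "\<dots> = \<epsilon> / (D * X)" using D unfolding \<epsilon>E X by (simp add: exp_minus exp_add algebra_simps exp_diff field_simps)
    finally have q: "(1/4::real) ^ Suc s \<le> \<epsilon> / (D * X)" .
    have "n * (A * (2 * R) ^ k * ((d + k) * (1/4) ^ Suc s)) = n * (B * (1/4) ^ Suc s)"
      by (simp add: B_def algebra_simps)
    also have "\<dots> \<le> (C1 * X) * (B * (\<epsilon> / (D * X)))"
      using n q B C1 X0 by (intro mult_mono mult_left_mono) auto
    also have "\<dots> = \<epsilon> / 2 * (B / (B + 1))" 
    proof -
      have "\<epsilon> / (D * X) = \<epsilon> / (2 * (B + 1)) / (C1 * X)" by (simp add: D_def)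
      then have "(C1 * X) * (B * (\<epsilon> / (D * X))) = B * (\<epsilon> / (2 * (B + 1)))"
        using X0 C1 by (simp only:) (simp del: distrib_left_numeral)
      then show ?thesis by simp
    qed
    also have "\<dots> \<le> \<epsilon> / 2 * 1" using B \<epsilon> by (intro mult_left_mono) (auto simp: divide_le_eq)
    finally have e2: "n * (A * (2 * R) ^ k * ((d + k) * (1/4) ^ Suc s)) \<le> \<epsilon> / 2" by simp
    have N0: "N > 0" and hr: "0 < 2 / N" "2 / N \<le> \<rho>" using N1 C0 h by auto
    have "\<exists>F g. relu_net I (3 * DIM('a) + (DIM('a) + k) * (6 + 4 * s))
      (n * (9 * DIM('a) + (DIM('a) + k) * (26 * s + 28))) F \<and> affine_over F (n * (4 * s + 3)) g \<and>
      (\<forall>p\<in>\<Omega>. \<bar>f p - g p\<bar> \<le> A * (2 / N) ^ k + n * (A * (2 * R) ^ k * ((DIM('a) + k) * (1/4) ^ Suc s)))"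
    proof (rule grid_approximation)
      show "(\<lambda>p. p \<bullet> b) \<in> I" if "b \<in> Basis" for b :: 'a using I that by blast
      show "\<bar>p \<bullet> b\<bar> \<le> R" if "p \<in> \<Omega>" "b \<in> Basis" for p b :: 'a using bd that by blast
      show "locally_polynomial k A (2 / N) \<Omega> f" using lp hr by blast
    qed (use R A N0 in \<open>auto simp: n_def \<omega>_def d_def\<close>)
    then obtain F g where Fg: "relu_net I (3 * d + (d + k) * (6 + 4 * s)) (n * (9 * d + (d + k) * (26 * s + 28))) F"
      "affine_over F (n * (4 * s + 3)) g"
      "\<And>p. p\<in>\<Omega> \<Longrightarrow> \<bar>f p - g p\<bar> \<le> A * (2 / N) ^ k + n * (A * (2 * R) ^ k * ((d + k) * (1/4) ^ Suc s))"
      unfolding d_def by blast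
    have E1: "1 \<le> E + 1" using E by simp
    have s3: "m * real s \<le> m * C3 * (E + 1)" if "m \<ge> 0" for m
      using mult_left_mono[OF s2 that] by (simp add: mult.assoc)
    have lift: "m \<le> m * (E + 1)" if "m \<ge> 0" for m
      using mult_left_mono[OF E1 that] by simp
    have "real (3 * d + (d + k) * (6 + 4 * s)) = (3 * d + (d + k) * 6) + ((d + k) * 4) * real s"
      by (simp add: algebra_simps)
    also have "\<dots> \<le> (3 * d + (d + k) * 6) * (E + 1) + ((d + k) * 4) * C3 * (E + 1)"
      by (intro add_mono s3) (use lift[of "real (3 * d + (d + k) * 6)"] in auto)
    also have "\<dots> = CL * (E + 1)" by (simp add: CL_def algebra_simps)
    also have "\<dots> \<le> (CL + C1 * CW + 1) * (E + 1)" using C1 CL E1 by (intro mult_right_mono) auto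
    finally have L: "real (3 * d + (d + k) * (6 + 4 * s)) \<le> (CL + C1 * CW + 1) * (E + 1)" .
    have "real (9 * d + (d + k) * (26 * s + 28) + (4 * s + 3)) =
       real (9 * d + (d + k) * 28 + 3) + (real (d + k) * 26 + 4) * real s" by (simp add: algebra_simps)
    also have "\<dots> \<le> real (9 * d + (d + k) * 28 + 3) * (E + 1) + (real (d + k) * 26 + 4) * C3 * (E + 1)"
      by (intro add_mono s3 lift) auto
    also have "\<dots> = CW * (E + 1)" by (simp add: CW_def algebra_simps)
    finally have w: "real (9 * d + (d + k) * (26 * s + 28) + (4 * s + 3)) \<le> CW * (E + 1)" .
    have "real (n * (9 * d + (d + k) * (26 * s + 28)) + n * (4 * s + 3)) =
      real n * real (9 * d + (d + k) * (26 * s + 28) + (4 * s + 3))" by (simp add: algebra_simps)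
    also have "\<dots> \<le> (C1 * X) * (CW * (E + 1))" using n w C1 X0 by (intro mult_mono) auto
    also have "\<dots> = (C1 * CW) * (X * (E + 1))" by simp
    also have "\<dots> \<le> (CL + C1 * CW + 1) * (X * (E + 1))" using CL X0 E1 by (intro mult_right_mono) auto
    finally have W: "real (n * (9 * d + (d + k) * (26 * s + 28)) + n * (4 * s + 3)) \<le> (CL + C1 * CW + 1) * X * (E + 1)"
      by (simp add: mult.assoc)
    have "\<bar>f p - g p\<bar> \<le> \<epsilon>" if "p \<in> \<Omega>" for p using Fg(3)[OF that] e1 e2 by linarith
    with Fg(1,2) L W show "\<exists>L W F q g. relu_net I L W F \<and> affine_over F q g \<and> real L \<le> (CL + C1 * CW + 1) * (ln (1 / \<epsilon>) + 1) \<and>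
      real (W + q) \<le> (CL + C1 * CW + 1) * \<epsilon> powr (- real DIM('a) / real k) * (ln (1 / \<epsilon>) + 1) \<and>
      (\<forall>p\<in>\<Omega>. \<bar>f p - g p\<bar> \<le> \<epsilon>)"
      unfolding X_def E_def d_def[symmetric] by blast
  qed
qed

section \<open>Taylor expansion from iterated partial derivatives\<close>

text \<open>Closure under coordinatewise interpolation: a path that changes one coordinate at a time
  from \<open>x\<close> to \<open>y\<close> stays in the set, also at faces of the domain.\<close>

definition box_like :: "'a::euclidean_space set \<Rightarrow> bool" where
  "box_like S \<longleftrightarrow> (\<forall>x\<in>S. \<forall>y\<in>S. \<forall>z. (\<forall>b\<in>Basis. z \<bullet> b \<in> closed_segment (x \<bullet> b) (y \<bullet> b)) \<longrightarrow> z \<in> S)"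

text \<open>Phrased with \<open>closed_segment\<close> so that \<open>b < a\<close> is allowed;
  characteristics are traced backwards in time.\<close>

lemma vector_derivative_bound:
  fixes f :: "real \<Rightarrow> 'b::real_normed_vector"
  assumes "\<And>t. t \<in> closed_segment a b \<Longrightarrow> (f has_vector_derivative f' t) (at t within closed_segment a b)"
    and "\<And>t. t \<in> closed_segment a b \<Longrightarrow> norm (f' t) \<le> B"
  shows "norm (f b - f a) \<le> B * \<bar>b - a\<bar>"
proof -
  have "norm (f b - f a) \<le> B * norm (b - a)"
  proof (rule differentiable_bound[where S = "closed_segment a b" and f' = "\<lambda>t h. h *\<^sub>R f' t"])
    fix t assume t: "t \<in> closed_segment a b"
    show "(f has_derivative (\<lambda>h. h *\<^sub>R f' t)) (at t within closed_segment a b)"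
      using assms(1)[OF t] by (simp add: has_vector_derivative_def)
    have "norm (h *\<^sub>R f' t) \<le> B * norm h" for h
      using mult_right_mono[OF assms(2)[OF t], of "\<bar>h\<bar>"] by (simp add: mult.commute)
    then show "onorm (\<lambda>h. h *\<^sub>R f' t) \<le> B" by (rule onorm_le)
  qed auto
  then show ?thesis by simp
qed

text \<open>The classical argument that continuous partial derivatives imply differentiability, with
  one-sided partials at the boundary. The increment is split along a coordinate path, and on each
  leg the partial derivative differs little from its value at \<open>x\<close>.\<close>

lemma has_derivative_of_partials:
  fixes f :: "'a::euclidean_space \<Rightarrow> 'b::real_normed_vector"
  assumes S: "box_like S" and x: "x \<in> S"
    and der: "\<And>b y. b \<in> Basis \<Longrightarrow> y \<in> S \<Longrightarrow>
      ((\<lambda>h. f (y + h *\<^sub>R b)) has_vector_derivative g b y) (at 0 within {h. y + h *\<^sub>R b \<in> S})"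
    and cont: "\<And>b. b \<in> Basis \<Longrightarrow> continuous_on S (g b)"
  shows "(f has_derivative (\<lambda>v. \<Sum>b\<in>Basis. (v \<bullet> b) *\<^sub>R g b x)) (at x within S)"
proof -
  have main: "\<exists>\<delta>>0. \<forall>y\<in>S. norm (y - x) < \<delta> \<longrightarrow>
      norm (f y - f x - (\<Sum>b\<in>Basis. ((y - x) \<bullet> b) *\<^sub>R g b x)) \<le> e * norm (y - x)" if e: "e > 0" for e
  proof -
    define e' where "e' = e / DIM('a)"
    have e': "e' > 0" using e by (simp add: e'_def)
    have "\<forall>b\<in>Basis. \<exists>\<delta>>0. \<forall>y\<in>S. dist y x < \<delta> \<longrightarrow> dist (g b y) (g b x) < e'"
      using cont x e' unfolding continuous_on_iff by blast
    then obtain \<delta>' where \<delta>': "\<And>b. b \<in> Basis \<Longrightarrow> \<delta>' b > 0"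
      "\<And>b y. b \<in> Basis \<Longrightarrow> y \<in> S \<Longrightarrow> dist y x < \<delta>' b \<Longrightarrow> dist (g b y) (g b x) < e'" by metis
    define \<delta> where "\<delta> = Min (\<delta>' ` Basis)"
    have \<delta>: "\<delta> > 0" unfolding \<delta>_def using \<delta>'(1) by (subst Min_gr_iff) auto
    have \<delta>g: "norm (g b y - g b x) \<le> e'" if "b \<in> Basis" "y \<in> S" "norm (y - x) < \<delta>" for b y
    proof -
      have "\<delta> \<le> \<delta>' b" unfolding \<delta>_def using that(1) by (intro Min_le) auto
      then have "dist y x < \<delta>' b" using that(3) by (simp add: dist_norm)
      from \<delta>'(2)[OF that(1,2) this] show ?thesis by (simp add: dist_norm)
    qed
    show ?thesis
    proof (intro exI[of _ \<delta>] conjI \<delta> ballI impI)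
      fix y assume y: "y \<in> S" "norm (y - x) < \<delta>"
      \<comment> \<open>The point that takes the coordinates in \<open>B\<close> from
        \<open>y\<close> and the others from \<open>x\<close>.\<close>
      define z where "z B = x + (\<Sum>b\<in>B. ((y - x) \<bullet> b) *\<^sub>R b)" for B :: "'a set"
      have zb: "z B \<bullet> b = (if b \<in> B then y \<bullet> b else x \<bullet> b)" if "B \<subseteq> Basis" "b \<in> Basis" for B b
      proof -
        have fB: "finite B" using that(1) by (rule finite_subset) simp
        have "(\<Sum>c\<in>B. ((y - x) \<bullet> c) *\<^sub>R c) \<bullet> b = (\<Sum>c\<in>B. if c = b then (y - x) \<bullet> b else 0)"
          unfolding inner_sum_left by (rule sum.cong) (use that in \<open>auto simp: inner_Basis\<close>)
        also have "\<dots> = (if b \<in> B then (y - x) \<bullet> b else 0)" using fB by (simp add: sum.delta)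
        finally show ?thesis by (simp add: z_def inner_add_left inner_diff_left)
      qed
      have tel: "norm (f (z B) - f x - (\<Sum>b\<in>B. ((y - x) \<bullet> b) *\<^sub>R g b x)) \<le> (\<Sum>b\<in>B. e' * \<bar>(y - x) \<bullet> b\<bar>)"
        if "finite B" "B \<subseteq> Basis" for B using that
      proof (induction B rule: finite_induct)
        case empty
        then show ?case by (simp add: z_def)
      next
        case (insert b B)
        then have b: "b \<in> Basis" and B: "B \<subseteq> Basis" by auto
        define \<eta> where "\<eta> = (y - x) \<bullet> b"
        have z': "z (insert b B) = z B + \<eta> *\<^sub>R b" using insert by (simp add: z_def \<eta>_def)
        have seg: "z B + t *\<^sub>R b \<in> S \<and> norm (z B + t *\<^sub>R b - x) \<le> norm (y - x)" if t: "t \<in> closed_segment 0 \<eta>" for t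
        proof
          have comp: "(z B + t *\<^sub>R b) \<bullet> c \<in> closed_segment (x \<bullet> c) (y \<bullet> c)" if c: "c \<in> Basis" for c
          proof (cases "c = b")
            case True
            then have "(z B + t *\<^sub>R b) \<bullet> c = x \<bullet> b + t" using zb[OF B b] insert(2) b by (simp add: inner_add_left)
            with t True show ?thesis by (auto simp: \<eta>_def inner_diff_left closed_segment_eq_real_ivl split: if_splits)
          next
            case False
            then show ?thesis using zb[OF B c] b c by (auto simp: inner_add_left inner_Basis)
          qed
          then show "z B + t *\<^sub>R b \<in> S" using S x y(1) unfolding box_like_def by blast
          show "norm (z B + t *\<^sub>R b - x) \<le> norm (y - x)"
            by (rule norm_le_componentwise)
               (use comp in \<open>fastforce simp: inner_diff_left closed_segment_eq_real_ivl split: if_splits\<close>)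
        qed
        \<comment> \<open>Removing the linear part at \<open>x\<close> leaves a derivative of norm
          at most \<open>e'\<close>, since every point of the leg is no farther from
          \<open>x\<close> than \<open>y\<close> is.\<close>
        define \<phi> where "\<phi> t = f (z B + t *\<^sub>R b) - t *\<^sub>R g b x" for t
        have "norm (\<phi> \<eta> - \<phi> 0) \<le> e' * \<bar>\<eta> - 0\<bar>"
        proof (rule vector_derivative_bound)
          fix t assume t: "t \<in> closed_segment 0 \<eta>"
          have st: "z B + t *\<^sub>R b \<in> S" using seg[OF t] by simp
          have "(((\<lambda>h. f ((z B + t *\<^sub>R b) + h *\<^sub>R b)) \<circ> (\<lambda>s. s - t)) has_vector_derivative (1 *\<^sub>R g b (z B + t *\<^sub>R b)))
              (at t within closed_segment 0 \<eta>)"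
          proof (rule vector_diff_chain_within)
            show "((\<lambda>s. s - t) has_vector_derivative 1) (at t within closed_segment 0 \<eta>)"
              by (auto intro!: derivative_eq_intros)
            show "((\<lambda>h. f (z B + t *\<^sub>R b + h *\<^sub>R b)) has_vector_derivative g b (z B + t *\<^sub>R b))
               (at (t - t) within (\<lambda>s. s - t) ` closed_segment 0 \<eta>)"
              unfolding diff_self
            proof (rule has_vector_derivative_within_subset[OF der[OF b st]])
              show "(\<lambda>s. s - t) ` closed_segment 0 \<eta> \<subseteq> {h. z B + t *\<^sub>R b + h *\<^sub>R b \<in> S}"
                using seg by (auto simp: scaleR_diff_left)
            qed
          qed
          then have "((\<lambda>s. f (z B + s *\<^sub>R b)) has_vector_derivative g b (z B + t *\<^sub>R b)) (at t within closed_segment 0 \<eta>)"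
            by (simp add: o_def scaleR_diff_left)
          then show "(\<phi> has_vector_derivative (g b (z B + t *\<^sub>R b) - g b x)) (at t within closed_segment 0 \<eta>)"
            unfolding \<phi>_def by (auto intro!: derivative_eq_intros)
          show "norm (g b (z B + t *\<^sub>R b) - g b x) \<le> e'"
            using \<delta>g[OF b st] seg[OF t] y(2) by simp
        qed
        then have "norm (f (z (insert b B)) - f (z B) - \<eta> *\<^sub>R g b x) \<le> e' * \<bar>\<eta>\<bar>"
          by (simp add: \<phi>_def z' algebra_simps)
        moreover have "f (z (insert b B)) - f x - (\<Sum>b\<in>insert b B. ((y - x) \<bullet> b) *\<^sub>R g b x) =
          (f (z (insert b B)) - f (z B) - \<eta> *\<^sub>R g b x) + (f (z B) - f x - (\<Sum>b\<in>B. ((y - x) \<bullet> b) *\<^sub>R g b x))"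
          using insert(1,2) by (simp add: \<eta>_def)
        ultimately show ?case using insert.IH[OF B] insert(1,2)
          by (simp only: sum.insert) (rule norm_triangle_le, simp add: \<eta>_def)
      qed
      have "z Basis = y"
        unfolding z_def by (simp add: euclidean_representation)
      then have "norm (f y - f x - (\<Sum>b\<in>Basis. ((y - x) \<bullet> b) *\<^sub>R g b x)) \<le> (\<Sum>b\<in>(Basis::'a set). e' * \<bar>(y - x) \<bullet> b\<bar>)"
        using tel[of Basis] by simp
      also have "\<dots> \<le> (\<Sum>b\<in>(Basis::'a set). e' * norm (y - x))"
        using e' by (intro sum_mono mult_left_mono) (auto intro: Basis_le_norm)
      also have "\<dots> = e * norm (y - x)" by (simp add: e'_def)
      finally show "norm (f y - f x - (\<Sum>b\<in>Basis. ((y - x) \<bullet> b) *\<^sub>R g b x)) \<le> e * norm (y - x)" .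
    qed
  qed
  have "bounded_linear (\<lambda>v. \<Sum>b\<in>Basis. (v \<bullet> b) *\<^sub>R g b x)"
    by (intro bounded_linear_sum bounded_linear_compose[OF bounded_linear_scaleR_left bounded_linear_inner_left])
  with main show ?thesis
    unfolding has_derivative_within_alt by auto
qed

text \<open>Splitting off the last letter, not the first: in \<open>iter_partial S (u @ w) f\<close>
  the last letter of \<open>u\<close> can be absorbed into \<open>w\<close>, which relates Taylor
  polynomials of consecutive orders.\<close>

lemma sum_words_Suc:
  fixes h :: "'a::euclidean_space list \<Rightarrow> 'b::comm_monoid_add"
  shows "(\<Sum>u\<in>words (Suc m). h u) = h [] + (\<Sum>b\<in>Basis. \<Sum>u\<in>words m. h (u @ [b]))"
proof -
  have eq: "words (Suc m) = insert ([] :: 'a list) ((\<lambda>(b, u). u @ [b]) ` ((Basis::'a set) \<times> words m))"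
  proof (intro Set.set_eqI iffI)
    fix w :: "'a list" assume "w \<in> words (Suc m)"
    then show "w \<in> insert [] ((\<lambda>(b, u). u @ [b]) ` ((Basis::'a set) \<times> words m))"
      by (cases w rule: rev_cases) (auto simp: words_def)
  qed (auto simp: words_def)
  have inj: "inj_on (\<lambda>(b, u). u @ [b]) ((Basis::'a set) \<times> words m)" by (auto simp: inj_on_def)
  have "(\<Sum>u\<in>(\<lambda>(b, u). u @ [b]) ` ((Basis::'a set) \<times> words m). h u) =
      (\<Sum>(b, u)\<in>(Basis::'a set) \<times> words m. h (u @ [b]))"
    by (subst sum.reindex[OF inj]) (rule sum.cong, auto)
  then show ?thesis unfolding eq
    by (subst sum.insert) (auto simp: sum.cartesian_product)
qed

lemma word_monomial_scaleR: "word_monomial w (t *\<^sub>R v) = t ^ length w * word_monomial w v"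
  by (induction w) (auto simp: algebra_simps)

text \<open>A multi-index of order \<open>l\<close> is represented by \<open>l! / \<alpha>!\<close>
  words, so dividing by the factorial of the word length gives the usual weights
  \<open>1 / \<alpha>!\<close> whenever the derivatives commute.\<close>

definition taylor_poly :: "'a::euclidean_space set \<Rightarrow> nat \<Rightarrow> ('a \<Rightarrow> 'b::real_normed_vector) \<Rightarrow> 'a \<Rightarrow> 'a list \<Rightarrow> 'a \<Rightarrow> 'b" where
  "taylor_poly S m f x w v = (\<Sum>u\<in>words m. (word_monomial u v / fact (length u)) *\<^sub>R iter_partial S (u @ w) f x)"

lemma Ck_on_has_derivative:
  fixes f :: "'a::euclidean_space \<Rightarrow> 'b::real_normed_vector"
  assumes "Ck_on k S f" "box_like S" "set w \<subseteq> Basis" "length w < k" "x \<in> S"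
  shows "(iter_partial S w f has_derivative (\<lambda>v. \<Sum>b\<in>Basis. (v \<bullet> b) *\<^sub>R iter_partial S (b # w) f x)) (at x within S)"
proof (rule has_derivative_of_partials[OF assms(2,5)])
  fix b y assume b_y: "b \<in> (Basis::'a set)" "y \<in> S"
  have "(\<lambda>h. iter_partial S w f (y + h *\<^sub>R b)) differentiable (at 0 within {h. y + h *\<^sub>R b \<in> S})"
    using assms(1,3,4) b_y by (auto simp: Ck_on_def)
  then show "((\<lambda>h. iter_partial S w f (y + h *\<^sub>R b)) has_vector_derivative iter_partial S (b # w) f y)
     (at 0 within {h. y + h *\<^sub>R b \<in> S})"
    by (simp add: vector_derivative_works partial_within_def)
next
  fix b assume "b \<in> (Basis::'a set)"
  then show "continuous_on S (iter_partial S (b # w) f)"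
    using assms(1,3,4) unfolding Ck_on_def by (metis insert_subset length_Cons list.simps(15) Suc_leI)
qed

text \<open>Along the segment, the derivative of the order \<open>Suc m\<close> remainder for
  \<open>w\<close> is the sum over \<open>b\<close> of \<open>v \<bullet> b\<close> times the order
  \<open>m\<close> remainder for \<open>b # w\<close>. With the induction taken over all words at
  once, the mean value inequality contributes one factor of the l1 norm of \<open>v\<close> per
  order. For \<open>m = 0\<close> the polynomial is empty and the bound is that on the
  derivative.\<close>

lemma taylor_words:
  fixes f :: "'a::euclidean_space \<Rightarrow> 'b::real_normed_vector"
  assumes Ck: "Ck_on k S f" "box_like S" and \<Omega>: "convex \<Omega>" "\<Omega> \<subseteq> S"
    and M: "\<And>w y. set w \<subseteq> Basis \<Longrightarrow> length w \<le> k \<Longrightarrow> y \<in> \<Omega> \<Longrightarrow> norm (iter_partial S w f y) \<le> M"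
    and xv: "x \<in> \<Omega>" "x + v \<in> \<Omega>" and w: "set w \<subseteq> Basis" "length w + m \<le> k"
  shows "norm (iter_partial S w f (x + v) - taylor_poly S m f x w v) \<le> M * (\<Sum>b\<in>Basis. \<bar>v \<bullet> b\<bar>) ^ m"
  using w xv(2)
proof (induction m arbitrary: w v)
  case 0
  have "words 0 = ({} :: 'a list set)" by (simp add: words_def)
  then show ?case using M[of w "x + v"] 0 by (simp add: taylor_poly_def)
next
  case (Suc m w v)
  define s where "s = (\<Sum>b\<in>Basis. \<bar>v \<bullet> b\<bar>)"
  have s0: "s \<ge> 0" by (simp add: s_def sum_nonneg)
  have M0: "M \<ge> 0" using M[of "[]" x] xv(1) by (auto intro: order_trans[OF norm_ge_zero])
  define D where "D w = iter_partial S w f" for w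
  define G where "G t = D w (x + t *\<^sub>R v) - taylor_poly S (Suc m) f x w (t *\<^sub>R v)" for t
  define G' where "G' t = (\<Sum>b\<in>Basis. (v \<bullet> b) *\<^sub>R (D (b # w) (x + t *\<^sub>R v) - taylor_poly S m f x (b # w) (t *\<^sub>R v)))" for t
  have seg: "x + t *\<^sub>R v \<in> \<Omega>" if "t \<in> closed_segment 0 1" for t
  proof -
    have "x + t *\<^sub>R v = (1 - t) *\<^sub>R x + t *\<^sub>R (x + v)" by (simp add: algebra_simps)
    moreover have "0 \<le> t" "t \<le> 1" using that by (auto simp: closed_segment_eq_real_ivl)
    ultimately show ?thesis using \<Omega>(1) xv(1) Suc.prems(3) convexD_alt by metis
  qed
  have "norm (G 1 - G 0) \<le> M * s ^ Suc m * \<bar>1 - 0\<bar>"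
  proof (rule vector_derivative_bound)
    fix t :: real assume t: "t \<in> closed_segment 0 1"
    have xt: "x + t *\<^sub>R v \<in> S" using seg[OF t] \<Omega>(2) by auto
    have "(D w has_derivative (\<lambda>h. \<Sum>b\<in>Basis. (h \<bullet> b) *\<^sub>R D (b # w) (x + t *\<^sub>R v))) (at (x + t *\<^sub>R v) within S)"
      using Ck_on_has_derivative[OF Ck Suc.prems(1) _ xt] Suc.prems(2) unfolding D_def by simp
    then have "((D w \<circ> (\<lambda>t. x + t *\<^sub>R v)) has_vector_derivative (\<Sum>b\<in>Basis. (v \<bullet> b) *\<^sub>R D (b # w) (x + t *\<^sub>R v)))
       (at t within closed_segment 0 1)"
      by (intro vector_derivative_diff_chain_within)
         (auto intro!: derivative_eq_intros elim!: has_derivative_subset dest: seg intro: subsetD[OF \<Omega>(2)])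
    then have 1: "((\<lambda>t. D w (x + t *\<^sub>R v)) has_vector_derivative (\<Sum>b\<in>Basis. (v \<bullet> b) *\<^sub>R D (b # w) (x + t *\<^sub>R v)))
       (at t within closed_segment 0 1)" by (simp add: o_def)
    have T: "taylor_poly S (Suc m) f x w (t *\<^sub>R v) = D w x + (\<Sum>b\<in>Basis. \<Sum>u\<in>words m.
        (t ^ Suc (length u) / fact (Suc (length u))) *\<^sub>R ((word_monomial u v * (v \<bullet> b)) *\<^sub>R D (u @ b # w) x))" for t
      unfolding taylor_poly_def sum_words_Suc
      by (simp add: D_def word_monomial_scaleR)
    have T': "taylor_poly S m f x (b # w) (t *\<^sub>R v) = (\<Sum>u\<in>words m.
        (t ^ length u / fact (length u)) *\<^sub>R (word_monomial u v *\<^sub>R D (u @ b # w) x))" for b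
      unfolding taylor_poly_def by (simp add: D_def word_monomial_scaleR)
    have pow: "((\<lambda>t. (t ^ Suc n / fact (Suc n)) *\<^sub>R c) has_vector_derivative (t ^ n / fact n) *\<^sub>R c) (at t within A)" for n A and c :: 'b
    proof -
      have "((\<lambda>t. t ^ Suc n / fact (Suc n)) has_real_derivative (t ^ n / fact n)) (at t within A)"
        by (rule derivative_eq_intros refl | simp)+
      from bounded_linear.has_vector_derivative[OF bounded_linear_scaleR_left
        this[unfolded has_real_derivative_iff_has_vector_derivative]]
      show ?thesis .
    qed
    have "((\<lambda>t. taylor_poly S (Suc m) f x w (t *\<^sub>R v)) has_vector_derivative
        (0 + (\<Sum>b\<in>Basis. \<Sum>u\<in>words m. (t ^ length u / fact (length u)) *\<^sub>R ((word_monomial u v * (v \<bullet> b)) *\<^sub>R D (u @ b # w) x))))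
        (at t within closed_segment 0 1)"
      unfolding T by (intro has_vector_derivative_add has_vector_derivative_const has_vector_derivative_sum pow)
    from has_vector_derivative_diff[OF 1 this]
    show "(G has_vector_derivative G' t) (at t within closed_segment 0 1)"
      unfolding G_def[abs_def] G'_def T'
      by (simp add: scaleR_diff_right sum_subtractf scaleR_sum_right mult.commute mult.left_commute)
    have "norm (G' t) \<le> (\<Sum>b\<in>Basis. \<bar>v \<bullet> b\<bar> * (M * s ^ m))"
      unfolding G'_def
    proof (rule sum_norm_le)
      fix b :: 'a assume b: "b \<in> Basis"
      have t01: "0 \<le> t" "t \<le> 1" using t by (auto simp: closed_segment_eq_real_ivl)
      have "norm (iter_partial S (b # w) f (x + t *\<^sub>R v) - taylor_poly S m f x (b # w) (t *\<^sub>R v))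
         \<le> M * (\<Sum>c\<in>Basis. \<bar>(t *\<^sub>R v) \<bullet> c\<bar>) ^ m"
        by (rule Suc.IH) (use b Suc.prems seg[OF t] in auto)
      also have "(\<Sum>c\<in>Basis. \<bar>(t *\<^sub>R v) \<bullet> c\<bar>) = t * s" using t01 by (simp add: s_def abs_mult sum_distrib_left)
      also have "M * (t * s) ^ m \<le> M * s ^ m"
        using t01 s0 M0 by (intro mult_left_mono power_mono) (auto simp: mult_left_le_one_le)
      finally show "norm ((v \<bullet> b) *\<^sub>R (D (b # w) (x + t *\<^sub>R v) - taylor_poly S m f x (b # w) (t *\<^sub>R v)))
         \<le> \<bar>v \<bullet> b\<bar> * (M * s ^ m)" unfolding D_def by (simp add: mult_left_mono)
    qed
    also have "\<dots> = M * s ^ Suc m" by (simp add: s_def sum_distrib_right[symmetric])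
    finally show "norm (G' t) \<le> M * s ^ Suc m" .
  qed
  moreover have "G 0 = 0"
    by (simp add: G_def D_def taylor_poly_def sum_words_Suc)
  ultimately show ?case by (simp add: G_def D_def s_def)
qed

section \<open>Global solutions of ordinary differential equations\<close>

text \<open>Integrating the exponential weight away from \<open>t\<close>, in either direction,
  reproduces it with a factor \<open>1 / l\<close>; this factor becomes the contraction constant of
  the Picard map.\<close>

lemma integral_between_exp_bound:
  fixes f :: "real \<Rightarrow> 'a::banach"
  assumes cont: "continuous_on {0..T} f" and st: "s \<in> {0..T}" "t \<in> {0..T}" and l: "l > 0"
    and bd: "\<And>\<tau>. \<tau> \<in> {0..T} \<Longrightarrow> norm (f \<tau>) \<le> c * exp (l * \<bar>\<tau> - t\<bar>)"
  shows "norm (integral {0..s} f - integral {0..t} f) \<le> c / l * exp (l * \<bar>s - t\<bar>)"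
proof -
  define I where "I u = integral {0..u} f" for u
  have der: "(I has_vector_derivative f u) (at u within {a..b})" if "u \<in> {a..b}" "0 \<le> a" "b \<le> T" for u a b
    unfolding I_def using that
    by (intro has_vector_derivative_within_subset[OF integral_has_vector_derivative[OF cont]]) auto
  have "0 \<le> norm (f t)" by simp
  also have "norm (f t) \<le> c" using bd[OF st(2)] by simp
  finally have c: "0 \<le> c" .
  consider "s = t" | "t < s" | "s < t" by linarith
  then show ?thesis
  proof cases
    case 1
    then show ?thesis using c l by simp
  next
    case 2
    have "norm (I s - I t) \<le> c / l * exp (l * (s - t)) - c / l * exp (l * (t - t))"
    proof (rule differentiable_bound_general[OF 2, where \<phi>' = "\<lambda>u. c * exp (l * (u - t))" and f' = f])
      show "continuous_on {t..s} I"
        by (rule continuous_on_vector_derivative[OF der]) (use st in auto)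
      show "(I has_vector_derivative f u) (at u)" if "t < u" "u < s" for u
        using der[of u t s] that st by (simp add: at_within_Icc_at)
      show "((\<lambda>u. c / l * exp (l * (u - t))) has_vector_derivative c * exp (l * (u - t))) (at u)" for u
        unfolding has_real_derivative_iff_has_vector_derivative[symmetric]
        using l by (auto intro!: derivative_eq_intros)
      show "norm (f u) \<le> c * exp (l * (u - t))" if "t < u" "u < s" for u
        using bd[of u] that st by auto
    qed (intro continuous_intros)
    moreover have "0 \<le> c / l" using c l by simp
    ultimately show ?thesis using 2 by (simp add: I_def)
  next
    case 3
    have "norm (I t - I s) \<le> - (c / l) * exp (l * (t - t)) - - (c / l) * exp (l * (t - s))"
    proof (rule differentiable_bound_general[OF 3, where \<phi>' = "\<lambda>u. c * exp (l * (t - u))" and f' = f])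
      show "continuous_on {s..t} I"
        by (rule continuous_on_vector_derivative[OF der]) (use st in auto)
      show "(I has_vector_derivative f u) (at u)" if "s < u" "u < t" for u
        using der[of u s t] that st by (simp add: at_within_Icc_at)
      show "((\<lambda>u. - (c / l) * exp (l * (t - u))) has_vector_derivative c * exp (l * (t - u))) (at u)" for u
        unfolding has_real_derivative_iff_has_vector_derivative[symmetric]
        using l by (auto intro!: derivative_eq_intros)
      show "norm (f u) \<le> c * exp (l * (t - u))" if "s < u" "u < t" for u
        using bd[of u] that st by auto
    qed (intro continuous_intros)
    moreover have "0 \<le> c / l" using c l by simp
    ultimately show ?thesis using 3 by (simp add: I_def norm_minus_commute)
  qed
qed

text \<open>Picard iteration contracts in the norm weighted by \<open>exp (- l * \<bar>s - t\<bar>)\<close> for \<open>l\<close> twice the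
  Lipschitz constant, so that no restriction to short time intervals is needed.\<close>

lemma lipschitz_ode_solution:
  fixes F :: "real \<Rightarrow> 'a::euclidean_space \<Rightarrow> 'a"
  assumes cont: "continuous_on ({0..T} \<times> UNIV) (\<lambda>(s, y). F s y)" and t: "t \<in> {0..T}"
    and lip: "\<And>s y z. s \<in> {0..T} \<Longrightarrow> norm (F s y - F s z) \<le> \<Lambda> * norm (y - z)"
  shows "\<exists>\<gamma>. \<gamma> t = x \<and> (\<forall>s\<in>{0..T}. (\<gamma> has_vector_derivative F s (\<gamma> s)) (at s within {0..T}))"
proof -
  define l where "l = 2 * \<bar>\<Lambda>\<bar> + 1"
  have l: "l > 0" by (simp add: l_def)
  \<comment> \<open>Bounded continuous functions live on the whole real line; clamping the time to
    the interval extends the Picard map to them.\<close>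
  define cl where "cl s = max 0 (min T s)" for s
  have T: "0 \<le> T" using t by simp
  have cl: "cl s \<in> {0..T}" for s using T by (simp add: cl_def)
  have cl_id: "s \<in> {0..T} \<Longrightarrow> cl s = s" for s by (simp add: cl_def)
  have cont_cl: "continuous_on UNIV cl" unfolding cl_def by (intro continuous_intros)
  define E where "E s = exp (l * \<bar>s - t\<bar>)" for s
  have E: "E s > 0" "continuous_on A E" for s A by (auto simp: E_def intro!: continuous_intros)
  \<comment> \<open>The unknown \<open>g\<close> is the trajectory divided by the weight
    \<open>E\<close>, so that the ordinary supremum metric on \<open>g\<close> is the weighted
    metric on trajectories.\<close>
  define f where "f g \<tau> = F \<tau> (E \<tau> *\<^sub>R apply_bcontfun g \<tau>)" for g \<tau>
  have cont_f: "continuous_on {0..T} (f g)" for g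
  proof -
    have "continuous_on {0..T} ((\<lambda>(s, y). F s y) \<circ> (\<lambda>\<tau>. (\<tau>, E \<tau> *\<^sub>R apply_bcontfun g \<tau>)))"
      by (rule continuous_on_compose) (auto intro!: continuous_intros E continuous_on_subset[OF cont])
    then show ?thesis by (simp add: o_def f_def[abs_def])
  qed
  define I where "I g s = integral {0..s} (f g)" for g s
  have derI: "(I g has_vector_derivative f g s) (at s within {0..T})" if "s \<in> {0..T}" for g s
    unfolding I_def by (rule integral_has_vector_derivative[OF cont_f that])
  have contI: "continuous_on {0..T} (I g)" for g
    by (rule continuous_on_vector_derivative[OF derI])
  define P where "P g s = (1 / E s) *\<^sub>R (x + I g s - I g t)" for g s
  have contP: "continuous_on {0..T} (P g)" for g
    unfolding P_def using E(1) by (intro continuous_intros contI E(2)) (auto simp: less_imp_neq[symmetric])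
  have mem: "(\<lambda>s. P g (cl s)) \<in> bcontfun" for g
  proof -
    have "continuous_on UNIV (P g \<circ> cl)"
      by (rule continuous_on_compose[OF cont_cl]) (rule continuous_on_subset[OF contP], use cl in auto)
    moreover have "bounded (P g ` {0..T})"
      by (intro compact_imp_bounded compact_continuous_image contP) simp
    then have "bounded (range (\<lambda>s. P g (cl s)))" by (rule bounded_subset) (use cl in auto)
    ultimately show ?thesis by (simp add: bcontfun_def o_def)
  qed
  define \<Phi> where "\<Phi> g = Bcontfun (\<lambda>s. P g (cl s))" for g
  have \<Phi>: "apply_bcontfun (\<Phi> g) s = P g (cl s)" for g s
    by (simp add: \<Phi>_def Bcontfun_inverse[OF mem])
  have "\<exists>!g. \<Phi> g = g"
  proof (rule banach_fix_type[where c = "1/2"])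
    show "\<forall>g h. dist (\<Phi> g) (\<Phi> h) \<le> 1 / 2 * dist g h"
    proof (intro allI)
    fix g h
    have "dist (\<Phi> g) (\<Phi> h) \<le> (1/2) * dist g h"
    proof (rule dist_bound)
      fix s0
      define s where "s = cl s0"
      have s: "s \<in> {0..T}" unfolding s_def by (rule cl)
      define c where "c = \<bar>\<Lambda>\<bar> * dist g h"
      have c0: "c \<ge> 0" by (simp add: c_def)
      have "norm (integral {0..s} (\<lambda>u. f g u - f h u) - integral {0..t} (\<lambda>u. f g u - f h u)) \<le> c / l * exp (l * \<bar>s - t\<bar>)"
      proof (rule integral_between_exp_bound[OF _ s t l])
        show "continuous_on {0..T} (\<lambda>u. f g u - f h u)" by (intro continuous_intros cont_f)
        fix \<tau> assume \<tau>: "\<tau> \<in> {0..T}"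
        have "norm (f g \<tau> - f h \<tau>) \<le> \<Lambda> * norm (E \<tau> *\<^sub>R apply_bcontfun g \<tau> - E \<tau> *\<^sub>R apply_bcontfun h \<tau>)"
          unfolding f_def by (rule lip[OF \<tau>])
        also have "\<dots> \<le> \<bar>\<Lambda>\<bar> * (E \<tau> * dist g h)"
          using E(1)[of \<tau>] dist_bounded[of g \<tau> h]
          by (intro mult_mono) (auto simp: scaleR_diff_right[symmetric] dist_norm)
        finally show "norm (f g \<tau> - f h \<tau>) \<le> c * exp (l * \<bar>\<tau> - t\<bar>)"
          by (simp add: c_def E_def algebra_simps)
      qed
      moreover have "integral {0..u} (\<lambda>u. f g u - f h u) = I g u - I h u" if "u \<in> {0..T}" for u
        unfolding I_def using that
        by (intro integral_diff integrable_continuous_real continuous_on_subset[OF cont_f]) auto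
      ultimately have *: "norm ((I g s - I h s) - (I g t - I h t)) \<le> c / l * E s"
        using s t by (simp add: E_def)
      have "P g s - P h s = (1 / E s) *\<^sub>R ((I g s - I h s) - (I g t - I h t))"
        by (simp add: P_def algebra_simps)
      then have "norm (P g s - P h s) = norm ((I g s - I h s) - (I g t - I h t)) / E s"
        using E(1)[of s] by simp
      also have "\<dots> \<le> c / l" using * E(1)[of s] by (simp add: pos_divide_le_eq)
      also have "\<dots> \<le> (1/2) * dist g h"
      proof -
        have "2 * c \<le> l * dist g h" by (simp add: c_def l_def algebra_simps)
        then show ?thesis using l by (simp add: field_simps)
      qed
      finally show "dist (apply_bcontfun (\<Phi> g) s0) (apply_bcontfun (\<Phi> h) s0) \<le> (1/2) * dist g h"
        by (simp add: \<Phi> dist_norm s_def)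
    qed
    then show "dist (\<Phi> g) (\<Phi> h) \<le> 1 / 2 * dist g h" .
    qed
  qed auto
  then obtain g where g: "\<Phi> g = g" by blast
  define \<gamma> where "\<gamma> s = x + I g s - I g t" for s
  have fix_eq: "E s *\<^sub>R apply_bcontfun g s = \<gamma> s" if "s \<in> {0..T}" for s
  proof -
    have "apply_bcontfun g s = P g s" using \<Phi>[of g s] g cl_id[OF that] by simp
    then show ?thesis using E(1)[of s] by (simp add: P_def \<gamma>_def)
  qed
  have "(\<gamma> has_vector_derivative F s (\<gamma> s)) (at s within {0..T})" if s: "s \<in> {0..T}" for s
  proof -
    have "f g s = F s (\<gamma> s)" using fix_eq[OF s] by (simp add: f_def)
    with derI[OF s, of g] show ?thesis unfolding \<gamma>_def by (auto intro!: derivative_eq_intros)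
  qed
  then show ?thesis by (intro exI[of _ \<gamma>]) (simp add: \<gamma>_def)
qed

text \<open>Gronwall in differential form, forwards and backwards. The case \<open>c = 1\<close>
  serves fields of linear growth, the case \<open>c = 0\<close> serves differences of two solutions
  and so uniqueness.\<close>

lemma growth_estimate:
  fixes \<gamma> :: "real \<Rightarrow> 'a::euclidean_space"
  assumes der: "\<And>s. s \<in> {a..b} \<Longrightarrow> (\<gamma> has_vector_derivative \<gamma>' s) (at s within {a..b})"
    and bd: "\<And>s. s \<in> {a..b} \<Longrightarrow> norm (\<gamma>' s) \<le> C * (c + norm (\<gamma> s))"
    and ab: "a \<le> b" and c: "c \<ge> 0" and C: "C \<ge> 0"
  shows "c + norm (\<gamma> b) \<le> (c + norm (\<gamma> a)) * exp (C * (b - a))"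
    and "c + norm (\<gamma> a) \<le> (c + norm (\<gamma> b)) * exp (C * (b - a))"
proof -
  have main: "c + norm (\<gamma> b) \<le> (c + \<delta> + norm (\<gamma> a)) * exp (C * (b - a)) \<and>
      c + norm (\<gamma> a) \<le> (c + \<delta> + norm (\<gamma> b)) * exp (C * (b - a))" if \<delta>: "\<delta> > 0" for \<delta>
  proof -
    \<comment> \<open>The norm is not differentiable at 0. This smooth substitute exceeds it by at
      most \<open>\<delta>\<close>, and \<open>\<delta>\<close> is sent to 0 at the end.\<close>
    define r where "r s = sqrt (\<delta>\<^sup>2 + \<gamma> s \<bullet> \<gamma> s)" for s
    define r' where "r' s = (\<gamma> s \<bullet> \<gamma>' s) / r s" for s
    have pos: "\<delta>\<^sup>2 + \<gamma> s \<bullet> \<gamma> s > 0" for s using \<delta> by (simp add: add_pos_nonneg)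
    have r: "r s > 0" "norm (\<gamma> s) \<le> r s" "r s \<le> \<delta> + norm (\<gamma> s)" for s
    proof -
      show "r s > 0" using pos by (simp add: r_def)
      show "norm (\<gamma> s) \<le> r s" unfolding r_def norm_eq_sqrt_inner by simp
      have "sqrt (\<delta>\<^sup>2 + (norm (\<gamma> s))\<^sup>2) \<le> \<delta> + norm (\<gamma> s)"
        using \<delta> by (intro real_le_lsqrt) (auto simp: power2_eq_square algebra_simps)
      then show "r s \<le> \<delta> + norm (\<gamma> s)" by (simp add: r_def power2_norm_eq_inner)
    qed
    have dr: "(r has_real_derivative r' s) (at s within {a..b})" if s: "s \<in> {a..b}" for s
    proof -
      have "((\<lambda>s. \<delta>\<^sup>2 + \<gamma> s \<bullet> \<gamma> s) has_real_derivative 2 * (\<gamma> s \<bullet> \<gamma>' s)) (at s within {a..b})"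
        using der[OF s] unfolding has_vector_derivative_def has_field_derivative_def
        by (auto intro!: derivative_eq_intros simp: inner_commute algebra_simps)
      then show ?thesis unfolding r_def r'_def
        by (rule DERIV_chain2[where f = sqrt, THEN DERIV_cong, rotated])
           (use pos[of s] in \<open>auto intro!: DERIV_real_sqrt simp: field_simps\<close>)
    qed
    have r': "\<bar>r' s\<bar> \<le> C * (c + r s)" if s: "s \<in> {a..b}" for s
    proof -
      have "\<bar>\<gamma> s \<bullet> \<gamma>' s\<bar> \<le> norm (\<gamma> s) * norm (\<gamma>' s)" by (rule Cauchy_Schwarz_ineq2)
      also have "\<dots> \<le> r s * norm (\<gamma>' s)" using r by (intro mult_right_mono) auto
      finally have "\<bar>r' s\<bar> \<le> norm (\<gamma>' s)" using r(1)[of s] by (simp add: r'_def abs_divide pos_divide_le_eq mult.commute)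
      also have "\<dots> \<le> C * (c + norm (\<gamma> s))" by (rule bd[OF s])
      also have "\<dots> \<le> C * (c + r s)" using r(2) C by (intro mult_left_mono) auto
      finally show ?thesis .
    qed
    \<comment> \<open>The mean value theorem shows that \<open>(c + r s) * exp (- C * s)\<close>
      does not increase, which is the forward estimate.\<close>
    have "\<exists>s\<in>{a..b}. (c + r b) * exp (- C * b) - (c + r a) * exp (- C * a) =
        ((r' s - C * (c + r s)) * exp (- C * s)) * (b - a)"
    proof (rule mvt_very_simple[OF ab])
      fix s assume "a \<le> s" "s \<le> b"
      then have "s \<in> {a..b}" by simp
      from dr[OF this] have "((\<lambda>s. (c + r s) * exp (- C * s)) has_real_derivative ((r' s - C * (c + r s)) * exp (- C * s))) (at s within {a..b})"
        by (auto intro!: derivative_eq_intros simp: algebra_simps)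
      then show "((\<lambda>s. (c + r s) * exp (- C * s)) has_derivative (*) ((r' s - C * (c + r s)) * exp (- C * s))) (at s within {a..b})"
        by (simp add: has_field_derivative_def)
    qed
    then obtain s where s: "s \<in> {a..b}" "(c + r b) * exp (- C * b) - (c + r a) * exp (- C * a) =
        ((r' s - C * (c + r s)) * exp (- C * s)) * (b - a)" by blast
    have "((r' s - C * (c + r s)) * exp (- C * s)) * (b - a) \<le> 0"
      using r'[OF s(1)] ab by (intro mult_nonpos_nonneg) auto
    then have "(c + r b) * exp (- C * b) \<le> (c + r a) * exp (- C * a)" using s(2) by linarith
    then have "(c + r b) * exp (- C * b) * exp (C * b) \<le> (c + r a) * exp (- C * a) * exp (C * b)"
      by (rule mult_right_mono) simp
    then have 1: "c + r b \<le> (c + r a) * exp (C * (b - a))"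
      by (simp add: mult.assoc exp_add[symmetric] algebra_simps)
    \<comment> \<open>Likewise \<open>(c + r s) * exp (C * s)\<close> does not decrease, which is
      the backward estimate.\<close>
    have "\<exists>s\<in>{a..b}. (c + r b) * exp (C * b) - (c + r a) * exp (C * a) =
        ((r' s + C * (c + r s)) * exp (C * s)) * (b - a)"
    proof (rule mvt_very_simple[OF ab])
      fix s assume "a \<le> s" "s \<le> b"
      then have "s \<in> {a..b}" by simp
      from dr[OF this] have "((\<lambda>s. (c + r s) * exp (C * s)) has_real_derivative ((r' s + C * (c + r s)) * exp (C * s))) (at s within {a..b})"
        by (auto intro!: derivative_eq_intros simp: algebra_simps)
      then show "((\<lambda>s. (c + r s) * exp (C * s)) has_derivative (*) ((r' s + C * (c + r s)) * exp (C * s))) (at s within {a..b})"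
        by (simp add: has_field_derivative_def)
    qed
    then obtain s where s: "s \<in> {a..b}" "(c + r b) * exp (C * b) - (c + r a) * exp (C * a) =
        ((r' s + C * (c + r s)) * exp (C * s)) * (b - a)" by blast
    have "((r' s + C * (c + r s)) * exp (C * s)) * (b - a) \<ge> 0"
      using r'[OF s(1)] ab by (intro mult_nonneg_nonneg) auto
    then have "(c + r a) * exp (C * a) \<le> (c + r b) * exp (C * b)" using s(2) by linarith
    then have "(c + r a) * exp (C * a) * exp (- C * a) \<le> (c + r b) * exp (C * b) * exp (- C * a)"
      by (rule mult_right_mono) simp
    then have 2: "c + r a \<le> (c + r b) * exp (C * (b - a))"
      by (simp add: mult.assoc exp_add[symmetric] algebra_simps)
    have m: "(c + r s) * exp (C * (b - a)) \<le> (c + \<delta> + norm (\<gamma> s)) * exp (C * (b - a))" for s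
      using r(3)[of s] by (intro mult_right_mono) auto
    show ?thesis using 1 2 m[of a] m[of b] r(2)[of a] r(2)[of b] by linarith
  qed
  have lim: "u \<le> v" if "\<And>\<delta>. \<delta> > 0 \<Longrightarrow> u \<le> v + \<delta> * exp (C * (b - a))" for u v :: real
  proof (rule field_le_epsilon)
    fix e :: real assume "e > 0"
    then show "u \<le> v + e" using that[of "e / exp (C * (b - a))"] by simp
  qed
  show "c + norm (\<gamma> b) \<le> (c + norm (\<gamma> a)) * exp (C * (b - a))"
    by (rule lim) (use main in \<open>simp add: algebra_simps\<close>)
  show "c + norm (\<gamma> a) \<le> (c + norm (\<gamma> b)) * exp (C * (b - a))"
    by (rule lim) (use main in \<open>simp add: algebra_simps\<close>)
qed

lemma growth_estimate_abs:
  fixes \<gamma> :: "real \<Rightarrow> 'a::euclidean_space"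
  assumes der: "\<And>s. s \<in> {0..T} \<Longrightarrow> (\<gamma> has_vector_derivative \<gamma>' s) (at s within {0..T})"
    and bd: "\<And>s. s \<in> {0..T} \<Longrightarrow> norm (\<gamma>' s) \<le> C * (c + norm (\<gamma> s))"
    and st: "s \<in> {0..T}" "t \<in> {0..T}" and c: "c \<ge> 0" and C: "C \<ge> 0"
  shows "c + norm (\<gamma> s) \<le> (c + norm (\<gamma> t)) * exp (C * \<bar>s - t\<bar>)"
proof -
  have d: "(\<gamma> has_vector_derivative \<gamma>' u) (at u within {a..b})" if "u \<in> {a..b}" "0 \<le> a" "b \<le> T" for u a b
    using that by (intro has_vector_derivative_within_subset[OF der]) auto
  show ?thesis
  proof (cases "t \<le> s")
    case True
    have "c + norm (\<gamma> s) \<le> (c + norm (\<gamma> t)) * exp (C * (s - t))"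
      by (rule growth_estimate(1)[OF d bd True c C]) (use st in auto)
    with True show ?thesis by simp
  next
    case False
    then have "s \<le> t" by simp
    have "c + norm (\<gamma> s) \<le> (c + norm (\<gamma> t)) * exp (C * (t - s))"
      by (rule growth_estimate(2)[OF d bd \<open>s \<le> t\<close> c C]) (use st in auto)
    with False show ?thesis by simp
  qed
qed

text \<open>Linear growth confines every solution to a ball of known radius. Composing the field
  with the projection onto that ball makes it globally Lipschitz without spoiling the growth bound,
  so the modified solution stays in the ball, where the projection is the identity.\<close>

lemma linear_growth_ode:
  fixes F :: "real \<Rightarrow> 'a::euclidean_space \<Rightarrow> 'a"
  assumes cont: "continuous_on ({0..T} \<times> UNIV) (\<lambda>(s, y). F s y)" and t: "t \<in> {0..T}"
    and lip: "\<And>R. \<exists>\<Lambda>. \<forall>s\<in>{0..T}. \<forall>y\<in>cball 0 R. \<forall>z\<in>cball 0 R. norm (F s y - F s z) \<le> \<Lambda> * norm (y - z)"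
    and growth: "\<And>s y. s \<in> {0..T} \<Longrightarrow> norm (F s y) \<le> C * (1 + norm y)" and C: "C \<ge> 0"
  shows "\<exists>\<gamma>. \<gamma> t = x \<and> (\<forall>s\<in>{0..T}. (\<gamma> has_vector_derivative F s (\<gamma> s)) (at s within {0..T}))"
    and "\<gamma> t = x \<Longrightarrow> (\<And>s. s\<in>{0..T} \<Longrightarrow> (\<gamma> has_vector_derivative F s (\<gamma> s)) (at s within {0..T})) \<Longrightarrow> s \<in> {0..T}
       \<Longrightarrow> 1 + norm (\<gamma> s) \<le> (1 + norm x) * exp (C * \<bar>s - t\<bar>)"
    and "\<gamma> t = x \<Longrightarrow> (\<And>s. s\<in>{0..T} \<Longrightarrow> (\<gamma> has_vector_derivative F s (\<gamma> s)) (at s within {0..T})) \<Longrightarrow>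
       \<gamma>2 t = x \<Longrightarrow> (\<And>s. s\<in>{0..T} \<Longrightarrow> (\<gamma>2 has_vector_derivative F s (\<gamma>2 s)) (at s within {0..T})) \<Longrightarrow> s \<in> {0..T}
       \<Longrightarrow> \<gamma> s = \<gamma>2 s"
proof -
  have bound: "1 + norm (\<gamma> s) \<le> (1 + norm x) * exp (C * \<bar>s - t\<bar>)"
    if "\<gamma> t = x" "\<And>s. s\<in>{0..T} \<Longrightarrow> (\<gamma> has_vector_derivative F s (\<gamma> s)) (at s within {0..T})" "s \<in> {0..T}" for \<gamma> s
    using growth_estimate_abs[OF that(2) growth that(3) t _ C] that(1) by simp
  then show "\<gamma> t = x \<Longrightarrow> (\<And>s. s\<in>{0..T} \<Longrightarrow> (\<gamma> has_vector_derivative F s (\<gamma> s)) (at s within {0..T})) \<Longrightarrow> s \<in> {0..T}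
       \<Longrightarrow> 1 + norm (\<gamma> s) \<le> (1 + norm x) * exp (C * \<bar>s - t\<bar>)" .
  define R where "R = (1 + norm x) * exp (C * T)"
  have R0: "R \<ge> 0" by (simp add: R_def)
  have expR: "(1 + norm x) * exp (C * \<bar>s - t\<bar>) \<le> R" if "s \<in> {0..T}" for s
    unfolding R_def using that t C by (intro mult_left_mono) (auto intro!: mult_left_mono)
  from lip[of R] obtain \<Lambda> where \<Lambda>: "\<And>s y z. s \<in> {0..T} \<Longrightarrow> y \<in> cball 0 R \<Longrightarrow> z \<in> cball 0 R \<Longrightarrow>
      norm (F s y - F s z) \<le> \<Lambda> * norm (y - z)" by blast
  show "\<gamma> t = x \<Longrightarrow> (\<And>s. s\<in>{0..T} \<Longrightarrow> (\<gamma> has_vector_derivative F s (\<gamma> s)) (at s within {0..T})) \<Longrightarrow>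
       \<gamma>2 t = x \<Longrightarrow> (\<And>s. s\<in>{0..T} \<Longrightarrow> (\<gamma>2 has_vector_derivative F s (\<gamma>2 s)) (at s within {0..T})) \<Longrightarrow> s \<in> {0..T}
       \<Longrightarrow> \<gamma> s = \<gamma>2 s"
  proof -
    assume 1: "\<gamma> t = x" "\<And>s. s\<in>{0..T} \<Longrightarrow> (\<gamma> has_vector_derivative F s (\<gamma> s)) (at s within {0..T})"
      and 2: "\<gamma>2 t = x" "\<And>s. s\<in>{0..T} \<Longrightarrow> (\<gamma>2 has_vector_derivative F s (\<gamma>2 s)) (at s within {0..T})"
      and s: "s \<in> {0..T}"
    have in1: "\<gamma> u \<in> cball 0 R" "\<gamma>2 u \<in> cball 0 R" if "u \<in> {0..T}" for u
      using bound[OF 1 that] bound[OF 2 that] expR[OF that] by auto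
    have "0 + norm (\<gamma> s - \<gamma>2 s) \<le> (0 + norm (\<gamma> t - \<gamma>2 t)) * exp (\<bar>\<Lambda>\<bar> * \<bar>s - t\<bar>)"
    proof (rule growth_estimate_abs[where \<gamma> = "\<lambda>s. \<gamma> s - \<gamma>2 s" and \<gamma>' = "\<lambda>s. F s (\<gamma> s) - F s (\<gamma>2 s)", OF _ _ s t])
      fix u assume u: "u \<in> {0..T}"
      show "((\<lambda>s. \<gamma> s - \<gamma>2 s) has_vector_derivative F u (\<gamma> u) - F u (\<gamma>2 u)) (at u within {0..T})"
        by (intro has_vector_derivative_diff 1 2 u)
      have "norm (F u (\<gamma> u) - F u (\<gamma>2 u)) \<le> \<Lambda> * norm (\<gamma> u - \<gamma>2 u)"
        by (rule \<Lambda>[OF u in1[OF u]])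
      also have "\<dots> \<le> \<bar>\<Lambda>\<bar> * norm (\<gamma> u - \<gamma>2 u)" by (intro mult_right_mono) auto
      finally show "norm (F u (\<gamma> u) - F u (\<gamma>2 u)) \<le> \<bar>\<Lambda>\<bar> * (0 + norm (\<gamma> u - \<gamma>2 u))" by simp
    qed auto
    then show "\<gamma> s = \<gamma>2 s" using 1(1) 2(1) by simp
  qed
  \<comment> \<open>The projection has Lipschitz constant 1 and does not increase the norm; both
    properties are needed for the modified field.\<close>
  define P where "P = closest_point (cball (0::'a) R)"
  have cb: "convex (cball (0::'a) R)" "closed (cball (0::'a) R)" "cball (0::'a) R \<noteq> {}" using R0 by auto
  have P_in: "P y \<in> cball 0 R" for y unfolding P_def by (rule closest_point_in_set[OF cb(2,3)])
  have P_id: "y \<in> cball 0 R \<Longrightarrow> P y = y" for y unfolding P_def by (rule closest_point_self)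
  have P_lip: "norm (P y - P z) \<le> norm (y - z)" for y z
    unfolding P_def using closest_point_lipschitz[OF cb, of y z] by (simp add: dist_norm)
  have P_norm: "norm (P y) \<le> norm y" for y using P_lip[of y 0] P_id[of 0] R0 by simp
  have "\<exists>\<gamma>. \<gamma> t = x \<and> (\<forall>s\<in>{0..T}. (\<gamma> has_vector_derivative F s (P (\<gamma> s))) (at s within {0..T}))"
  proof (rule lipschitz_ode_solution[where F = "\<lambda>s y. F s (P y)", OF _ t])
    have "continuous_on ({0..T} \<times> UNIV) ((\<lambda>(s, y). F s y) \<circ> (\<lambda>(s, y). (s, P y)))"
    proof (rule continuous_on_compose)
      show "continuous_on ({0..T} \<times> UNIV) (\<lambda>(s, y). (s, P y))"
        unfolding P_def case_prod_beta
        by (intro continuous_intros continuous_on_compose2[OF continuous_on_closest_point[OF cb, of UNIV]]) auto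
      show "continuous_on ((\<lambda>(s, y). (s, P y)) ` ({0..T} \<times> UNIV)) (\<lambda>(s, y). F s y)"
        by (rule continuous_on_subset[OF cont]) auto
    qed
    then show "continuous_on ({0..T} \<times> UNIV) (\<lambda>(s, y). F s (P y))"
      by (simp add: o_def case_prod_beta)
    show "norm (F s (P y) - F s (P z)) \<le> \<bar>\<Lambda>\<bar> * norm (y - z)" if "s \<in> {0..T}" for s y z
    proof -
      have "norm (F s (P y) - F s (P z)) \<le> \<Lambda> * norm (P y - P z)" by (rule \<Lambda>[OF that P_in P_in])
      also have "\<dots> \<le> \<bar>\<Lambda>\<bar> * norm (y - z)" using P_lip by (intro mult_mono) auto
      finally show ?thesis .
    qed
  qed
  then obtain \<gamma> where \<gamma>: "\<gamma> t = x" "\<And>s. s\<in>{0..T} \<Longrightarrow> (\<gamma> has_vector_derivative F s (P (\<gamma> s))) (at s within {0..T})" by blast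
  have "P (\<gamma> s) = \<gamma> s" if s: "s \<in> {0..T}" for s
  proof (rule P_id)
    have "1 + norm (\<gamma> s) \<le> (1 + norm (\<gamma> t)) * exp (C * \<bar>s - t\<bar>)"
    proof (rule growth_estimate_abs[OF \<gamma>(2) _ s t _ C])
      fix u assume u: "u \<in> {0..T}"
      have "norm (F u (P (\<gamma> u))) \<le> C * (1 + norm (P (\<gamma> u)))" by (rule growth[OF u])
      also have "\<dots> \<le> C * (1 + norm (\<gamma> u))" using P_norm C by (intro mult_left_mono add_left_mono) auto
      finally show "norm (F u (P (\<gamma> u))) \<le> C * (1 + norm (\<gamma> u))" .
    qed auto
    then show "\<gamma> s \<in> cball 0 R" using expR[OF s] \<gamma>(1) by simp
  qed
  with \<gamma> show "\<exists>\<gamma>. \<gamma> t = x \<and> (\<forall>s\<in>{0..T}. (\<gamma> has_vector_derivative F s (\<gamma> s)) (at s within {0..T}))"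
    by (intro exI[of _ \<gamma>]) auto
qed

section \<open>Polynomials in the weighted coefficient norm\<close>

text \<open>Says that \<open>f\<close> has a representation as a finite sum of word monomials whose
  coefficients, weighted by \<open>\<rho>\<close> to the word length, have absolute sum at most
  \<open>B\<close>. The inductive form avoids coefficient families, and concatenation of words makes
  this norm submultiplicative.\<close>

inductive majorized :: "real \<Rightarrow> real \<Rightarrow> ('a::euclidean_space \<Rightarrow> real) \<Rightarrow> bool" for \<rho> :: real where
  zero: "0 \<le> B \<Longrightarrow> majorized \<rho> B (\<lambda>v. 0)"
| add_monomial: "majorized \<rho> B f \<Longrightarrow> set w \<subseteq> Basis \<Longrightarrow> B + \<bar>a\<bar> * \<rho> ^ length w \<le> B' \<Longrightarrow>
    majorized \<rho> B' (\<lambda>v. a * word_monomial w v + f v)"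

lemma majorized_mono: "majorized \<rho> B f \<Longrightarrow> B \<le> B' \<Longrightarrow> majorized \<rho> B' f"
  by (induction rule: majorized.induct) (auto intro: majorized.intros order_trans)

lemma majorized_monomial: "set w \<subseteq> Basis \<Longrightarrow> majorized \<rho> (\<bar>a\<bar> * \<rho> ^ length w) (\<lambda>v. a * word_monomial w v)"
  using majorized.add_monomial[OF majorized.zero[of 0], of w a] by simp

lemma majorized_const: "majorized \<rho> \<bar>c\<bar> (\<lambda>v. c)"
  using majorized_monomial[of "[]" \<rho> c] by simp

lemma majorized_coord: "b \<in> Basis \<Longrightarrow> majorized \<rho> \<rho> (\<lambda>v. v \<bullet> b)"
  using majorized_monomial[of "[b]" \<rho> 1] by simp

lemma majorized_nonneg: "majorized \<rho> B f \<Longrightarrow> 0 \<le> \<rho> \<Longrightarrow> 0 \<le> B"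
proof (induction rule: majorized.induct)
  case (add_monomial B f w a B')
  then have "0 \<le> \<bar>a\<bar> * \<rho> ^ length w" by simp
  with add_monomial show ?case by linarith
qed

lemma majorized_add:
  assumes "majorized \<rho> B f" "majorized \<rho> B' g"
  shows "majorized \<rho> (B + B') (\<lambda>v. f v + g v)"
  using assms
proof (induction rule: majorized.induct)
  case (zero B)
  then show ?case by (simp add: majorized_mono)
next
  case (add_monomial B f w a B'')
  have "majorized \<rho> (B'' + B') (\<lambda>v. a * word_monomial w v + (f v + g v))"
    by (rule majorized.add_monomial[OF add_monomial.IH[OF add_monomial.prems] add_monomial.hyps(2)])
       (use add_monomial.hyps(3) in simp)
  then show ?case by (simp add: add.assoc)
qed

lemma majorized_monomial_mult:
  assumes "majorized \<rho> B f" "set w \<subseteq> Basis" "0 \<le> \<rho>"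
  shows "majorized \<rho> (\<bar>a\<bar> * \<rho> ^ length w * B) (\<lambda>v. a * word_monomial w v * f v)"
  using assms
proof (induction rule: majorized.induct)
  case (zero B)
  then show ?case by (simp add: majorized.zero)
next
  case (add_monomial B f u c B')
  have "\<bar>a\<bar> * \<rho> ^ length w * (B + \<bar>c\<bar> * \<rho> ^ length u) \<le> \<bar>a\<bar> * \<rho> ^ length w * B'"
    using add_monomial by (intro mult_left_mono) auto
  then have "majorized \<rho> (\<bar>a\<bar> * \<rho> ^ length w * B')
     (\<lambda>v. (a * c) * word_monomial (w @ u) v + a * word_monomial w v * f v)"
    by (intro majorized.add_monomial[OF add_monomial.IH[OF add_monomial.prems]])
       (use add_monomial in \<open>auto simp: algebra_simps abs_mult power_add\<close>)
  then show ?case by (simp add: algebra_simps)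
qed

lemma majorized_mult:
  assumes "majorized \<rho> B f" "majorized \<rho> B' g" "0 \<le> \<rho>"
  shows "majorized \<rho> (B * B') (\<lambda>v. f v * g v)"
  using assms
proof (induction rule: majorized.induct)
  case (zero B)
  then show ?case using majorized_nonneg[OF zero.prems] by (simp add: majorized.zero)
next
  case (add_monomial B f w a B'')
  have "majorized \<rho> (\<bar>a\<bar> * \<rho> ^ length w * B' + B * B') (\<lambda>v. a * word_monomial w v * g v + f v * g v)"
    by (intro majorized_add majorized_monomial_mult add_monomial)
  moreover have "(B + \<bar>a\<bar> * \<rho> ^ length w) * B' \<le> B'' * B'"
    using add_monomial majorized_nonneg[OF add_monomial.prems] by (intro mult_right_mono) auto
  ultimately show ?case by (auto simp: algebra_simps elim: majorized_mono)
qed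

lemma majorized_scale:
  assumes "majorized \<rho> B f" "0 \<le> \<rho>"
  shows "majorized \<rho> (\<bar>c\<bar> * B) (\<lambda>v. c * f v)"
  by (rule majorized_mult[OF majorized_const assms])

lemma majorized_diff:
  assumes "majorized \<rho> B f" "majorized \<rho> B' g" "0 \<le> \<rho>"
  shows "majorized \<rho> (B + B') (\<lambda>v. f v - g v)"
  using majorized_add[OF assms(1) majorized_scale[OF assms(2,3), of "- 1"]] by simp

lemma majorized_sum:
  assumes "finite A" "\<And>i. i \<in> A \<Longrightarrow> majorized \<rho> (B i) (f i)"
  shows "majorized \<rho> (\<Sum>i\<in>A. B i) (\<lambda>v. \<Sum>i\<in>A. f i v)"
  using assms by (induction A rule: finite_induct) (auto intro: majorized.zero majorized_add)

text \<open>Substitution of polynomials into a monomial: if every component of \<open>\<xi>\<close>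
  has norm at most \<open>s\<close>, a word costs one factor \<open>s\<close> per letter.\<close>

lemma majorized_word_monomial:
  assumes "\<And>b. b \<in> Basis \<Longrightarrow> majorized \<rho> s (\<lambda>v. \<xi> v \<bullet> b)" "set u \<subseteq> Basis" "0 \<le> \<rho>"
  shows "majorized \<rho> (s ^ length u) (\<lambda>v. word_monomial u (\<xi> v))"
  using assms(2)
proof (induction u)
  case Nil
  show ?case using majorized_const[of \<rho> 1] by simp
next
  case (Cons b u)
  then show ?case using majorized_mult[OF assms(1)[of b] Cons.IH assms(3)] by simp
qed

lemma word_monomial_bound:
  assumes "\<And>b. b \<in> Basis \<Longrightarrow> \<bar>v \<bullet> b\<bar> \<le> h" "set w \<subseteq> Basis"
  shows "\<bar>word_monomial w v\<bar> \<le> h ^ length w"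
  using assms(2)
proof (induction w)
  case (Cons b w)
  have "\<bar>v \<bullet> b\<bar> * \<bar>word_monomial w v\<bar> \<le> h * h ^ length w"
    using Cons assms(1)[of b] by (intro mult_mono) auto
  then show ?case by (simp add: abs_mult)
qed simp

lemma majorized_bound:
  assumes "majorized \<rho> B f" "\<And>b. b \<in> Basis \<Longrightarrow> \<bar>v \<bullet> b\<bar> \<le> \<rho>"
  shows "\<bar>f v\<bar> \<le> B"
  using assms(1)
proof (induction rule: majorized.induct)
  case (add_monomial B f w a B')
  have "\<bar>a * word_monomial w v\<bar> \<le> \<bar>a\<bar> * \<rho> ^ length w"
    unfolding abs_mult using word_monomial_bound[OF assms(2) add_monomial.hyps(2)] by (intro mult_left_mono) auto
  with add_monomial show ?case by linarith
qed simp

text \<open>A dropped word has length at least \<open>k\<close>, so its value is its weighted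
  coefficient times a power of \<open>h / \<rho> \<le> 1\<close> with exponent at least
  \<open>k\<close>. A kept coefficient is bounded after division by a power of
  \<open>\<rho> \<le> 1\<close>. The degree of \<open>f\<close> does not enter, which allows
  truncation after arbitrarily many Euler steps.\<close>

lemma majorized_truncate:
  assumes "majorized \<rho> B f" "0 < \<rho>" "\<rho> \<le> 1"
  shows "\<exists>a. (\<forall>w\<in>words k. \<bar>a w\<bar> \<le> B / \<rho> ^ k) \<and>
    (\<forall>v h. 0 \<le> h \<and> h \<le> \<rho> \<and> (\<forall>b\<in>Basis. \<bar>v \<bullet> b\<bar> \<le> h) \<longrightarrow>
       \<bar>f v - (\<Sum>w\<in>words k. a w * word_monomial w v)\<bar> \<le> B * (h / \<rho>) ^ k)"
  using assms(1)
proof (induction rule: majorized.induct)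
  case (zero B)
  then show ?case using assms by (intro exI[of _ "\<lambda>_. 0"]) auto
next
  case (add_monomial B f w c B')
  from add_monomial.IH obtain a where a: "\<And>u. u\<in>words k \<Longrightarrow> \<bar>a u\<bar> \<le> B / \<rho> ^ k"
    "\<And>v h. 0 \<le> h \<Longrightarrow> h \<le> \<rho> \<Longrightarrow> (\<forall>b\<in>Basis. \<bar>v \<bullet> b\<bar> \<le> h) \<Longrightarrow>
       \<bar>f v - (\<Sum>w\<in>words k. a w * word_monomial w v)\<bar> \<le> B * (h / \<rho>) ^ k" by blast
  have BB: "B \<le> B'" using add_monomial.hyps(3) assms(2) by (smt (verit) mult_nonneg_nonneg zero_le_power abs_ge_zero)
  have B0: "0 \<le> B" using majorized_nonneg[OF add_monomial.hyps(1)] assms(2) by simp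
  show ?case
  proof (cases "w \<in> words k")
    case True
    define a' where "a' u = (if u = w then a w + c else a u)" for u
    have "\<bar>a' u\<bar> \<le> B' / \<rho> ^ k" if u: "u \<in> words k" for u
    proof (cases "u = w")
      case uw: True
      have "\<rho> ^ k \<le> \<rho> ^ length w" using True assms by (intro power_decreasing) (auto simp: words_def)
      then have "\<bar>c\<bar> * \<rho> ^ k \<le> \<bar>c\<bar> * \<rho> ^ length w" by (intro mult_left_mono) auto
      then have "B + \<bar>c\<bar> * \<rho> ^ k \<le> B'" using add_monomial.hyps(3) by linarith
      from divide_right_mono[OF this, of "\<rho> ^ k"]
      have "B / \<rho> ^ k + \<bar>c\<bar> \<le> B' / \<rho> ^ k" using assms by (simp add: add_divide_distrib)
      then show ?thesis using a(1)[OF True] uw by (simp add: a'_def)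
    next
      case False
      have "B / \<rho> ^ k \<le> B' / \<rho> ^ k" using BB assms by (simp add: divide_right_mono)
      then show ?thesis using a(1)[OF u] False by (simp add: a'_def)
    qed
    moreover have "(\<Sum>u\<in>words k. a' u * word_monomial u v) = c * word_monomial w v + (\<Sum>u\<in>words k. a u * word_monomial u v)" for v
    proof -
      have "(\<Sum>u\<in>words k. a' u * word_monomial u v) =
         (\<Sum>u\<in>words k. a u * word_monomial u v + (if u = w then c * word_monomial w v else 0))"
        by (rule sum.cong) (auto simp: a'_def algebra_simps)
      also have "\<dots> = (\<Sum>u\<in>words k. a u * word_monomial u v) + c * word_monomial w v"
        using True by (simp add: sum.distrib)
      finally show ?thesis by simp
    qed
    moreover have "\<bar>f v - (\<Sum>w\<in>words k. a w * word_monomial w v)\<bar> \<le> B' * (h / \<rho>) ^ k"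
      if "0 \<le> h" "h \<le> \<rho>" "\<forall>b\<in>Basis. \<bar>v \<bullet> b\<bar> \<le> h" for v h
      by (rule order_trans[OF a(2)[OF that]]) (use that BB assms in \<open>auto intro: mult_right_mono\<close>)
    ultimately show ?thesis by (intro exI[of _ a']) simp
  next
    case False
    have "k \<le> length w" using False add_monomial.hyps(2) by (auto simp: words_def)
    have "\<bar>c * word_monomial w v + f v - (\<Sum>w\<in>words k. a w * word_monomial w v)\<bar> \<le> B' * (h / \<rho>) ^ k"
      if h: "0 \<le> h" "h \<le> \<rho>" "\<forall>b\<in>Basis. \<bar>v \<bullet> b\<bar> \<le> h" for v h
    proof -
      have "\<bar>c * word_monomial w v\<bar> \<le> \<bar>c\<bar> * h ^ length w"
        unfolding abs_mult using word_monomial_bound[of v h w] h add_monomial.hyps(2) by (intro mult_left_mono) auto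
      also have "\<dots> = \<bar>c\<bar> * \<rho> ^ length w * (h / \<rho>) ^ length w" using assms by (simp add: power_divide)
      also have "\<dots> \<le> \<bar>c\<bar> * \<rho> ^ length w * (h / \<rho>) ^ k"
        using h assms \<open>k \<le> length w\<close> by (intro mult_left_mono power_decreasing) auto
      finally have "\<bar>c * word_monomial w v\<bar> + \<bar>f v - (\<Sum>w\<in>words k. a w * word_monomial w v)\<bar>
         \<le> (B + \<bar>c\<bar> * \<rho> ^ length w) * (h / \<rho>) ^ k"
        using a(2)[OF h(1,2,3)] by (simp add: algebra_simps)
      also have "\<dots> \<le> B' * (h / \<rho>) ^ k"
        using add_monomial.hyps(3) h assms by (intro mult_right_mono) auto
      finally show ?thesis by linarith
    qed
    moreover have "\<bar>a u\<bar> \<le> B' / \<rho> ^ k" if "u \<in> words k" for u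
      using a(1)[OF that] divide_right_mono[OF BB, of "\<rho> ^ k"] assms by simp
    ultimately show ?thesis by (intro exI[of _ a]) blast
  qed
qed

lemma word_monomial_diff_bound:
  assumes "\<And>b. b \<in> Basis \<Longrightarrow> \<bar>v \<bullet> b\<bar> \<le> 1" "\<And>b. b \<in> Basis \<Longrightarrow> \<bar>v' \<bullet> b\<bar> \<le> 1" "set w \<subseteq> Basis"
  shows "\<bar>word_monomial w v - word_monomial w v'\<bar> \<le> length w * norm (v - v')"
  using assms(3)
proof (induction w)
  case (Cons b w)
  have b: "b \<in> Basis" using Cons.prems by simp
  have "(v \<bullet> b) * word_monomial w v - (v' \<bullet> b) * word_monomial w v' =
     ((v - v') \<bullet> b) * word_monomial w v + (v' \<bullet> b) * (word_monomial w v - word_monomial w v')"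
    by (simp add: algebra_simps)
  also have "\<bar>\<dots>\<bar> \<le> \<bar>(v - v') \<bullet> b\<bar> * \<bar>word_monomial w v\<bar> + \<bar>v' \<bullet> b\<bar> * \<bar>word_monomial w v - word_monomial w v'\<bar>"
    by (metis abs_mult abs_triangle_ineq)
  also have "\<dots> \<le> norm (v - v') * 1 + 1 * (length w * norm (v - v'))"
  proof (intro add_mono mult_mono)
    show "\<bar>(v - v') \<bullet> b\<bar> \<le> norm (v - v')" using b by (rule Basis_le_norm)
    show "\<bar>word_monomial w v\<bar> \<le> 1" using word_monomial_bound[of v 1 w] assms(1) Cons.prems by simp
    show "\<bar>word_monomial w v - word_monomial w v'\<bar> \<le> length w * norm (v - v')" using Cons by simp
  qed (use assms(2)[OF b] in auto)
  finally show ?case by (simp add: algebra_simps)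
qed simp

lemma discrete_gronwall:
  fixes e :: "nat \<Rightarrow> real"
  assumes "\<And>i. i < N \<Longrightarrow> e (Suc i) \<le> (1 + a) * e i + b" "e 0 \<le> e0" "0 \<le> a" "0 \<le> b" "0 \<le> e0" "i \<le> N"
  shows "e i \<le> (e0 + i * b) * exp (a * i)"
proof -
  have "e i \<le> (e0 + i * b) * (1 + a) ^ i"
    using assms(6)
  proof (induction i)
    case (Suc i)
    have p: "(1 + a) ^ Suc i \<ge> 1" using assms(3) by (intro one_le_power) simp
    have "e (Suc i) \<le> (1 + a) * e i + b" using assms(1) Suc.prems by simp
    also have "\<dots> \<le> (1 + a) * ((e0 + i * b) * (1 + a) ^ i) + b * (1 + a) ^ Suc i"
      using Suc assms p by (intro add_mono mult_left_mono) (auto simp: mult_le_cancel_left1)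
    also have "\<dots> = (e0 + Suc i * b) * (1 + a) ^ Suc i" by (simp add: algebra_simps)
    finally show ?case .
  qed (use assms(2) in simp)
  also have "(1 + a) ^ i \<le> exp a ^ i" using assms(3) by (intro power_mono) auto
  then have "(e0 + i * b) * (1 + a) ^ i \<le> (e0 + i * b) * exp (a * i)"
    using assms by (intro mult_left_mono) (auto simp: exp_of_nat_mult[symmetric] mult.commute)
  finally show ?thesis .
qed

section \<open>Euler approximation of the characteristic flow\<close>

lemma box_like_txe_domain: "box_like (txe_domain T UNIV :: ('n::finite, 'm::finite) txe set)"
  unfolding box_like_def
proof (intro ballI allI impI)
  fix p q z :: "('n, 'm) txe"
  assume p: "p \<in> txe_domain T UNIV" and q: "q \<in> txe_domain T UNIV"
    and z: "\<forall>b\<in>Basis. z \<bullet> b \<in> closed_segment (p \<bullet> b) (q \<bullet> b)"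
  have seg: "l \<le> w \<and> w \<le> u" if "w \<in> closed_segment x y" "l \<le> x" "x \<le> u" "l \<le> y" "y \<le> u" for w x y l u :: real
    using that by (auto simp: closed_segment_eq_real_ivl split: if_splits)
  have "(1, 0, 0) \<in> (Basis :: ('n, 'm) txe set)" by (simp add: Basis_prod_def zero_prod_def)
  then have "z \<bullet> (1, 0, 0) \<in> closed_segment (p \<bullet> (1, 0, 0)) (q \<bullet> (1, 0, 0))" using z by blast
  then have "fst z \<in> closed_segment (fst p) (fst q)" by (simp add: inner_prod_def)
  then have 1: "fst z \<in> {0..T}" using p q seg[of "fst z" "fst p" "fst q" 0 T] by (auto simp: txe_domain_def)
  have "0 \<bullet> b \<le> snd (snd z) \<bullet> b \<and> snd (snd z) \<bullet> b \<le> 1 \<bullet> b" if b: "b \<in> Basis" for b :: "real ^ 'm"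
  proof -
    have "z \<bullet> (0, 0, b) \<in> closed_segment (p \<bullet> (0, 0, b)) (q \<bullet> (0, 0, b))"
      using z b by (auto simp: Basis_prod_def)
    then have "snd (snd z) \<bullet> b \<in> closed_segment (snd (snd p) \<bullet> b) (snd (snd q) \<bullet> b)" by (simp add: inner_prod_def)
    with p q b show ?thesis
      by (intro seg) (auto simp: txe_domain_def param_cube_def mem_box)
  qed
  then have "snd (snd z) \<in> param_cube" by (simp add: param_cube_def mem_box)
  with 1 show "z \<in> txe_domain T UNIV" by (cases z) (auto simp: txe_domain_def)
qed

lemma convex_txe_domain: "convex A \<Longrightarrow> convex (txe_domain T A)"
  unfolding txe_domain_def param_cube_def by (intro convex_Times convex_box) auto

lemma compact_txe_domain: "compact A \<Longrightarrow> compact (txe_domain T A)"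
  unfolding txe_domain_def param_cube_def by (intro compact_Times compact_cbox) auto

section \<open>Uniform bounds and Lipschitz constants from the C^k norm\<close>

lemma Ck_norm_bound:
  assumes Ck: "Ck_on k S f" and \<Omega>: "compact \<Omega>" "\<Omega> \<subseteq> S" and w: "set w \<subseteq> Basis" "length w \<le> k" and x: "x \<in> \<Omega>"
  shows "norm (iter_partial S w f x) \<le> Ck_norm k S \<Omega> f"
proof -
  have "continuous_on \<Omega> (\<lambda>x. norm (iter_partial S w f x))"
    using Ck w \<Omega>(2) unfolding Ck_on_def by (intro continuous_intros) (blast intro: continuous_on_subset)
  then have "bdd_above ((\<lambda>x. norm (iter_partial S w f x)) ` \<Omega>)"
    using \<Omega>(1) by (intro bounded_imp_bdd_above compact_imp_bounded compact_continuous_image)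
  then have "norm (iter_partial S w f x) \<le> (SUP x\<in>\<Omega>. norm (iter_partial S w f x))"
    using x by (rule cSUP_upper[rotated])
  also have "\<dots> \<le> Ck_norm k S \<Omega> f"
    unfolding Ck_norm_def using w by (intro Max_ge finite_imageI) (auto simp: finite_lists_length_le)
  finally show ?thesis .
qed

text \<open>The Taylor estimate of order 1: the polynomial is then the constant \<open>f x\<close>,
  as the only word is the empty one.\<close>

lemma Ck_on_lipschitz:
  fixes f :: "'a::euclidean_space \<Rightarrow> 'b::real_normed_vector"
  assumes Ck: "Ck_on k S f" "box_like S" "k \<ge> 1" and \<Omega>: "convex \<Omega>" "\<Omega> \<subseteq> S"
    and M: "\<And>w y. set w \<subseteq> Basis \<Longrightarrow> length w \<le> k \<Longrightarrow> y \<in> \<Omega> \<Longrightarrow> norm (iter_partial S w f y) \<le> M"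
    and xy: "x \<in> \<Omega>" "y \<in> \<Omega>"
  shows "norm (f y - f x) \<le> M * DIM('a) * norm (y - x)"
proof -
  have M0: "M \<ge> 0" using M[of "[]" x] xy(1) by (auto intro: order_trans[OF norm_ge_zero])
  have "x + (y - x) \<in> \<Omega>" using xy by simp
  from taylor_words[OF Ck(1,2) \<Omega> M xy(1) this, of "[]" 1] Ck(3)
  have "norm (f y - taylor_poly S 1 f x [] (y - x)) \<le> M * (\<Sum>b\<in>Basis. \<bar>(y - x) \<bullet> b\<bar>)" by simp
  moreover have "words 1 = {[] :: 'a list}" by (auto simp: words_def)
  then have "taylor_poly S 1 f x [] (y - x) = f x" by (simp add: taylor_poly_def)
  moreover have "(\<Sum>b\<in>Basis. \<bar>(y - x) \<bullet> b\<bar>) \<le> (\<Sum>b\<in>(Basis::'a set). norm (y - x))"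
    by (intro sum_mono Basis_le_norm)
  then have "M * (\<Sum>b\<in>Basis. \<bar>(y - x) \<bullet> b\<bar>) \<le> M * (DIM('a) * norm (y - x))"
    using M0 by (intro mult_left_mono) auto
  ultimately show ?thesis by simp
qed

text \<open>Collects what the constants may depend on. The numbers \<open>C\<close> and the field
  \<open>V\<close> influence them only through \<open>M\<close>, so every constant defined below is
  built from \<open>k\<close>, \<open>T\<close>, \<open>\<kappa>\<close>, \<open>M\<close> and the
  dimensions alone.\<close>

locale transport_field =
  fixes k :: nat and T C \<kappa> M :: real and V :: "('n::finite, 'm::finite) txe \<Rightarrow> real ^ 'n"
  assumes k: "k \<ge> 1" and T: "T > 0" and C: "C > 0" and \<kappa>: "\<kappa> \<ge> 0"
    and Ck: "Ck_on k (txe_domain T UNIV) V"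
    and growth: "\<And>t x \<eta>. t \<in> {0..T} \<Longrightarrow> \<eta> \<in> param_cube \<Longrightarrow> norm (V (t, x, \<eta>)) \<le> C * (1 + norm x)"
    and M: "\<And>w q. set w \<subseteq> Basis \<Longrightarrow> length w \<le> k \<Longrightarrow> q \<in> txe_domain T (cball 0 (G0 T C \<kappa>)) \<Longrightarrow>
       norm (iter_partial (txe_domain T UNIV) w V q) \<le> M"
begin

abbreviation S :: "('n, 'm) txe set" where "S \<equiv> txe_domain T UNIV"
abbreviation \<Omega>G :: "('n, 'm) txe set" where "\<Omega>G \<equiv> txe_domain T (cball 0 (G0 T C \<kappa>))"
abbreviation \<Omega> :: "('n, 'm) txe set" where "\<Omega> \<equiv> txe_domain T (cball 0 \<kappa>)"

lemma domain_iff: "(t, x, \<eta>) \<in> txe_domain T A \<longleftrightarrow> 0 \<le> t \<and> t \<le> T \<and> x \<in> A \<and> \<eta> \<in> param_cube"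
  by (auto simp: txe_domain_def)

lemma \<Omega>G_sub: "\<Omega>G \<subseteq> S" by (auto simp: txe_domain_def)

lemma V_bound: "q \<in> \<Omega>G \<Longrightarrow> norm (V q) \<le> M" using M[of "[]" q] by simp

definition d :: nat where "d = DIM(('n, 'm) txe)"

lemma V_lipschitz: "q \<in> \<Omega>G \<Longrightarrow> q' \<in> \<Omega>G \<Longrightarrow> norm (V q' - V q) \<le> M * d * norm (q' - q)"
  unfolding d_def
  by (rule Ck_on_lipschitz[OF Ck box_like_txe_domain k convex_txe_domain[OF convex_cball] \<Omega>G_sub M])

text \<open>Gronwall bounds \<open>1 + norm y\<close>; the radius \<open>G0\<close> arises from it
  by \<open>exp (C * T) - 1 \<le> C * T * exp (C * T)\<close>.\<close>

lemma G0_ge: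
  assumes "1 + norm y \<le> (1 + \<kappa>) * exp (C * T)"
  shows "y \<in> cball 0 (G0 T C \<kappa>)"
proof -
  have "1 + - (C * T) \<le> exp (- (C * T))" by (rule exp_ge_add_one_self)
  then have "(1 - C * T) * exp (C * T) \<le> exp (- (C * T)) * exp (C * T)" by (intro mult_right_mono) auto
  then have "exp (C * T) - 1 \<le> C * T * exp (C * T)" by (simp add: exp_add[symmetric] algebra_simps)
  then have "norm y \<le> (\<kappa> + C * T) * exp (C * T)" using assms by (simp add: algebra_simps)
  then show ?thesis by (simp add: G0_def)
qed

lemma M0: "M \<ge> 0"
proof -
  have "(0, 0, 0) \<in> \<Omega>G" using T G0_ge[of 0] \<kappa> C by (auto simp: domain_iff param_cube_def mem_box_cart G0_def)
  from V_bound[OF this] show ?thesis by (rule order_trans[OF norm_ge_zero])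
qed

lemma V_cont: "continuous_on S V"
  using Ck unfolding Ck_on_def by (metis empty_subsetI iter_partial.simps(1) le0 list.set(1) list.size(3))

text \<open>Here the Lipschitz constant may depend on the field and on the radius, because it is
  used only for existence and uniqueness of characteristics.\<close>

lemma field_facts:
  assumes "\<eta> \<in> param_cube"
  shows "continuous_on ({0..T} \<times> UNIV) (\<lambda>(s, y). V (s, y, \<eta>))"
    and "\<And>R. \<exists>\<Lambda>. \<forall>s\<in>{0..T}. \<forall>y\<in>cball 0 R. \<forall>z\<in>cball 0 R. norm (V (s, y, \<eta>) - V (s, z, \<eta>)) \<le> \<Lambda> * norm (y - z)"
proof -
  have "continuous_on ({0..T} \<times> UNIV) (V \<circ> (\<lambda>(s, y). (s, y, \<eta>)))"
    by (rule continuous_on_compose)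
       (use assms in \<open>auto simp: case_prod_beta domain_iff intro!: continuous_intros continuous_on_subset[OF V_cont]\<close>)
  then show "continuous_on ({0..T} \<times> UNIV) (\<lambda>(s, y). V (s, y, \<eta>))" by (simp add: o_def case_prod_beta)
  fix R
  let ?\<Omega> = "txe_domain T (cball 0 R) :: ('n, 'm) txe set"
  have sub: "?\<Omega> \<subseteq> S" by (auto simp: txe_domain_def)
  have M': "norm (iter_partial S w V q) \<le> Ck_norm k S ?\<Omega> V"
    if "set w \<subseteq> Basis" "length w \<le> k" "q \<in> ?\<Omega>" for w q
    by (rule Ck_norm_bound[OF Ck compact_txe_domain[OF compact_cball] sub that])
  have "norm (V (s, y, \<eta>) - V (s, z, \<eta>)) \<le> (Ck_norm k S ?\<Omega> V * d) * norm (y - z)"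
    if "s \<in> {0..T}" "y \<in> cball 0 R" "z \<in> cball 0 R" for s y z
    using Ck_on_lipschitz[OF Ck box_like_txe_domain k convex_txe_domain[OF convex_cball] sub M', of "(s, z, \<eta>)" "(s, y, \<eta>)"]
      that assms by (simp add: domain_iff d_def norm_prod_def)
  then show "\<exists>\<Lambda>. \<forall>s\<in>{0..T}. \<forall>y\<in>cball 0 R. \<forall>z\<in>cball 0 R. norm (V (s, y, \<eta>) - V (s, z, \<eta>)) \<le> \<Lambda> * norm (y - z)"
    by blast
qed

text \<open>Uniqueness evaluates the definite description in \<open>char_flow\<close>, and linear
  growth keeps the curve in the region where \<open>M\<close> is a bound.\<close>

lemma characteristic:
  assumes p: "(t, x, \<eta>) \<in> \<Omega>"
  shows "\<exists>\<gamma>. \<gamma> t = x \<and> \<gamma> 0 = char_flow T V 0 t x \<eta> \<and>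
    (\<forall>s\<in>{0..T}. (\<gamma> has_vector_derivative V (s, \<gamma> s, \<eta>)) (at s within {0..T})) \<and>
    (\<forall>s\<in>{0..T}. (s, \<gamma> s, \<eta>) \<in> \<Omega>G)"
proof -
  have t: "t \<in> {0..T}" and \<eta>: "\<eta> \<in> param_cube" and x: "norm x \<le> \<kappa>" using p by (auto simp: domain_iff)
  have gr: "norm (V (s, y, \<eta>)) \<le> C * (1 + norm y)" if "s \<in> {0..T}" for s y
    by (rule growth[OF that \<eta>])
  note ode = linear_growth_ode[where F = "\<lambda>s y. V (s, y, \<eta>)", OF field_facts(1)[OF \<eta>] t field_facts(2)[OF \<eta>] gr less_imp_le[OF C]]
  from ode(1) obtain \<gamma> where \<gamma>: "\<gamma> t = x" "\<And>s. s\<in>{0..T} \<Longrightarrow> (\<gamma> has_vector_derivative V (s, \<gamma> s, \<eta>)) (at s within {0..T})" by blast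
  have ch: "is_characteristic T V t x \<eta> \<gamma>" unfolding is_characteristic_def using \<gamma> by auto
  have "char_flow T V 0 t x \<eta> = \<gamma> 0" unfolding char_flow_def
  proof (rule the_equality)
    show "\<exists>\<gamma>'. is_characteristic T V t x \<eta> \<gamma>' \<and> \<gamma>' 0 = \<gamma> 0" using ch by blast
    fix y assume "\<exists>\<gamma>'. is_characteristic T V t x \<eta> \<gamma>' \<and> \<gamma>' 0 = y"
    then obtain \<gamma>' where "is_characteristic T V t x \<eta> \<gamma>'" "\<gamma>' 0 = y" by blast
    then show "y = \<gamma> 0" unfolding is_characteristic_def
      using ode(3)[of \<gamma>' x \<gamma> 0] \<gamma> T by auto
  qed
  moreover have "(s, \<gamma> s, \<eta>) \<in> \<Omega>G" if s: "s \<in> {0..T}" for s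
  proof -
    have "1 + norm (\<gamma> s) \<le> (1 + norm x) * exp (C * \<bar>s - t\<bar>)" by (rule ode(2)[OF _ \<gamma> s])
    also have "\<dots> \<le> (1 + \<kappa>) * exp (C * T)"
      using x s t C \<kappa> by (intro mult_mono) auto
    finally show ?thesis using G0_ge s \<eta> by (auto simp: domain_iff)
  qed
  ultimately show ?thesis using \<gamma> by (intro exI[of _ \<gamma>]) simp
qed

text \<open>The radius \<open>G0\<close> would bring \<open>C\<close> into the constants.
  Integrating the bound \<open>M\<close> on the field along the characteristic avoids it.\<close>

lemma flow_bound:
  assumes p: "(t, x, \<eta>) \<in> \<Omega>"
  shows "norm (char_flow T V 0 t x \<eta>) \<le> \<kappa> + T * M"
proof -
  from characteristic[OF p] obtain \<gamma> where \<gamma>: "\<gamma> t = x" "\<gamma> 0 = char_flow T V 0 t x \<eta>"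
    "\<And>s. s\<in>{0..T} \<Longrightarrow> (\<gamma> has_vector_derivative V (s, \<gamma> s, \<eta>)) (at s within {0..T})"
    "\<And>s. s\<in>{0..T} \<Longrightarrow> (s, \<gamma> s, \<eta>) \<in> \<Omega>G" by blast
  have t: "0 \<le> t" "t \<le> T" and x: "norm x \<le> \<kappa>" using p by (auto simp: domain_iff)
  have "norm (\<gamma> 0 - \<gamma> t) \<le> M * \<bar>0 - t\<bar>"
  proof (rule vector_derivative_bound)
    fix s assume "s \<in> closed_segment t 0"
    then have s: "s \<in> {0..T}" and sub: "closed_segment t 0 \<subseteq> {0..T}" using t by (auto simp: closed_segment_eq_real_ivl split: if_splits)
    show "(\<gamma> has_vector_derivative V (s, \<gamma> s, \<eta>)) (at s within closed_segment t 0)"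
      by (rule has_vector_derivative_within_subset[OF \<gamma>(3)[OF s] sub])
    show "norm (V (s, \<gamma> s, \<eta>)) \<le> M" by (rule V_bound[OF \<gamma>(4)[OF s]])
  qed
  moreover have "M * t \<le> M * T" using t M0 by (intro mult_left_mono) auto
  ultimately have "norm (\<gamma> 0 - x) \<le> T * M" using t \<gamma>(1) by (simp add: mult.commute)
  moreover have "norm (\<gamma> 0) \<le> norm (\<gamma> 0 - x) + norm x" using norm_triangle_ineq[of "\<gamma> 0 - x" x] by simp
  ultimately show ?thesis using x \<gamma>(2) by simp
qed

text \<open>Runs backwards from time \<open>t\<close> to 0 in \<open>N\<close> steps of length
  \<open>t / N\<close>. The number of steps is the same for all starting times, so the schemes of
  two points can be compared step by step.\<close>

fun euler :: "nat \<Rightarrow> ('n, 'm) txe \<Rightarrow> nat \<Rightarrow> real ^ 'n" where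
  "euler N (t, x, \<eta>) 0 = x"
| "euler N (t, x, \<eta>) (Suc i) = euler N (t, x, \<eta>) i -
    (t / N) *\<^sub>R V (t * (1 - i / N), euler N (t, x, \<eta>) i, \<eta>)"

lemma time_in: "0 \<le> t \<Longrightarrow> t \<le> T \<Longrightarrow> i \<le> N \<Longrightarrow> N \<ge> 1 \<Longrightarrow> 0 \<le> t * (1 - real i / real N) \<and> t * (1 - real i / real N) \<le> T"
proof
  assume *: "0 \<le> t" "t \<le> T" "i \<le> N" "N \<ge> 1"
  have "0 \<le> 1 - real i / real N" "1 - real i / real N \<le> 1" using * by auto
  then show "0 \<le> t * (1 - real i / real N)" "t * (1 - real i / real N) \<le> T"
    using * mult_mono[of t T "1 - real i / real N" 1] by auto
qed

text \<open>The discrete growth factor \<open>(1 + C * T / N) ^ i\<close> is below the continuous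
  one, so the Euler points remain in the same ball as the characteristics.\<close>

lemma euler_in:
  assumes p: "(t, x, \<eta>) \<in> \<Omega>" and N: "N \<ge> 1" and i: "i \<le> N"
  shows "(t * (1 - i / N), euler N (t, x, \<eta>) i, \<eta>) \<in> \<Omega>G"
proof -
  have t: "0 \<le> t" "t \<le> T" and \<eta>: "\<eta> \<in> param_cube" and x: "norm x \<le> \<kappa>" using p by (auto simp: domain_iff)
  have "1 + norm (euler N (t, x, \<eta>) i) \<le> ((1 + \<kappa>) + real i * 0) * exp (C * T / N * i)"
  proof (rule discrete_gronwall[where N = N and e = "\<lambda>i. 1 + norm (euler N (t, x, \<eta>) i)"])
    fix i assume "i < N"
    then have "norm (V (t * (1 - i / N), euler N (t, x, \<eta>) i, \<eta>)) \<le> C * (1 + norm (euler N (t, x, \<eta>) i))"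
      using time_in[OF t, of i N] N \<eta> by (intro growth) auto
    then have "(t / N) * norm (V (t * (1 - i / N), euler N (t, x, \<eta>) i, \<eta>)) \<le> (T / N) * (C * (1 + norm (euler N (t, x, \<eta>) i)))"
      using t T C by (intro mult_mono divide_right_mono) auto
    moreover have "norm (euler N (t, x, \<eta>) (Suc i)) \<le> norm (euler N (t, x, \<eta>) i) + (t / N) * norm (V (t * (1 - i / N), euler N (t, x, \<eta>) i, \<eta>))"
      using norm_triangle_ineq4[of "euler N (t, x, \<eta>) i" "(t / N) *\<^sub>R V (t * (1 - i / N), euler N (t, x, \<eta>) i, \<eta>)"] t by simp
    ultimately show "1 + norm (euler N (t, x, \<eta>) (Suc i)) \<le> (1 + C * T / N) * (1 + norm (euler N (t, x, \<eta>) i)) + 0"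
      by (simp add: algebra_simps)
  qed (use x C T \<kappa> i in auto)
  also have "\<dots> \<le> (1 + \<kappa>) * exp (C * T)"
  proof -
    have "C * T / N * i = (C * T) * (i / N)" by simp
    also have "\<dots> \<le> (C * T) * 1" using C T i N by (intro mult_left_mono) auto
    finally show ?thesis using \<kappa> by (intro mult_mono) auto
  qed
  finally show ?thesis using G0_ge time_in[OF t i N] \<eta> by (auto simp: domain_iff)
qed

lemma euler_bound:
  assumes p: "(t, x, \<eta>) \<in> \<Omega>" and N: "N \<ge> 1" and i: "i \<le> N"
  shows "norm (euler N (t, x, \<eta>) i) \<le> \<kappa> + T * M"
proof -
  have t: "0 \<le> t" "t \<le> T" and x: "norm x \<le> \<kappa>" using p by (auto simp: domain_iff)
  have "norm (euler N (t, x, \<eta>) i) \<le> (\<kappa> + i * (T / N * M)) * exp (0 * real i)"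
  proof (rule discrete_gronwall[where N = N])
    fix i assume "i < N"
    then have "norm (V (t * (1 - i / N), euler N (t, x, \<eta>) i, \<eta>)) \<le> M"
      using euler_in[OF p N, of i] by (intro V_bound) auto
    then have "(t / N) * norm (V (t * (1 - i / N), euler N (t, x, \<eta>) i, \<eta>)) \<le> (T / N) * M"
      using t T by (intro mult_mono divide_right_mono) auto
    moreover have "norm (euler N (t, x, \<eta>) (Suc i)) \<le> norm (euler N (t, x, \<eta>) i) + (t / N) * norm (V (t * (1 - i / N), euler N (t, x, \<eta>) i, \<eta>))"
      using norm_triangle_ineq4[of "euler N (t, x, \<eta>) i" "(t / N) *\<^sub>R V (t * (1 - i / N), euler N (t, x, \<eta>) i, \<eta>)"] t by simp
    ultimately show "norm (euler N (t, x, \<eta>) (Suc i)) \<le> (1 + 0) * norm (euler N (t, x, \<eta>) i) + T / N * M" by simp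
  qed (use x \<kappa> T M0 i in auto)
  also have "\<dots> = \<kappa> + (T * M) * (i / N)" by simp
  also have "\<dots> \<le> \<kappa> + (T * M) * 1" using T M0 i N by (intro add_left_mono mult_left_mono) auto
  finally show ?thesis by simp
qed

lemma characteristic_lipschitz:
  assumes \<gamma>: "\<And>s. s\<in>{0..T} \<Longrightarrow> (\<gamma> has_vector_derivative V (s, \<gamma> s, \<eta>)) (at s within {0..T})"
    "\<And>s. s\<in>{0..T} \<Longrightarrow> (s, \<gamma> s, \<eta>) \<in> \<Omega>G" and s: "s \<in> {0..T}" "s' \<in> {0..T}"
  shows "norm (\<gamma> s' - \<gamma> s) \<le> M * \<bar>s' - s\<bar>"
proof (rule vector_derivative_bound)
  fix u assume "u \<in> closed_segment s s'"
  then have u: "u \<in> {0..T}" and sub: "closed_segment s s' \<subseteq> {0..T}" using s by (auto simp: closed_segment_eq_real_ivl split: if_splits)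
  show "(\<gamma> has_vector_derivative V (u, \<gamma> u, \<eta>)) (at u within closed_segment s s')"
    by (rule has_vector_derivative_within_subset[OF \<gamma>(1)[OF u] sub])
  show "norm (V (u, \<gamma> u, \<eta>)) \<le> M" by (rule V_bound[OF \<gamma>(2)[OF u]])
qed

definition \<Lambda> :: real where "\<Lambda> = M * d"

lemma \<Lambda>0: "\<Lambda> \<ge> 0" using M0 by (simp add: \<Lambda>_def)

lemma norm_triple_le: "norm (a, b, c) \<le> norm a + norm b + norm c"
  using norm_Pair_le[of a "(b, c)"] norm_Pair_le[of b c] by linarith

text \<open>First order convergence suffices, since \<open>N\<close> is free; what matters is that
  the bound holds for all points of \<open>\<Omega>\<close> at once.\<close>

lemma euler_converges:
  assumes p: "(t, x, \<eta>) \<in> \<Omega>" and N: "N \<ge> 1"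
  shows "norm (euler N (t, x, \<eta>) N - char_flow T V 0 t x \<eta>) \<le> T * \<Lambda> * (1 + M) * T * exp (T * \<Lambda>) / N"
proof -
  from characteristic[OF p] obtain \<gamma> where \<gamma>: "\<gamma> t = x" "\<gamma> 0 = char_flow T V 0 t x \<eta>"
    "\<And>s. s\<in>{0..T} \<Longrightarrow> (\<gamma> has_vector_derivative V (s, \<gamma> s, \<eta>)) (at s within {0..T})"
    "\<And>s. s\<in>{0..T} \<Longrightarrow> (s, \<gamma> s, \<eta>) \<in> \<Omega>G" by blast
  have t: "0 \<le> t" "t \<le> T" using p by (auto simp: domain_iff)
  define s where "s i = t * (1 - real i / real N)" for i :: nat
  have s: "s i \<in> {0..T}" if "i \<le> N" for i using time_in[OF t that N] by (simp add: s_def)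
  have sstep: "s (Suc i) - s i = - (t / N)" for i
  proof -
    have "real (Suc i) / real N = real i / N + 1 / N" by (simp add: add_divide_distrib)
    then show ?thesis unfolding s_def by (simp add: algebra_simps)
  qed
  have tN: "t / N \<le> T / N" "0 \<le> t / N" using t by (auto simp: divide_right_mono)
  define z where "z i = euler N (t, x, \<eta>) i" for i
  have z_in: "(s i, z i, \<eta>) \<in> \<Omega>G" if "i \<le> N" for i using euler_in[OF p N that] by (simp add: s_def z_def)
  have "norm (z N - \<gamma> (s N)) \<le> (0 + real N * (T / N * (\<Lambda> * ((1 + M) * (T / N))))) * exp (T * \<Lambda> / N * real N)"
  proof (rule discrete_gronwall[where N = N and e = "\<lambda>i. norm (z i - \<gamma> (s i))"])
    fix i assume i: "i < N"
    then have si: "s i \<in> {0..T}" "s (Suc i) \<in> {0..T}" using s by auto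
    define Vi where "Vi = V (s i, \<gamma> (s i), \<eta>)"
    \<comment> \<open>The local error: after removal of the linear part, the curve has a derivative
      bounded by \<open>\<Lambda> * (1 + M)\<close> times the step length, because the field is
      Lipschitz and the curve moves with speed at most \<open>M\<close>.\<close>
    have "norm ((\<gamma> (s (Suc i)) - s (Suc i) *\<^sub>R Vi) - (\<gamma> (s i) - s i *\<^sub>R Vi)) \<le> (\<Lambda> * ((1 + M) * (T / N))) * \<bar>s (Suc i) - s i\<bar>"
    proof (rule vector_derivative_bound)
      fix u assume u: "u \<in> closed_segment (s i) (s (Suc i))"
      then have uT: "u \<in> {0..T}" and sub: "closed_segment (s i) (s (Suc i)) \<subseteq> {0..T}"
        using si by (auto simp: closed_segment_eq_real_ivl split: if_splits)
      show "((\<lambda>u. \<gamma> u - u *\<^sub>R Vi) has_vector_derivative (V (u, \<gamma> u, \<eta>) - Vi)) (at u within closed_segment (s i) (s (Suc i)))"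
        using has_vector_derivative_within_subset[OF \<gamma>(3)[OF uT] sub] by (auto intro!: derivative_eq_intros)
      have us: "\<bar>u - s i\<bar> \<le> T / N" using u sstep[of i] tN by (auto simp: closed_segment_eq_real_ivl split: if_splits)
      have "norm (V (u, \<gamma> u, \<eta>) - Vi) \<le> \<Lambda> * norm ((u, \<gamma> u, \<eta>) - (s i, \<gamma> (s i), \<eta>))"
        unfolding Vi_def \<Lambda>_def by (rule V_lipschitz[OF \<gamma>(4)[OF si(1)] \<gamma>(4)[OF uT]])
      also have "norm ((u, \<gamma> u, \<eta>) - (s i, \<gamma> (s i), \<eta>)) \<le> \<bar>u - s i\<bar> + norm (\<gamma> u - \<gamma> (s i))"
        using norm_triple_le[of "u - s i" "\<gamma> u - \<gamma> (s i)" "\<eta> - \<eta>"] by simp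
      also have "\<dots> \<le> (1 + M) * \<bar>u - s i\<bar>"
        using characteristic_lipschitz[OF \<gamma>(3,4) si(1) uT] by (simp add: algebra_simps)
      also have "\<dots> \<le> (1 + M) * (T / N)" using us M0 by (intro mult_left_mono) auto
      finally show "norm (V (u, \<gamma> u, \<eta>) - Vi) \<le> \<Lambda> * ((1 + M) * (T / N))"
        using \<Lambda>0 by (simp add: mult_left_mono)
    qed
    also have "(\<Lambda> * ((1 + M) * (T / N))) * \<bar>s (Suc i) - s i\<bar> \<le> (\<Lambda> * ((1 + M) * (T / N))) * (T / N)"
      using sstep[of i] tN \<Lambda>0 M0 T by (intro mult_left_mono) auto
    also have "(\<gamma> (s (Suc i)) - s (Suc i) *\<^sub>R Vi) - (\<gamma> (s i) - s i *\<^sub>R Vi) = \<gamma> (s (Suc i)) - \<gamma> (s i) - (s (Suc i) - s i) *\<^sub>R Vi"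
      by (simp add: algebra_simps)
    finally have loc: "norm (\<gamma> (s (Suc i)) - \<gamma> (s i) + (t / N) *\<^sub>R Vi) \<le> T / N * (\<Lambda> * ((1 + M) * (T / N)))"
      unfolding sstep by (simp add: mult.commute)
    have "norm (V (s i, z i, \<eta>) - Vi) \<le> \<Lambda> * norm ((s i, z i, \<eta>) - (s i, \<gamma> (s i), \<eta>))"
      unfolding Vi_def \<Lambda>_def using i by (intro V_lipschitz \<gamma>(4) si z_in) auto
    then have "norm (V (s i, z i, \<eta>) - Vi) \<le> \<Lambda> * norm (z i - \<gamma> (s i))" by (simp add: norm_Pair)
    then have "(t / N) * norm (V (s i, z i, \<eta>) - Vi) \<le> (T / N) * (\<Lambda> * norm (z i - \<gamma> (s i)))"
      using tN T by (intro mult_mono) auto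
    then have st: "norm ((t / N) *\<^sub>R (V (s i, z i, \<eta>) - Vi)) \<le> (T / N) * (\<Lambda> * norm (z i - \<gamma> (s i)))"
      using t by simp
    have "z (Suc i) - \<gamma> (s (Suc i)) = (z i - \<gamma> (s i)) - (t / N) *\<^sub>R (V (s i, z i, \<eta>) - Vi)
        - (\<gamma> (s (Suc i)) - \<gamma> (s i) + (t / N) *\<^sub>R Vi)"
      by (simp add: z_def s_def algebra_simps)
    then have "norm (z (Suc i) - \<gamma> (s (Suc i))) \<le> norm (z i - \<gamma> (s i)) + (T / N) * (\<Lambda> * norm (z i - \<gamma> (s i))) + T / N * (\<Lambda> * ((1 + M) * (T / N)))"
      using st loc by (smt (verit) norm_triangle_ineq4)
    then show "norm (z (Suc i) - \<gamma> (s (Suc i))) \<le> (1 + T * \<Lambda> / N) * norm (z i - \<gamma> (s i)) + T / N * (\<Lambda> * ((1 + M) * (T / N)))"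
      by (simp add: algebra_simps)
  qed (use T \<Lambda>0 M0 \<gamma>(1) in \<open>auto simp: z_def s_def\<close>)
  moreover have "s N = 0" using N by (simp add: s_def)
  ultimately show ?thesis using N \<gamma>(2) by (simp add: z_def algebra_simps)
qed

definition eul_pt :: "nat \<Rightarrow> ('n, 'm) txe \<Rightarrow> nat \<Rightarrow> ('n, 'm) txe" where
  "eul_pt N p i = (fst p * (1 - i / N), euler N p i, snd (snd p))"

lemma eul_pt_in: "p \<in> \<Omega> \<Longrightarrow> N \<ge> 1 \<Longrightarrow> i \<le> N \<Longrightarrow> eul_pt N p i \<in> \<Omega>G"
  using euler_in[of "fst p" "fst (snd p)" "snd (snd p)" N i] by (simp add: eul_pt_def)

lemma euler_Suc: "euler N p (Suc i) = euler N p i - (fst p / N) *\<^sub>R V (eul_pt N p i)"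
  by (cases p) (auto simp: eul_pt_def)

lemma euler_0: "euler N p 0 = fst (snd p)" by (cases p) auto

text \<open>The three summands account for the difference of the starting positions, of the step
  lengths (where the field has norm at most \<open>M\<close>), and of the time and parameter
  arguments; the exponential is the Gronwall factor.\<close>

definition stability_const :: real where "stability_const = (1 + M + 2 * T * \<Lambda>) * exp (T * \<Lambda>)"

lemma stability_const_nonneg: "stability_const \<ge> 0" using M0 T \<Lambda>0 by (simp add: stability_const_def)

lemma norm_components:
  fixes v :: "('n, 'm) txe"
  shows "\<bar>fst v\<bar> \<le> norm v" "norm (fst (snd v)) \<le> norm v" "norm (snd (snd v)) \<le> norm v"
  using norm_fst_le[of "fst v" "snd v"] norm_snd_le[of "snd v" "fst v"] norm_fst_le[of "fst (snd v)" "snd (snd v)"]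
    norm_snd_le[of "snd (snd v)" "fst (snd v)"] by auto

lemma fst_bounds: "p \<in> \<Omega> \<Longrightarrow> 0 \<le> fst p" "p \<in> \<Omega> \<Longrightarrow> fst p \<le> T"
  by (auto simp: txe_domain_def)

lemma eul_pt_diff:
  assumes N: "N \<ge> 1" "i \<le> N"
  shows "norm (eul_pt N p i - eul_pt N p0 i) \<le> 2 * norm (p - p0) + norm (euler N p i - euler N p0 i)"
proof -
  have "\<bar>fst (p - p0) * (1 - i / N)\<bar> \<le> \<bar>fst (p - p0)\<bar> * 1"
    unfolding abs_mult using N by (intro mult_left_mono) (auto simp: abs_le_iff field_simps)
  then have "\<bar>fst p * (1 - i / N) - fst p0 * (1 - i / N)\<bar> \<le> norm (p - p0)"
    using norm_components(1)[of "p - p0"] by (simp add: left_diff_distrib)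
  moreover have "norm (snd (snd p) - snd (snd p0)) \<le> norm (p - p0)"
    using norm_components(3)[of "p - p0"] by simp
  ultimately show ?thesis
    using norm_triple_le[of "fst p * (1 - i / N) - fst p0 * (1 - i / N)" "euler N p i - euler N p0 i" "snd (snd p) - snd (snd p0)"]
    by (simp add: eul_pt_def)
qed

text \<open>A Lipschitz bound independent of \<open>N\<close> and \<open>i\<close>: it keeps the
  Euler points of \<open>p\<close> near those of \<open>p0\<close>, where the Taylor polynomials are
  taken.\<close>

lemma euler_stable:
  assumes p: "p \<in> \<Omega>" "p0 \<in> \<Omega>" and N: "N \<ge> 1" and i: "i \<le> N"
  shows "norm (euler N p i - euler N p0 i) \<le> stability_const * norm (p - p0)"
proof -
  define r where "r = norm (p - p0)"
  have r0: "r \<ge> 0" by (simp add: r_def)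
  have "norm (euler N p i - euler N p0 i) \<le> (r + i * ((M + 2 * T * \<Lambda>) * r / N)) * exp (T * \<Lambda> / N * i)"
  proof (rule discrete_gronwall[where N = N])
    fix i assume i: "i < N"
    define q where "q = eul_pt N p i"
    define q0 where "q0 = eul_pt N p0 i"
    have q: "q \<in> \<Omega>G" "q0 \<in> \<Omega>G" using i unfolding q_def q0_def by (auto intro!: eul_pt_in p N)
    have eq: "euler N p (Suc i) - euler N p0 (Suc i) = (euler N p i - euler N p0 i)
       - ((fst p - fst p0) / N) *\<^sub>R V q - (fst p0 / N) *\<^sub>R (V q - V q0)"
      by (simp add: euler_Suc q_def q0_def algebra_simps diff_divide_distrib)
    have "norm (((fst p - fst p0) / N) *\<^sub>R V q) \<le> r / N * M"
      unfolding norm_scaleR using V_bound[OF q(1)] norm_components(1)[of "p - p0"] r0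
      by (intro mult_mono) (auto simp: r_def abs_divide divide_right_mono)
    moreover have "norm ((fst p0 / N) *\<^sub>R (V q - V q0)) \<le> T / N * (\<Lambda> * (2 * r + norm (euler N p i - euler N p0 i)))"
    proof -
      have "norm (V q - V q0) \<le> \<Lambda> * norm (q - q0)" unfolding \<Lambda>_def by (rule V_lipschitz[OF q(2,1)])
      also have "\<dots> \<le> \<Lambda> * (2 * r + norm (euler N p i - euler N p0 i))"
        unfolding q_def q0_def r_def using eul_pt_diff[OF N, of i p p0] i \<Lambda>0 by (intro mult_left_mono) auto
      finally show ?thesis unfolding norm_scaleR
        using fst_bounds[OF p(2)] T by (intro mult_mono) (auto simp: divide_right_mono)
    qed
    ultimately have "norm (euler N p (Suc i) - euler N p0 (Suc i)) \<le> norm (euler N p i - euler N p0 i)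
       + r / N * M + T / N * (\<Lambda> * (2 * r + norm (euler N p i - euler N p0 i)))"
      unfolding eq by (smt (verit) norm_triangle_ineq4)
    then show "norm (euler N p (Suc i) - euler N p0 (Suc i)) \<le> (1 + T * \<Lambda> / N) * norm (euler N p i - euler N p0 i) + (M + 2 * T * \<Lambda>) * r / N"
      by (simp add: algebra_simps add_divide_distrib)
  next
    show "norm (euler N p 0 - euler N p0 0) \<le> r"
      unfolding euler_0 r_def using norm_components(2)[of "p - p0"] by simp
  qed (use T \<Lambda>0 M0 r0 i in auto)
  also have "\<dots> \<le> (r + (M + 2 * T * \<Lambda>) * r) * exp (T * \<Lambda>)"
  proof (rule mult_mono)
    have iN: "i / N \<le> 1" using i N by simp
    have c: "0 \<le> (M + 2 * T * \<Lambda>) * r" using M0 T \<Lambda>0 r0 by simp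
    show "r + i * ((M + 2 * T * \<Lambda>) * r / N) \<le> r + (M + 2 * T * \<Lambda>) * r"
      using mult_left_mono[OF iN c] by (simp add: mult.commute)
    have "0 \<le> T * \<Lambda>" using T \<Lambda>0 by simp
    from mult_left_mono[OF iN this] show "exp (T * \<Lambda> / N * i) \<le> exp (T * \<Lambda>)" by simp
  qed (use M0 T \<Lambda>0 r0 in auto)
  also have "\<dots> = stability_const * norm (p - p0)" by (simp add: stability_const_def r_def algebra_simps)
  finally show ?thesis .
qed

end

section \<open>Local polynomials for the flow\<close>

lemma Basis_txe:
  "b \<in> (Basis :: ('n::finite, 'm::finite) txe set) \<longleftrightarrow>
     b = (1, 0, 0) \<or> (\<exists>j\<in>Basis. b = (0, j, 0)) \<or> (\<exists>l\<in>Basis. b = (0, 0, l))"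
  by (auto simp: Basis_prod_def zero_prod_def)

lemma power_length_le:
  "0 \<le> s \<Longrightarrow> s \<le> (1::real) \<Longrightarrow> w \<noteq> [] \<Longrightarrow> s ^ length w \<le> s"
  using power_decreasing[of 1 "length w" s] by (cases w) auto

context transport_field
begin

abbreviation taylor :: "('n, 'm) txe \<Rightarrow> ('n, 'm) txe \<Rightarrow> real ^ 'n" where
  "taylor q \<xi> \<equiv> taylor_poly S k V q [] \<xi>"

text \<open>The coefficient norm with weight 1 of a Taylor polynomial of the field is at most
  \<open>M\<close> per word.\<close>

definition taylor_const :: real where "taylor_const = M * card (words k :: ('n, 'm) txe list set)"

lemma taylor_const_nonneg: "taylor_const \<ge> 0" using M0 by (simp add: taylor_const_def)

lemma taylor_inner:
  "taylor q \<xi> \<bullet> j = (\<Sum>u\<in>words k. ((iter_partial S u V q \<bullet> j) / fact (length u)) * word_monomial u \<xi>)"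
  by (simp add: taylor_poly_def inner_sum_left mult.commute)

lemma taylor_coeff_bound:
  assumes "q \<in> \<Omega>G" "j \<in> Basis" "u \<in> words k"
  shows "\<bar>(iter_partial S u V q \<bullet> j) / fact (length u)\<bar> \<le> M"
proof -
  have u: "set u \<subseteq> Basis" "length u \<le> k" using assms(3) by (auto simp: words_def)
  have "\<bar>iter_partial S u V q \<bullet> j\<bar> \<le> M"
    using Basis_le_norm[OF assms(2), of "iter_partial S u V q"] M[OF u assms(1)] by linarith
  moreover have "(1::real) \<le> fact (length u)" by (rule fact_ge_1)
  then have "\<bar>iter_partial S u V q \<bullet> j\<bar> / fact (length u) \<le> \<bar>iter_partial S u V q \<bullet> j\<bar> / 1"
    by (intro divide_left_mono) auto
  ultimately show ?thesis by simp
qed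

text \<open>For arguments of norm at most 1 each word contributes at most \<open>M\<close>. Without
  the constant term \<open>V q\<close> only nonempty words remain, and each supplies a factor
  \<open>s\<close>. This gain limits the growth in one Euler step to a factor
  \<open>1 + O(1 / N)\<close>.\<close>

lemma taylor_majorized:
  assumes \<xi>: "\<And>b. b \<in> Basis \<Longrightarrow> majorized \<rho> s (\<lambda>v. \<xi> v \<bullet> b)" and \<rho>: "0 \<le> \<rho>" and s: "s \<le> 1"
    and q: "q \<in> \<Omega>G" and j: "j \<in> Basis"
  shows "majorized \<rho> taylor_const (\<lambda>v. taylor q (\<xi> v) \<bullet> j)"
    and "majorized \<rho> (taylor_const * s) (\<lambda>v. taylor q (\<xi> v) \<bullet> j - V q \<bullet> j)"
proof -
  have s0: "0 \<le> s" using majorized_nonneg[OF \<xi>[of "(1, 0, 0)"] \<rho>] by (simp add: Basis_txe)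
  define c where "c u = (iter_partial S u V q \<bullet> j) / fact (length u)" for u
  have c: "\<bar>c u\<bar> \<le> M" if "u \<in> words k" for u unfolding c_def by (rule taylor_coeff_bound[OF q j that])
  have term_maj: "majorized \<rho> (M * s ^ length u) (\<lambda>v. c u * word_monomial u (\<xi> v))" if u: "u \<in> words k" for u
  proof (rule majorized_mono)
    show "majorized \<rho> (\<bar>c u\<bar> * s ^ length u) (\<lambda>v. c u * word_monomial u (\<xi> v))"
      by (intro majorized_scale majorized_word_monomial \<xi> \<rho>) (use u in \<open>auto simp: words_def\<close>)
    show "\<bar>c u\<bar> * s ^ length u \<le> M * s ^ length u" using c[OF u] s0 by (intro mult_right_mono) auto
  qed
  have eq: "taylor q \<zeta> \<bullet> j = (\<Sum>u\<in>words k. c u * word_monomial u \<zeta>)" for \<zeta>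
    unfolding taylor_inner c_def ..
  have "majorized \<rho> (\<Sum>u\<in>(words k :: ('n, 'm) txe list set). M) (\<lambda>v. \<Sum>u\<in>words k. c u * word_monomial u (\<xi> v))"
  proof (rule majorized_sum)
    fix u :: "('n, 'm) txe list" assume u: "u \<in> words k"
    have "M * s ^ length u \<le> M * 1" using s s0 M0 by (intro mult_left_mono power_le_one) auto
    then show "majorized \<rho> M (\<lambda>v. c u * word_monomial u (\<xi> v))"
      using majorized_mono[OF term_maj[OF u]] by simp
  qed simp
  then show "majorized \<rho> taylor_const (\<lambda>v. taylor q (\<xi> v) \<bullet> j)" unfolding eq taylor_const_def by (simp add: mult.commute)
  let ?W = "(words k :: ('n, 'm) txe list set) - {[]}"
  have nil: "[] \<in> (words k :: ('n, 'm) txe list set)" using k by (simp add: words_def)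
  have eq2: "taylor q \<zeta> \<bullet> j - V q \<bullet> j = (\<Sum>u\<in>?W. c u * word_monomial u \<zeta>)" for \<zeta>
    unfolding eq by (subst sum.remove[OF finite_words nil]) (simp add: c_def)
  have "majorized \<rho> (\<Sum>u\<in>?W. M * s) (\<lambda>v. \<Sum>u\<in>?W. c u * word_monomial u (\<xi> v))"
  proof (rule majorized_sum)
    fix u assume u: "u \<in> ?W"
    have "M * s ^ length u \<le> M * s" using u s s0 M0 by (intro mult_left_mono power_length_le) auto
    then show "majorized \<rho> (M * s) (\<lambda>v. c u * word_monomial u (\<xi> v))"
      using majorized_mono[OF term_maj] u by blast
  qed simp
  moreover have "(\<Sum>u\<in>?W. M * s) \<le> taylor_const * s"
  proof -
    have "real (card ?W) \<le> card (words k :: ('n, 'm) txe list set)"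
      using card_mono[of "words k" ?W] by simp
    then have "real (card ?W) * (M * s) \<le> card (words k :: ('n, 'm) txe list set) * (M * s)"
      using M0 s0 by (intro mult_right_mono) auto
    then show ?thesis by (simp add: taylor_const_def algebra_simps)
  qed
  ultimately show "majorized \<rho> (taylor_const * s) (\<lambda>v. taylor q (\<xi> v) \<bullet> j - V q \<bullet> j)"
    unfolding eq2 by (rule majorized_mono)
qed

lemma taylor_lipschitz:
  assumes q: "q \<in> \<Omega>G" and a: "\<And>b. b \<in> Basis \<Longrightarrow> \<bar>a \<bullet> b\<bar> \<le> 1" and a': "\<And>b. b \<in> Basis \<Longrightarrow> \<bar>a' \<bullet> b\<bar> \<le> 1"
  shows "norm (taylor q a - taylor q a') \<le> taylor_const * k * norm (a - a')"
proof -
  have "taylor q a - taylor q a' = (\<Sum>u\<in>words k. ((word_monomial u a - word_monomial u a') / fact (length u)) *\<^sub>R iter_partial S u V q)"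
    by (simp add: taylor_poly_def sum_subtractf[symmetric] scaleR_diff_left[symmetric] diff_divide_distrib)
  also have "norm \<dots> \<le> (\<Sum>u\<in>(words k :: ('n, 'm) txe list set). k * norm (a - a') * M)"
  proof (rule sum_norm_le)
    fix u :: "('n, 'm) txe list" assume u: "u \<in> words k"
    then have u': "set u \<subseteq> Basis" "length u \<le> k" by (auto simp: words_def)
    have "\<bar>word_monomial u a - word_monomial u a'\<bar> / fact (length u) \<le> \<bar>word_monomial u a - word_monomial u a'\<bar> / 1"
      by (intro divide_left_mono) (auto simp: fact_ge_1)
    also have "\<dots> \<le> length u * norm (a - a')" using word_monomial_diff_bound[OF a a' u'(1)] by simp
    also have "\<dots> \<le> k * norm (a - a')" using u' by (intro mult_right_mono) auto
    finally show "norm (((word_monomial u a - word_monomial u a') / fact (length u)) *\<^sub>R iter_partial S u V q) \<le> k * norm (a - a') * M"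
      unfolding norm_scaleR using M[OF u' q] by (intro mult_mono) (auto simp: abs_divide)
  qed
  also have "\<dots> = taylor_const * k * norm (a - a')" by (simp add: taylor_const_def)
  finally show ?thesis .
qed

text \<open>\<open>jet N p i v\<close> is a polynomial in \<open>v\<close> approximating the displacement \<open>euler N (p + v) i - euler N p i\<close>: it
  obeys the same recursion, with the field replaced by its Taylor polynomial at the Euler point of \<open>p\<close>.
  Its degree grows with \<open>i\<close>, but its coefficients are summable with fixed geometric weights.\<close>

primrec jet :: "nat \<Rightarrow> ('n, 'm) txe \<Rightarrow> nat \<Rightarrow> ('n, 'm) txe \<Rightarrow> real ^ 'n" where
  "jet N p 0 v = fst (snd v)"
| "jet N p (Suc i) v = jet N p i v
     - ((fst p + fst v) / N) *\<^sub>R taylor (eul_pt N p i) (fst v * (1 - i / N), jet N p i v, snd (snd v))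
     + (fst p / N) *\<^sub>R V (eul_pt N p i)"

definition jet_pt :: "nat \<Rightarrow> ('n, 'm) txe \<Rightarrow> nat \<Rightarrow> ('n, 'm) txe \<Rightarrow> ('n, 'm) txe" where
  "jet_pt N p i v = (fst v * (1 - i / N), jet N p i v, snd (snd v))"

text \<open>The inverse of the total growth of the coefficient norm over all Euler steps. A
  coordinate has norm \<open>\<rho>\<close>, so the displacement starts at \<open>\<rho>\<close> and
  never exceeds 1.\<close>

definition \<rho> :: real where "\<rho> = exp (- ((T + 1) * taylor_const))"

lemma \<rho>: "0 < \<rho>" "\<rho> \<le> 1" using T taylor_const_nonneg by (auto simp: \<rho>_def)

lemma jet_pt_majorized:
  assumes N: "N \<ge> 1" "i \<le> N" and s: "\<rho> \<le> s" and j: "\<And>j. j \<in> Basis \<Longrightarrow> majorized \<rho> s (\<lambda>v. jet N p i v \<bullet> j)"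
    and b: "b \<in> Basis"
  shows "majorized \<rho> s (\<lambda>v. jet_pt N p i v \<bullet> b)"
  using b unfolding Basis_txe
proof (elim disjE bexE)
  assume b: "b = (1, 0, 0)"
  have "majorized \<rho> (\<bar>1 - i / N\<bar> * \<rho>) (\<lambda>v. (1 - i / N) * (v \<bullet> b))"
    using assms(5) \<rho> by (intro majorized_scale majorized_coord) auto
  moreover have "\<bar>1 - i / N\<bar> * \<rho> \<le> 1 * \<rho>" using N \<rho> by (intro mult_right_mono) (auto simp: abs_le_iff field_simps)
  ultimately show ?thesis using s unfolding b
    by (simp add: jet_pt_def inner_prod_def mult.commute) (erule majorized_mono, linarith)
next
  fix l assume l: "l \<in> Basis" "b = (0, l, 0)"
  then show ?thesis using j[OF l(1)] by (simp add: jet_pt_def inner_prod_def)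
next
  fix l :: "real ^ 'm" assume l: "l \<in> Basis" "b = (0, 0, l)"
  have "majorized \<rho> \<rho> (\<lambda>v. v \<bullet> b)" by (rule majorized_coord[OF assms(5)])
  then have "majorized \<rho> s (\<lambda>v. v \<bullet> b)" by (rule majorized_mono[OF _ s])
  then show ?thesis unfolding l(2) by (simp add: jet_pt_def inner_prod_def)
qed

lemma jet_growth:
  fixes i N :: nat
  assumes N: "i \<le> N" "N \<ge> 1"
  shows "\<rho> * (1 + (T + 1) * taylor_const / N) ^ i \<le> 1"
proof -
  have a: "0 \<le> (T + 1) * taylor_const / N" using T taylor_const_nonneg by simp
  have "(1 + (T + 1) * taylor_const / N) ^ i \<le> exp ((T + 1) * taylor_const / N) ^ i" using a by (intro power_mono) auto
  also have "\<dots> = exp ((T + 1) * taylor_const * (i / N))" by (simp add: exp_of_nat_mult[symmetric] mult.commute)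
  also have "\<dots> \<le> exp ((T + 1) * taylor_const * 1)" using T taylor_const_nonneg N by (subst exp_le_cancel_iff) (intro mult_left_mono, auto)
  finally have "\<rho> * (1 + (T + 1) * taylor_const / N) ^ i \<le> \<rho> * exp ((T + 1) * taylor_const)" using \<rho> by (intro mult_left_mono) auto
  also have "\<dots> = 1" by (simp add: \<rho>_def exp_minus)
  finally show ?thesis .
qed

text \<open>With \<open>s\<close> the norm after \<open>i\<close> steps, the Taylor polynomial
  without its constant term adds at most \<open>T / N * taylor_const * s\<close>. The shift of the
  starting time adds at most \<open>1 / N * \<rho> * taylor_const\<close>, which is at most
  \<open>1 / N * s * taylor_const\<close>. Both are proportional to \<open>s / N\<close>, so the
  norm stays bounded although the degree is not.\<close>

lemma jet_majorized:
  assumes p: "p \<in> \<Omega>" and N: "N \<ge> 1" and i: "i \<le> N" and j: "j \<in> Basis"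
  shows "majorized \<rho> (\<rho> * (1 + (T + 1) * taylor_const / N) ^ i) (\<lambda>v. jet N p i v \<bullet> j)"
  using i j
proof (induction i arbitrary: j)
  case 0
  have "(0, j, 0) \<in> (Basis :: ('n, 'm) txe set)" using 0 by (auto simp: Basis_txe)
  from majorized_coord[OF this, of \<rho>] show ?case by (simp add: inner_prod_def)
next
  case (Suc i j)
  define s where "s = \<rho> * (1 + (T + 1) * taylor_const / N) ^ i"
  have IH: "majorized \<rho> s (\<lambda>v. jet N p i v \<bullet> j)" if "j \<in> Basis" for j
    using Suc that unfolding s_def by simp
  have s: "\<rho> \<le> s" "s \<le> 1"
  proof -
    have "1 \<le> (1 + (T + 1) * taylor_const / N) ^ i" using T taylor_const_nonneg by (intro one_le_power) simp
    then show "\<rho> \<le> s" using \<rho> by (simp add: s_def)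
    show "s \<le> 1" unfolding s_def using Suc.prems N by (intro jet_growth) auto
  qed
  have q: "eul_pt N p i \<in> \<Omega>G" using Suc.prems by (intro eul_pt_in p N) auto
  have \<xi>': "majorized \<rho> s (\<lambda>v. jet_pt N p i v \<bullet> b)" if "b \<in> Basis" for b
    by (rule jet_pt_majorized[OF N _ s(1) IH that]) (use Suc.prems in auto)
  note tm = taylor_majorized[OF \<xi>' less_imp_le[OF \<rho>(1)] s(2) q Suc.prems(2)]
  define Q where "Q v = taylor (eul_pt N p i) (jet_pt N p i v) \<bullet> j" for v
  \<comment> \<open>Regrouped so that the factor \<open>fst p\<close> meets only the part without
    constant term, while the full Taylor polynomial is multiplied by the time component of
    \<open>v\<close>.\<close>
  have eq: "jet N p (Suc i) v \<bullet> j = (jet N p i v \<bullet> j - (fst p / N) * (Q v - V (eul_pt N p i) \<bullet> j)) - (1 / N) * ((v \<bullet> (1, 0, 0)) * Q v)" for v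
    by (simp add: Q_def jet_pt_def inner_diff_left inner_add_left algebra_simps add_divide_distrib inner_prod_def)
  have "majorized \<rho> ((s + \<bar>fst p / N\<bar> * (taylor_const * s)) + \<bar>1 / N\<bar> * (\<rho> * taylor_const)) (\<lambda>v. jet N p (Suc i) v \<bullet> j)"
    unfolding eq Q_def using Suc.prems(2) \<rho>(1)
    by (intro majorized_diff majorized_scale majorized_mult IH tm majorized_coord) (auto simp: Basis_txe)
  moreover have "(s + \<bar>fst p / N\<bar> * (taylor_const * s)) + \<bar>1 / N\<bar> * (\<rho> * taylor_const) \<le> (s + T / N * (taylor_const * s)) + 1 / N * (s * taylor_const)"
  proof (intro add_mono order_refl mult_mono)
    show "\<bar>fst p / N\<bar> \<le> T / N" using fst_bounds[OF p] by (simp add: abs_divide divide_right_mono)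
  qed (use s \<rho> taylor_const_nonneg T in auto)
  moreover have "(s + T / N * (taylor_const * s)) + 1 / N * (s * taylor_const) = \<rho> * (1 + (T + 1) * taylor_const / N) ^ Suc i"
    by (simp add: s_def algebra_simps add_divide_distrib)
  ultimately show ?case by (auto elim: majorized_mono)
qed

text \<open>Evaluates the majorant inside the cube of radius \<open>\<rho>\<close>; the bound 1 is
  the range in which \<open>taylor_lipschitz\<close> applies.\<close>

lemma jet_bound:
  assumes p: "p \<in> \<Omega>" and N: "N \<ge> 1" and i: "i \<le> N" and v: "\<And>b. b \<in> Basis \<Longrightarrow> \<bar>v \<bullet> b\<bar> \<le> \<rho>" and b: "b \<in> Basis"
  shows "\<bar>jet_pt N p i v \<bullet> b\<bar> \<le> 1"
proof -
  define s where "s = \<rho> * (1 + (T + 1) * taylor_const / N) ^ i"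
  have "1 \<le> (1 + (T + 1) * taylor_const / N) ^ i" using T taylor_const_nonneg by (intro one_le_power) simp
  then have "\<rho> \<le> s" using \<rho> by (simp add: s_def)
  from majorized_bound[OF jet_pt_majorized[OF N i this jet_majorized[OF p N i, folded s_def] b] v]
  show ?thesis using jet_growth[OF i N] by (simp add: s_def)
qed

text \<open>Below \<open>\<rho>\<close> the jets have components at most 1; the second bound makes
  corresponding Euler points at most 1 apart. Both arguments of the Taylor polynomial are then in
  the unit cube.\<close>

definition jet_radius :: real where "jet_radius = min \<rho> (1 / ((2 + stability_const) * d))"

lemma d_pos: "d > 0" by (simp add: d_def)

lemma jet_radius: "0 < jet_radius" "jet_radius \<le> \<rho>" "(2 + stability_const) * (d * jet_radius) \<le> 1"
proof -
  have pos: "0 < (2 + stability_const) * d" using stability_const_nonneg d_pos by simp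
  then show "0 < jet_radius" "jet_radius \<le> \<rho>" using \<rho> by (auto simp: jet_radius_def)
  have "((2 + stability_const) * d) * jet_radius \<le> ((2 + stability_const) * d) * (1 / ((2 + stability_const) * d))"
    using pos by (intro mult_left_mono) (auto simp: jet_radius_def)
  also have "\<dots> = 1"
    unfolding times_divide_eq_right mult_1_right by (rule divide_self) (use pos in linarith)
  finally show "(2 + stability_const) * (d * jet_radius) \<le> 1" by (simp add: mult.assoc)
qed

lemma norm_le_d:
  fixes v :: "('n, 'm) txe" and h :: real
  assumes "\<And>b. b \<in> Basis \<Longrightarrow> \<bar>v \<bullet> b\<bar> \<le> h"
  shows "norm v \<le> d * h"
proof -
  have "norm v \<le> (\<Sum>b\<in>Basis. \<bar>v \<bullet> b\<bar>)" by (rule norm_le_l1)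
  also have "\<dots> \<le> (\<Sum>b\<in>(Basis :: ('n, 'm) txe set). h)" by (rule sum_mono) (rule assms)
  finally show ?thesis by (simp add: d_def)
qed

definition jet_const :: real where "jet_const = T * M * (d * ((2 + stability_const) * d)) ^ k * exp (T * taylor_const * k)"

text \<open>The error of a step has two sources: the Taylor remainder \<open>H\<close>, of order
  \<open>h ^ k\<close>, and the earlier error passed through the Lipschitz Taylor polynomial. Both
  carry the factor \<open>T / N\<close>, so discrete Gronwall yields a bound free of
  \<open>N\<close>.\<close>

lemma jet_error:
  assumes p: "p \<in> \<Omega>" "p0 \<in> \<Omega>" and N: "N \<ge> 1" and h: "0 < h" "h \<le> jet_radius"
    and v: "\<And>b. b \<in> Basis \<Longrightarrow> \<bar>(p - p0) \<bullet> b\<bar> \<le> h"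
  shows "norm (euler N p N - euler N p0 N - jet N p0 N (p - p0)) \<le> jet_const * h ^ k"
proof -
  define v where "v = p - p0"
  define e where "e i = norm (euler N p i - euler N p0 i - jet N p0 i v)" for i
  define H where "H = M * (d * ((2 + stability_const) * d * h)) ^ k"
  have H0: "H \<ge> 0" using M0 stability_const_nonneg h by (simp add: H_def)
  have v\<rho>: "\<bar>v \<bullet> b\<bar> \<le> \<rho>" if "b \<in> Basis" for b
    using v[OF that] h(2) jet_radius(2) unfolding v_def by linarith
  have nv: "norm v \<le> d * h" unfolding v_def by (rule norm_le_d) (rule v)
  have "e N \<le> (0 + real N * (T / N * H)) * exp (T * taylor_const * k / N * real N)"
  proof (rule discrete_gronwall[where N = N])
    fix i assume i: "i < N"
    define q where "q = eul_pt N p i"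
    define q0 where "q0 = eul_pt N p0 i"
    have q: "q \<in> \<Omega>G" "q0 \<in> \<Omega>G" using i unfolding q_def q0_def by (auto intro!: eul_pt_in p N)
    have "norm (q - q0) \<le> 2 * norm v + stability_const * norm v"
      unfolding q_def q0_def v_def using eul_pt_diff[OF N, of i p p0] euler_stable[OF p N, of i] i by linarith
    also have "\<dots> = (2 + stability_const) * norm v" by (simp add: algebra_simps)
    also have "\<dots> \<le> (2 + stability_const) * (d * h)" using nv stability_const_nonneg by (intro mult_left_mono) auto
    finally have qd: "norm (q - q0) \<le> (2 + stability_const) * (d * h)" .
    have "(2 + stability_const) * (d * h) \<le> (2 + stability_const) * (d * jet_radius)" using h stability_const_nonneg by (intro mult_left_mono) auto
    then have qd1: "norm (q - q0) \<le> 1" using qd jet_radius(3) by linarith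
    have "norm (iter_partial S [] V (q0 + (q - q0)) - taylor q0 (q - q0)) \<le> M * (\<Sum>b\<in>Basis. \<bar>(q - q0) \<bullet> b\<bar>) ^ k"
      by (rule taylor_words[OF Ck box_like_txe_domain convex_txe_domain[OF convex_cball] \<Omega>G_sub M]) (use q in auto)
    also have "\<dots> \<le> H" unfolding H_def
    proof (intro mult_left_mono power_mono M0)
      have "(\<Sum>b\<in>Basis. \<bar>(q - q0) \<bullet> b\<bar>) \<le> (\<Sum>b\<in>(Basis::('n,'m) txe set). norm (q - q0))" by (intro sum_mono Basis_le_norm)
      also have "\<dots> = d * norm (q - q0)" by (simp add: d_def)
      also have "\<dots> \<le> d * ((2 + stability_const) * d * h)" using qd by (intro mult_left_mono) (auto simp: mult.assoc)
      finally show "(\<Sum>b\<in>Basis. \<bar>(q - q0) \<bullet> b\<bar>) \<le> d * ((2 + stability_const) * d * h)" .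
    qed (simp add: sum_nonneg)
    finally have t1: "norm (V q - taylor q0 (q - q0)) \<le> H" by simp
    have "norm (taylor q0 (q - q0) - taylor q0 (jet_pt N p0 i v)) \<le> taylor_const * k * norm ((q - q0) - jet_pt N p0 i v)"
    proof (rule taylor_lipschitz[OF q(2)])
      fix b :: "('n, 'm) txe" assume b: "b \<in> Basis"
      show "\<bar>(q - q0) \<bullet> b\<bar> \<le> 1" using Basis_le_norm[OF b, of "q - q0"] qd1 by linarith
      show "\<bar>jet_pt N p0 i v \<bullet> b\<bar> \<le> 1"
        by (rule jet_bound[OF p(2) N _ v\<rho> b]) (use i in simp)
    qed
    also have "norm ((q - q0) - jet_pt N p0 i v) = e i"
      by (simp add: q_def q0_def eul_pt_def jet_pt_def v_def e_def norm_Pair left_diff_distrib)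
    finally have t2: "norm (V q - taylor q0 (jet_pt N p0 i v)) \<le> H + taylor_const * k * e i"
      using t1 norm_triangle_ineq[of "V q - taylor q0 (q - q0)" "taylor q0 (q - q0) - taylor q0 (jet_pt N p0 i v)"] by simp
    have fp: "fst p = fst p0 + fst v" by (simp add: v_def)
    \<comment> \<open>The last summand in the recursion of \<open>jet\<close> is the Euler increment
      of \<open>p0\<close> with opposite sign, so the values of the field at \<open>q0\<close>
      cancel.\<close>
    have "euler N p (Suc i) - euler N p0 (Suc i) - jet N p0 (Suc i) v =
       (euler N p i - euler N p0 i - jet N p0 i v) - (fst p / N) *\<^sub>R (V q - taylor q0 (jet_pt N p0 i v))"
      unfolding euler_Suc jet.simps q_def[symmetric] q0_def[symmetric] jet_pt_def[symmetric] fp[symmetric]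
      by (simp add: algebra_simps)
    then have "e (Suc i) \<le> e i + norm ((fst p / N) *\<^sub>R (V q - taylor q0 (jet_pt N p0 i v)))"
      unfolding e_def using norm_triangle_ineq4 by metis
    also have "norm ((fst p / N) *\<^sub>R (V q - taylor q0 (jet_pt N p0 i v))) \<le> T / N * (H + taylor_const * k * e i)"
      unfolding norm_scaleR using fst_bounds[OF p(1)] t2 T by (intro mult_mono) (auto simp: abs_divide divide_right_mono)
    finally show "e (Suc i) \<le> (1 + T * taylor_const * k / N) * e i + T / N * H" by (simp add: algebra_simps)
  next
    show "e 0 \<le> 0" by (simp add: e_def euler_0 v_def)
  qed (use T taylor_const_nonneg H0 in auto)
  also have "\<dots> = jet_const * h ^ k" using N by (simp add: jet_const_def H_def power_mult_distrib)
  finally show ?thesis by (simp add: e_def v_def)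
qed

text \<open>One number dominates the coefficients, which are at most
  \<open>1 / \<rho> ^ k + \<kappa> + T * M\<close>, and the error, whose summands 1,
  \<open>jet_const\<close> and \<open>1 / \<rho> ^ k\<close> stem from the Euler scheme, the jet and
  the truncation.\<close>

definition flow_const :: real where "flow_const = 2 / \<rho> ^ k + \<kappa> + T * M + 1 + jet_const"

lemma jet_const_nonneg: "jet_const \<ge> 0" using T M0 stability_const_nonneg by (simp add: jet_const_def)

lemma flow_const_nonneg: "flow_const \<ge> 0" using \<rho> \<kappa> T M0 jet_const_nonneg by (simp add: flow_const_def)

lemma flow_locally_polynomial:
  assumes h: "0 < h" "h \<le> jet_radius" and j: "j \<in> Basis"
  shows "locally_polynomial k flow_const h \<Omega> (\<lambda>(t, x, \<eta>). char_flow T V 0 t x \<eta> \<bullet> j)"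
  unfolding locally_polynomial_def
proof
  fix p0 :: "('n, 'm) txe" assume p0: "p0 \<in> \<Omega>"
  define K where "K = T * \<Lambda> * (1 + M) * T * exp (T * \<Lambda>)"
  have K0: "K \<ge> 0" using T \<Lambda>0 M0 by (simp add: K_def)
  \<comment> \<open>The number of steps is free, as it enters neither the coefficient bounds nor the
    network; it only has to push the Euler error below \<open>h ^ k\<close>.\<close>
  obtain N :: nat where N: "N > K / h ^ k" using reals_Archimedean2 by blast
  have "0 \<le> K / h ^ k" using K0 h by simp
  then have N1: "N \<ge> 1" using N by (simp add: Suc_le_eq)
  have KN: "K / N \<le> h ^ k" using N N1 h by (simp add: field_simps)
  have "majorized \<rho> 1 (\<lambda>v. jet N p0 N v \<bullet> j)"
    by (rule majorized_mono[OF jet_majorized[OF p0 N1 order_refl j] jet_growth[OF order_refl N1]])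
  from majorized_truncate[OF this \<rho>, of k] obtain a where a: "\<And>w. w\<in>words k \<Longrightarrow> \<bar>a w\<bar> \<le> 1 / \<rho> ^ k"
    "\<And>v h. 0 \<le> h \<Longrightarrow> h \<le> \<rho> \<Longrightarrow> \<forall>b\<in>Basis. \<bar>v \<bullet> b\<bar> \<le> h \<Longrightarrow>
       \<bar>jet N p0 N v \<bullet> j - (\<Sum>w\<in>words k. a w * word_monomial w v)\<bar> \<le> 1 * (h / \<rho>) ^ k" by blast
  define z where "z = euler N p0 N \<bullet> j"
  have z: "\<bar>z\<bar> \<le> \<kappa> + T * M"
    using Basis_le_norm[OF j, of "euler N p0 N"] euler_bound[of "fst p0" "fst (snd p0)" "snd (snd p0)" N N] p0 N1
    by (simp add: z_def)
  \<comment> \<open>The jet describes displacements. The Euler value at the centre is added to the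
    coefficient of the empty word, which is available because \<open>k \<ge> 1\<close>.\<close>
  define a' where "a' w = (if w = [] then a w + z else a w)" for w
  have r1: "1 / \<rho> ^ k \<ge> 0" using \<rho> by simp
  have "\<bar>a' w\<bar> \<le> flow_const" if "w \<in> words k" for w
    using a(1)[OF that] z r1 jet_const_nonneg by (auto simp: a'_def flow_const_def)
  moreover have "\<bar>(case p of (t, x, \<eta>) \<Rightarrow> char_flow T V 0 t x \<eta> \<bullet> j) - (\<Sum>w\<in>words k. a' w * word_monomial w (p - p0))\<bar> \<le> flow_const * h ^ k"
    if p: "p \<in> \<Omega>" and v: "\<forall>b\<in>Basis. \<bar>(p - p0) \<bullet> b\<bar> \<le> h" for p
  proof -
    obtain t x \<eta> where pt: "p = (t, x, \<eta>)" by (cases p) auto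
    define X where "X = char_flow T V 0 t x \<eta>"
    have nil: "[] \<in> (words k :: ('n, 'm) txe list set)" using k by (simp add: words_def)
    have "(\<Sum>w\<in>words k. a' w * word_monomial w (p - p0)) =
       (\<Sum>w\<in>words k. a w * word_monomial w (p - p0) + (if w = [] then z else 0))"
      by (rule sum.cong) (auto simp: a'_def algebra_simps)
    also have "\<dots> = (\<Sum>w\<in>words k. a w * word_monomial w (p - p0)) + z"
      using nil by (simp add: sum.distrib)
    finally have s: "(\<Sum>w\<in>words k. a' w * word_monomial w (p - p0)) = (\<Sum>w\<in>words k. a w * word_monomial w (p - p0)) + z" .
    have 1: "\<bar>(euler N p N - X) \<bullet> j\<bar> \<le> h ^ k"
      using Basis_le_norm[OF j, of "euler N p N - X"] euler_converges[of t x \<eta> N] p N1 KN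
      unfolding pt X_def K_def by linarith
    have 2: "\<bar>(euler N p N - euler N p0 N - jet N p0 N (p - p0)) \<bullet> j\<bar> \<le> jet_const * h ^ k"
      using Basis_le_norm[OF j, of "euler N p N - euler N p0 N - jet N p0 N (p - p0)"]
        jet_error[OF p p0 N1 h] v by fastforce
    have "\<bar>jet N p0 N (p - p0) \<bullet> j - (\<Sum>w\<in>words k. a w * word_monomial w (p - p0))\<bar> \<le> 1 * (h / \<rho>) ^ k"
      by (rule a(2)) (use h jet_radius v in auto)
    then have 3: "\<bar>jet N p0 N (p - p0) \<bullet> j - (\<Sum>w\<in>words k. a w * word_monomial w (p - p0))\<bar> \<le> (1 / \<rho> ^ k) * h ^ k"
      by (simp add: power_divide)
    have "\<bar>X \<bullet> j - ((\<Sum>w\<in>words k. a w * word_monomial w (p - p0)) + z)\<bar> \<le> h ^ k + jet_const * h ^ k + (1 / \<rho> ^ k) * h ^ k"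
      using 1 2 3 unfolding z_def inner_diff_left by linarith
    also have "\<dots> = (1 / \<rho> ^ k + 1 + jet_const) * h ^ k" by (simp add: algebra_simps)
    also have "\<dots> \<le> flow_const * h ^ k"
    proof (rule mult_right_mono)
      have "2 / \<rho> ^ k = 1 / \<rho> ^ k + 1 / \<rho> ^ k" by simp
      then show "1 / \<rho> ^ k + 1 + jet_const \<le> flow_const" using r1 \<kappa> mult_nonneg_nonneg[OF less_imp_le[OF T] M0] unfolding flow_const_def by linarith
    qed (use h in simp)
    finally show ?thesis unfolding s X_def by (simp add: pt)
  qed
  ultimately show "\<exists>a. (\<forall>w\<in>words k. \<bar>a w\<bar> \<le> flow_const) \<and> (\<forall>p\<in>\<Omega>. (\<forall>b\<in>Basis. \<bar>(p - p0) \<bullet> b\<bar> \<le> h) \<longrightarrow>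
      \<bar>(case p of (t, x, \<eta>) \<Rightarrow> char_flow T V 0 t x \<eta> \<bullet> j) - (\<Sum>w\<in>words k. a w * word_monomial w (p - p0))\<bar> \<le> flow_const * h ^ k)"
    by (intro exI[of _ a']) blast
qed

end

section \<open>Composition with the initial datum\<close>

lemma affine_over_continuous:
  assumes "affine_over F q f" "\<And>g. g \<in> F \<Longrightarrow> continuous_on A g"
  shows "continuous_on A f"
proof -
  from assms(1) obtain S a b where S: "S \<subseteq> F" "f = (\<lambda>x. (\<Sum>g\<in>S. a g * g x) + b)"
    unfolding affine_over_def by blast
  show ?thesis unfolding S(2) by (intro continuous_intros assms(2)) (use S(1) in blast)
qed

text \<open>Continuity is used twice: it turns the essential bound for \<open>u0\<close> into a
  pointwise one, and it provides measurability of the final error.\<close>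

lemma relu_net_continuous:
  assumes "relu_net I L W F" "\<And>g. g \<in> I \<Longrightarrow> continuous_on A g" "g \<in> F"
  shows "continuous_on A g"
  using assms
proof (induction arbitrary: g rule: relu_net.induct)
  case (layer L W F G w W')
  show ?case
  proof (cases "g \<in> F")
    case True
    then show ?thesis using layer by blast
  next
    case False
    then obtain f where f: "affine_over F (w g) f" "g = (\<lambda>x. max 0 (f x))" using layer by blast
    have "continuous_on A f" by (rule affine_over_continuous[OF f(1)]) (use layer in blast)
    then show ?thesis unfolding f(2) by (intro continuous_intros)
  qed
qed auto

section \<open>Input coordinates as functions, in the order of the network input\<close>

definition coord_funs :: "(real ^ 'n::finite \<Rightarrow> real) list" where
  "coord_funs = map (\<lambda>i x. vec_nth x (from_nat_into UNIV i)) [0..<CARD('n)]"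

lemma coords_eq: "coords x = map (\<lambda>g. g x) coord_funs"
  by (simp add: coords_def coord_funs_def)

lemma length_coord_funs [simp]: "length (coord_funs :: (real ^ 'n::finite \<Rightarrow> real) list) = CARD('n)"
  by (simp add: coord_funs_def)

lemma set_coord_funs: "set (coord_funs :: (real ^ 'n::finite \<Rightarrow> real) list) = range (\<lambda>i x. vec_nth x i)"
proof -
  have "bij_betw (from_nat_into (UNIV :: 'n set)) {..<CARD('n)} UNIV"
    by (rule bij_betw_from_nat_into_finite) simp
  then have "from_nat_into (UNIV :: 'n set) ` {..<CARD('n)} = UNIV" by (simp add: bij_betw_def)
  then have "(\<lambda>i x. vec_nth (x :: real ^ 'n) i) ` (from_nat_into (UNIV :: 'n set) ` {..<CARD('n)}) = range (\<lambda>i x. vec_nth x i)"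
    by simp
  then show ?thesis by (simp add: coord_funs_def image_image atLeast0LessThan)
qed

definition txe_coord_funs :: "(('n::finite, 'm::finite) txe \<Rightarrow> real) list" where
  "txe_coord_funs = fst # map (\<lambda>g p. g (fst (snd p))) coord_funs @ map (\<lambda>g p. g (snd (snd p))) coord_funs"

lemma nn_input3_eq: "nn_input3 p = vec_of_list (map (\<lambda>g. g p) txe_coord_funs)"
  by (cases p) (auto simp: nn_input3_def txe_coord_funs_def coords_eq o_def)

lemma length_txe_coord_funs:
  "length (txe_coord_funs :: (('n::finite, 'm::finite) txe \<Rightarrow> real) list) = 1 + CARD('n) + CARD('m)"
  by (simp add: txe_coord_funs_def)

lemma inner_mem_txe_coord_funs:
  fixes b :: "('n::finite, 'm::finite) txe"
  assumes "b \<in> Basis"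
  shows "(\<lambda>p. p \<bullet> b) \<in> set txe_coord_funs"
  using assms unfolding Basis_txe
proof (elim disjE bexE)
  assume "b = (1, 0, 0)"
  then have "(\<lambda>p. p \<bullet> b) = fst" by (auto simp: inner_prod_def)
  then show ?thesis by (simp add: txe_coord_funs_def)
next
  fix j :: "real ^ 'n" assume j: "j \<in> Basis" "b = (0, j, 0)"
  then obtain i where "j = axis i 1" by (auto simp: Basis_vec_def)
  then have "(\<lambda>p. p \<bullet> b) = (\<lambda>p. vec_nth (fst (snd p)) i)" unfolding j(2)
    by (auto simp: inner_prod_def inner_axis)
  moreover have "(\<lambda>x. vec_nth x i) \<in> set (coord_funs :: (real ^ 'n \<Rightarrow> real) list)" by (simp add: set_coord_funs)
  ultimately show ?thesis by (auto simp: txe_coord_funs_def)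
next
  fix j :: "real ^ 'm" assume j: "j \<in> Basis" "b = (0, 0, j)"
  then obtain i where "j = axis i 1" by (auto simp: Basis_vec_def)
  then have "(\<lambda>p. p \<bullet> b) = (\<lambda>p. vec_nth (snd (snd p)) i)" unfolding j(2)
    by (auto simp: inner_prod_def inner_axis)
  moreover have "(\<lambda>x. vec_nth x i) \<in> set (coord_funs :: (real ^ 'm \<Rightarrow> real) list)" by (simp add: set_coord_funs)
  ultimately show ?thesis by (auto simp: txe_coord_funs_def)
qed

lemma continuous_on_txe_coord_funs: "g \<in> set txe_coord_funs \<Longrightarrow> continuous_on A g"
  by (auto simp: txe_coord_funs_def set_coord_funs intro!: continuous_intros)

lemma continuous_on_nn_real1:
  assumes "is_nn CARD('n) 1 \<Phi>"
  shows "continuous_on A (\<lambda>x :: real ^ 'n::finite. nn_real \<Phi> (nn_input1 x))"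
proof -
  let ?I = "set (coord_funs :: (real ^ 'n \<Rightarrow> real) list)"
  have "affine_over ?I 2 z" if "z \<in> ?I" for z
    by (rule affine_over_mono[OF affine_over_member[OF that]]) auto
  then have "\<exists>F' f. relu_net ?I (0 + nn_layers \<Phi>) (0 + 2 * nn_weights \<Phi>) F' \<and> affine_over F' (2 * nn_weights \<Phi>) f \<and>
    (\<forall>x. nn_real \<Phi> (vec_of_list (map (\<lambda>z. z x) coord_funs)) = f x)"
    by (intro relu_net_compose[OF relu_net.input]) (use assms in simp_all)
  then obtain F' f where
    F': "relu_net ?I (0 + nn_layers \<Phi>) (0 + 2 * nn_weights \<Phi>) F'" "affine_over F' (2 * nn_weights \<Phi>) f"
    "\<And>x. nn_real \<Phi> (vec_of_list (map (\<lambda>z. z x) coord_funs)) = f x" by blast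
  have "continuous_on A f"
    by (rule affine_over_continuous[OF F'(2) relu_net_continuous[OF F'(1)]])
       (auto simp: set_coord_funs intro!: continuous_intros)
  then show ?thesis using F'(3) by (simp add: nn_input1_def coords_eq)
qed

text \<open>A violation at one point of \<open>U\<close> would persist on a nonempty open set, which
  is not negligible. Needed because the approximate flow may hit a null set on which an essential
  bound says nothing.\<close>

lemma Linf_norm_pointwise:
  fixes f :: "'a::euclidean_space \<Rightarrow> real"
  assumes K: "K \<in> sets lebesgue" and U: "open U" "U \<subseteq> K" and f: "continuous_on U f"
    and le: "Linf_norm K f \<le> ennreal \<epsilon>" and \<epsilon>: "0 \<le> \<epsilon>" and x: "x \<in> U"
  shows "\<bar>f x\<bar> \<le> \<epsilon>"
proof (rule ccontr)
  assume neg: "\<not> \<bar>f x\<bar> \<le> \<epsilon>"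
  define O' where "O' = U \<inter> (\<lambda>x. \<bar>f x\<bar>) -` {\<epsilon><..}"
  have "open O'" unfolding O'_def
    by (rule continuous_open_preimage[OF _ U(1)]) (auto intro!: continuous_intros f)
  moreover have "O' \<noteq> {}" using x neg by (auto simp: O'_def)
  ultimately have nn: "\<not> negligible O'" by (rule open_not_negligible)
  have "AE x in lebesgue_on K. ennreal \<bar>f x\<bar> \<le> Linf_norm K f"
    unfolding Linf_norm_def by (rule esssup_AE)
  then have "AE x in lebesgue_on K. \<bar>f x\<bar> \<le> \<epsilon>"
  proof (rule AE_mp, intro AE_I2 impI)
    fix x assume "ennreal \<bar>f x\<bar> \<le> Linf_norm K f"
    then have "ennreal \<bar>f x\<bar> \<le> ennreal \<epsilon>" using le by (rule order_trans)
    then show "\<bar>f x\<bar> \<le> \<epsilon>" using \<epsilon> by simp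
  qed
  then have "AE x in lebesgue. x \<in> K \<longrightarrow> \<bar>f x\<bar> \<le> \<epsilon>"
    using K by (simp add: AE_restrict_space_iff)
  then obtain N where N: "N \<in> null_sets lebesgue" "{x. \<not> (x \<in> K \<longrightarrow> \<bar>f x\<bar> \<le> \<epsilon>)} \<subseteq> N"
    unfolding eventually_ae_filter by auto
  then have "O' \<subseteq> N" using U(2) by (auto simp: O'_def)
  moreover have "negligible N" using N(1) by (simp add: negligible_iff_null_sets)
  ultimately show False using nn negligible_subset by blast
qed

text \<open>The norm is infinite when the modulus is not measurable, so a pointwise bound alone is
  not enough; continuity supplies measurability.\<close>

lemma Linf_norm_le:
  fixes f :: "'a::euclidean_space \<Rightarrow> real"
  assumes K: "K \<in> sets lebesgue" and f: "continuous_on K f" and le: "\<And>x. x \<in> K \<Longrightarrow> \<bar>f x\<bar> \<le> \<epsilon>"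
  shows "Linf_norm K f \<le> ennreal \<epsilon>"
  unfolding Linf_norm_def
proof (rule esssup_I)
  have [measurable]: "f \<in> borel_measurable (lebesgue_on K)"
    by (rule continuous_imp_measurable_on_sets_lebesgue[OF f K])
  show "(\<lambda>x. ennreal \<bar>f x\<bar>) \<in> borel_measurable (lebesgue_on K)" by measurable
  show "AE x in lebesgue_on K. ennreal \<bar>f x\<bar> \<le> ennreal \<epsilon>"
    by (rule AE_I2) (use le in \<open>auto simp: space_restrict_space intro!: ennreal_leI\<close>)
qed

text \<open>A uniform limit of continuous functions. Applied to the approximating networks
  themselves, it gives continuity of the transport solution without any regularity theory for the
  flow.\<close>

lemma continuous_on_of_approximants:
  fixes f :: "'a::metric_space \<Rightarrow> real"
  assumes "\<And>e. 0 < e \<Longrightarrow> e < 1 \<Longrightarrow> \<exists>g. continuous_on A g \<and> (\<forall>x\<in>A. \<bar>f x - g x\<bar> \<le> e)"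
  shows "continuous_on A f"
  unfolding continuous_on_iff
proof (intro ballI allI impI)
  fix x e assume x: "x \<in> A" and e: "(0::real) < e"
  define e' where "e' = min (e / 4) (1 / 2)"
  have e': "0 < e'" "e' < 1" "e' \<le> e / 4" using e by (auto simp: e'_def)
  from assms[OF e'(1,2)] obtain g where g: "continuous_on A g" "\<And>x. x \<in> A \<Longrightarrow> \<bar>f x - g x\<bar> \<le> e'" by blast
  from g(1) x e obtain \<delta> where \<delta>: "\<delta> > 0" "\<And>y. y \<in> A \<Longrightarrow> dist y x < \<delta> \<Longrightarrow> dist (g y) (g x) < e / 4"
    unfolding continuous_on_iff by (metis zero_less_divide_iff zero_less_numeral)
  show "\<exists>\<delta>>0. \<forall>y\<in>A. dist y x < \<delta> \<longrightarrow> dist (f y) (f x) < e"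
  proof (intro exI[of _ \<delta>] conjI \<delta>(1) ballI impI)
    fix y assume y: "y \<in> A" "dist y x < \<delta>"
    show "dist (f y) (f x) < e"
      using \<delta>(2)[OF y] g(2)[OF y(1)] g(2)[OF x] e'(3) unfolding dist_real_def by linarith
  qed
qed

text \<open>Brings the fan-in down from \<open>q\<close> to 2. Otherwise every weight of the outer
  network would be multiplied by the large fan-in of the inner one.\<close>

lemma relu_net_signed_parts:
  assumes "relu_net I L W F" "affine_over F q g"
  shows "\<exists>F'. relu_net I (L + 2) (W + 2 * q) F' \<and> affine_over F' 2 g"
proof -
  let ?F1 = "insert (\<lambda>x. max 0 (g x)) F"
  let ?F2 = "insert (\<lambda>x. max 0 ((-1) * g x)) ?F1"
  have "relu_net I (Suc L) (W + q) ?F1" by (rule relu_net_extend[OF assms])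
  moreover have "affine_over ?F1 q (\<lambda>x. (-1) * g x)"
    by (rule affine_over_mono[OF affine_over_scale[OF assms(2)]]) auto
  ultimately have n: "relu_net I (Suc (Suc L)) (W + q + q) ?F2" by (rule relu_net_extend)
  have "affine_over ?F2 (1 + 1) (\<lambda>x. max 0 (g x) - max 0 ((-1) * g x))"
    by (intro affine_over_diff affine_over_member) auto
  moreover have "(\<lambda>x. max 0 (g x) - max 0 ((-1) * g x)) = g" by (auto simp: max_def)
  ultimately have "affine_over ?F2 2 g" by (simp add: numeral_2_eq_2)
  with n show ?thesis by (intro exI[of _ ?F2]) (auto simp: mult_2 simp flip: add.assoc)
qed

text \<open>The components of the inner map are fed to \<open>\<Phi>\<close> as differences of their positive and negative parts,
  since hidden neurons are nonnegative.\<close>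

lemma nn_compose_components:
  fixes g :: "'n::finite \<Rightarrow> 'x::topological_space \<Rightarrow> real"
  assumes g: "\<And>i. relu_net (set inps) (L i) (W i) (F i)" "\<And>i. affine_over (F i) (q i) (g i)"
    and L: "\<And>i. L i \<le> L'" and inps: "inps \<noteq> []" and \<Phi>: "is_nn CARD('n) 1 \<Phi>"
    and cont: "\<And>f. f \<in> set inps \<Longrightarrow> continuous_on A f"
  shows "\<exists>\<Psi>. is_nn (length inps) 1 \<Psi> \<and> nn_layers \<Psi> = L' + nn_layers \<Phi> + 3 \<and>
    nn_weights \<Psi> \<le> (\<Sum>i\<in>UNIV. W i + 2 * q i) + 4 * nn_weights \<Phi> \<and>
    (\<forall>x. nn_real \<Psi> (vec_of_list (map (\<lambda>f. f x) inps)) = nn_real \<Phi> (nn_input1 (vec_lambda (\<lambda>i. g i x)))) \<and>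
    continuous_on A (\<lambda>x. nn_real \<Psi> (vec_of_list (map (\<lambda>f. f x) inps)))"
proof -
  let ?I = "set inps"
  have "\<forall>i. \<exists>F'. relu_net ?I (L i + 2) (W i + 2 * q i) F' \<and> affine_over F' 2 (g i)"
    using relu_net_signed_parts[OF g] by blast
  then obtain F' where F': "\<And>i. relu_net ?I (L i + 2) (W i + 2 * q i) (F' i)" "\<And>i. affine_over (F' i) 2 (g i)" by metis
  define H where "H = ?I \<union> (\<Union>i\<in>UNIV. F' i)"
  have net: "relu_net ?I (L' + 2) (\<Sum>i\<in>UNIV. W i + 2 * q i) H" unfolding H_def
    by (rule relu_net_UN) (use L in \<open>auto intro: relu_net_pad[OF F'(1)]\<close>)
  define zs where "zs = map (\<lambda>l. g (from_nat_into UNIV l)) [0..<CARD('n)]"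
  have zs: "affine_over H 2 z" if "z \<in> set zs" for z
  proof -
    from that obtain i where "z = g i" by (auto simp: zs_def)
    then show ?thesis using affine_over_mono[OF F'(2)[of i], of H 2] by (auto simp: H_def)
  qed
  have len: "length zs = CARD('n)" by (simp add: zs_def)
  have "\<exists>F' f. relu_net ?I ((L' + 2) + nn_layers \<Phi>) ((\<Sum>i\<in>UNIV. W i + 2 * q i) + 2 * nn_weights \<Phi>) F' \<and>
      affine_over F' (2 * nn_weights \<Phi>) f \<and> (\<forall>x. nn_real \<Phi> (vec_of_list (map (\<lambda>z. z x) zs)) = f x)"
    by (rule relu_net_compose[OF net]) (use zs \<Phi> len in simp_all)
  then obtain H' f where H': "relu_net ?I ((L' + 2) + nn_layers \<Phi>) ((\<Sum>i\<in>UNIV. W i + 2 * q i) + 2 * nn_weights \<Phi>) H'"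
    "affine_over H' (2 * nn_weights \<Phi>) f" "\<And>x. nn_real \<Phi> (vec_of_list (map (\<lambda>z. z x) zs)) = f x" by blast
  \<comment> \<open>The affine output is charged \<open>2 * nn_weights \<Phi>\<close> once more,
    whence the factor 4. The three additional layers are two for the signed parts and one for the
    output.\<close>
  from relu_net_realise[OF H'(1) inps H'(2)] obtain \<Psi> where \<Psi>: "is_nn (length inps) 1 \<Psi>"
    "nn_layers \<Psi> = Suc ((L' + 2) + nn_layers \<Phi>)"
    "nn_weights \<Psi> \<le> (\<Sum>i\<in>UNIV. W i + 2 * q i) + 2 * nn_weights \<Phi> + 2 * nn_weights \<Phi>"
    "\<And>x. nn_real \<Psi> (vec_of_list (map (\<lambda>f. f x) inps)) = f x" by blast
  have "continuous_on A f"
    by (rule affine_over_continuous[OF H'(2) relu_net_continuous[OF H'(1) cont]])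
  moreover have "map (\<lambda>z. z x) zs = coords (vec_lambda (\<lambda>i. g i x))" for x
    by (simp add: zs_def coords_def)
  ultimately show ?thesis using \<Psi> H'(3)
    by (intro exI[of _ \<Psi>]) (auto simp: nn_input1_def simp del: vec_of_list_map)
qed

lemma norm_le_set_radius:
  assumes "compact K" "x \<in> K"
  shows "norm x \<le> set_radius K"
proof -
  have "bounded (insert 0 K)" using assms(1) by (simp add: compact_imp_bounded)
  then obtain B where "\<And>y. y \<in> insert 0 K \<Longrightarrow> norm y \<le> B" unfolding bounded_iff by blast
  then have "bdd_above (norm ` insert 0 K)" by (intro bdd_aboveI2) 
  then show ?thesis unfolding set_radius_def using assms(2) by (intro cSUP_upper) auto
qed

text \<open>Only the local approximability and the boundedness of \<open>X\<close> matter, so the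
  constant is fixed before \<open>X\<close>. The error is kept at \<open>\<epsilon> / 2\<close> to
  leave room for the strict inequality.\<close>

lemma transport_approximation:
  fixes k :: nat and T r \<kappa> M :: real and u0 :: "real ^ 'n::finite \<Rightarrow> real"
  assumes k: "k \<ge> 1" and T: "T > 0" and r: "r > 0" and M: "M \<ge> 0" and \<kappa>: "\<kappa> \<ge> 0"
    and Lip: "W1inf_loc u0" and app: "nn_approximable r u0"
    and A: "A \<ge> 0" and \<rho>: "\<rho> > 0"
  shows "\<exists>c>0. \<forall>(X :: ('n, 'm::finite) txe \<Rightarrow> real ^ 'n) \<epsilon>.
    (\<forall>j\<in>Basis. \<forall>h. 0 < h \<and> h \<le> \<rho> \<longrightarrow> locally_polynomial k A h (txe_domain T (cball 0 \<kappa>)) (\<lambda>p. X p \<bullet> j)) \<longrightarrow>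
    (\<forall>p\<in>txe_domain T (cball 0 \<kappa>). norm (X p) \<le> \<kappa> + T * M) \<longrightarrow> 0 < \<epsilon> \<longrightarrow> \<epsilon> < 1 \<longrightarrow>
    (\<exists>\<Phi>. is_nn (1 + CARD('n) + CARD('m)) 1 \<Phi> \<and> real (nn_layers \<Phi>) \<le> c * (ln (1 / \<epsilon>) + 1) \<and>
      real (nn_weights \<Phi>) \<le> c * (\<epsilon> powr (- 1 / r) + \<epsilon> powr (- real (1 + CARD('n) + CARD('m)) / real k)) * (ln (1 / \<epsilon>) + 1) \<and>
      (\<forall>p\<in>txe_domain T (cball 0 \<kappa>). \<bar>u0 (X p) - nn_real \<Phi> (nn_input3 p)\<bar> \<le> \<epsilon> / 2) \<and>
      continuous_on UNIV (\<lambda>p :: ('n, 'm) txe. nn_real \<Phi> (nn_input3 p)))"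
proof -
  define d where "d = 1 + CARD('n) + CARD('m)"
  define n where "n = real CARD('n)"
  define \<Omega> where "\<Omega> = (txe_domain T (cball 0 \<kappa>) :: ('n, 'm) txe set)"
  define R where "R = T + \<kappa> + 1"
  \<comment> \<open>The summand 1 is a margin: approximate flow values may leave the range of
    \<open>X\<close> and must still lie in the open ball where \<open>u0\<close> is approximated
    pointwise.\<close>
  define R' where "R' = \<kappa> + T * M + 1"
  have R1: "R \<ge> 1" using T \<kappa> by (simp add: R_def)
  have n1: "n \<ge> 1" by (simp add: n_def Suc_le_eq)
  have dim: "DIM(('n, 'm) txe) = d" by (simp add: d_def)
  have bd: "\<bar>p \<bullet> b\<bar> \<le> R" if p: "p \<in> \<Omega>" and b: "b \<in> Basis" for p b :: "('n, 'm) txe"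
    using b unfolding Basis_txe
  proof (elim disjE bexE)
    assume "b = (1, 0, 0)"
    then show ?thesis using p \<kappa> by (auto simp: \<Omega>_def txe_domain_def R_def inner_prod_def)
  next
    fix j :: "real ^ 'n" assume j: "j \<in> Basis" "b = (0, j, 0)"
    then show ?thesis using Basis_le_norm[OF j(1), of "fst (snd p)"] p T
      by (auto simp: \<Omega>_def txe_domain_def R_def inner_prod_def)
  next
    fix j :: "real ^ 'm" assume j: "j \<in> Basis" "b = (0, 0, j)"
    then obtain i where i: "j = axis i 1" by (auto simp: Basis_vec_def)
    then show ?thesis using p T \<kappa> j(2)
      by (auto simp: \<Omega>_def txe_domain_def R_def inner_prod_def inner_axis param_cube_def mem_box_cart intro: add_increasing)
  qed
  from approximation_rate[OF k A \<rho> R1, where 'a = "('n, 'm) txe"]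
  obtain c1 where c1: "c1 > 0" and rate0: "\<forall>(I :: (('n, 'm) txe \<Rightarrow> real) set) (\<Omega> :: ('n, 'm) txe set) f \<epsilon>.
    (\<forall>b\<in>Basis. (\<lambda>p. p \<bullet> b) \<in> I) \<longrightarrow> (\<forall>p\<in>\<Omega>. \<forall>b\<in>Basis. \<bar>p \<bullet> b\<bar> \<le> R) \<longrightarrow>
    (\<forall>h. 0 < h \<and> h \<le> \<rho> \<longrightarrow> locally_polynomial k A h \<Omega> f) \<longrightarrow> 0 < \<epsilon> \<longrightarrow> \<epsilon> < 1 \<longrightarrow>
    (\<exists>L W F q g. relu_net I L W F \<and> affine_over F q g \<and> real L \<le> c1 * (ln (1 / \<epsilon>) + 1) \<and>
      real (W + q) \<le> c1 * \<epsilon> powr (- real DIM(('n, 'm) txe) / real k) * (ln (1 / \<epsilon>) + 1) \<and>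
      (\<forall>p\<in>\<Omega>. \<bar>f p - g p\<bar> \<le> \<epsilon>))"
    by (elim exE conjE)
  have rate: "\<exists>L W F q g. relu_net I L W F \<and> affine_over F q g \<and> real L \<le> c1 * (ln (1 / \<epsilon>) + 1) \<and>
      real (W + q) \<le> c1 * \<epsilon> powr (- real d / real k) * (ln (1 / \<epsilon>) + 1) \<and> (\<forall>p\<in>\<Omega>. \<bar>f p - g p\<bar> \<le> \<epsilon>)"
    if "\<forall>b\<in>Basis. (\<lambda>p. p \<bullet> b) \<in> I" "\<forall>h. 0 < h \<and> h \<le> \<rho> \<longrightarrow> locally_polynomial k A h \<Omega> f" "0 < \<epsilon>" "\<epsilon> < 1"
    for I :: "(('n, 'm) txe \<Rightarrow> real) set" and f \<epsilon>
  proof -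
    have "\<forall>p\<in>\<Omega>. \<forall>b\<in>(Basis :: ('n, 'm) txe set). \<bar>p \<bullet> b\<bar> \<le> R" using bd by blast
    from rate0[THEN spec, of I, THEN spec, of \<Omega>, THEN spec, of f, THEN spec, of \<epsilon>, THEN mp, OF that(1), THEN mp, OF this,
      THEN mp, OF that(2), THEN mp, OF that(3), THEN mp, OF that(4)]
    show ?thesis unfolding dim .
  qed
  have "\<forall>K. compact K \<longrightarrow> (\<exists>c>0. \<forall>\<epsilon>. 0 < \<epsilon> \<and> \<epsilon> < 1 \<longrightarrow> (\<exists>\<Phi>. is_nn CARD('n) 1 \<Phi> \<and>
      real (nn_layers \<Phi>) \<le> c * (ln (1 / \<epsilon>) + 1) \<and> real (nn_weights \<Phi>) \<le> c * \<epsilon> powr (- 1 / r) \<and>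
      Linf_norm K (\<lambda>x. u0 x - nn_real \<Phi> (nn_input1 x)) \<le> ennreal \<epsilon>))"
    using app unfolding nn_approximable_def by (elim conjE)
  from this[THEN spec, THEN mp, OF compact_cball[of 0 R']]
  obtain c0 where c0: "c0 > 0" and u0_app: "\<forall>\<epsilon>. 0 < \<epsilon> \<and> \<epsilon> < 1 \<longrightarrow> (\<exists>\<Phi>. is_nn CARD('n) 1 \<Phi> \<and>
      real (nn_layers \<Phi>) \<le> c0 * (ln (1 / \<epsilon>) + 1) \<and> real (nn_weights \<Phi>) \<le> c0 * \<epsilon> powr (- 1 / r) \<and>
      Linf_norm (cball 0 R') (\<lambda>x. u0 x - nn_real \<Phi> (nn_input1 x)) \<le> ennreal \<epsilon>)"
    by (elim exE conjE)
  obtain \<beta> where \<beta>: "\<beta>-lipschitz_on (cball 0 R') u0"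
    using Lip compact_cball[of "0 :: real ^ 'n" R'] unfolding W1inf_loc_def by blast
  have \<beta>0: "\<beta> \<ge> 0" using \<beta> by (simp add: lipschitz_on_def)
  \<comment> \<open>With accuracy \<open>\<epsilon> / c5\<close> per component, the Euclidean error
    times \<open>\<beta> + 1\<close> is at most \<open>\<epsilon> / 4\<close>. Using
    \<open>\<beta> + 1\<close> instead of \<open>\<beta>\<close> also bounds the Euclidean error
    itself by 1/4, below the margin in \<open>R'\<close>.\<close>
  define c5 where "c5 = 4 * n * (\<beta> + 1)"
  have c5: "c5 \<ge> 4"
  proof -
    have "1 * 1 \<le> n * (\<beta> + 1)" using n1 \<beta>0 by (intro mult_mono) auto
    then show ?thesis by (simp add: c5_def)
  qed
  define cL where "cL = 3 + c1 * (1 + ln c5) + c0 * (1 + ln 4)"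
  \<comment> \<open>The power of \<open>c5\<close> and the term \<open>1 + ln c5\<close> convert the
    rate in \<open>\<delta>\<close> into the rate in \<open>\<epsilon>\<close>; the factor 2 covers
    \<open>W i + 2 * q i\<close>.\<close>
  define cP where "cP = 2 * (c1 * c5 powr (real d / real k) * (1 + ln c5))"
  define cQ where "cQ = 4 * (c0 * 4 powr (1 / r))"
  define cW where "cW = n * cP + cQ"
  have ln5: "ln c5 \<ge> 0" using c5 by simp
  have cL: "cL \<ge> 0" using c1 c0 ln5 by (simp add: cL_def)
  have cPQ: "cP \<ge> 0" "cQ \<ge> 0" using c1 c0 ln5 by (simp_all add: cP_def cQ_def)
  have cW: "cW \<ge> 0" using cPQ n1 by (simp add: cW_def)
  show ?thesis
  proof (rule exI[of _ "cL + cW + 1"], intro conjI allI impI)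
    show "cL + cW + 1 > 0" using cL cW by simp
  next
    fix X :: "('n, 'm) txe \<Rightarrow> real ^ 'n" and \<epsilon> :: real
    assume X: "\<forall>j\<in>Basis. \<forall>h. 0 < h \<and> h \<le> \<rho> \<longrightarrow> locally_polynomial k A h (txe_domain T (cball 0 \<kappa>)) (\<lambda>p. X p \<bullet> j)"
      and XB: "\<forall>p\<in>txe_domain T (cball 0 \<kappa>). norm (X p) \<le> \<kappa> + T * M" and \<epsilon>: "0 < \<epsilon>" "\<epsilon> < 1"
    define E where "E = ln (1 / \<epsilon>)"
    have E: "E \<ge> 0" using \<epsilon> by (simp add: E_def)
    define \<delta> where "\<delta> = \<epsilon> / c5"
    have \<delta>: "0 < \<delta>" "\<delta> < 1" using \<epsilon> c5 by (auto simp: \<delta>_def)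
    have ln\<delta>: "ln (1 / \<delta>) + 1 \<le> (1 + ln c5) * (E + 1)"
    proof -
      have "ln (1 / \<delta>) = E + ln c5" using \<epsilon> c5 by (simp add: \<delta>_def E_def ln_div)
      then show ?thesis using E ln5 by (simp add: algebra_simps)
    qed
    have ln\<delta>0: "0 \<le> ln (1 / \<delta>) + 1" using \<delta> ln_ge_zero[of "1 / \<delta>"] by (simp add: add_nonneg_nonneg)
    define good where "good i L W F q g \<longleftrightarrow> relu_net (set txe_coord_funs) L W F \<and> affine_over F q g \<and>
      real L \<le> c1 * (ln (1 / \<delta>) + 1) \<and> real (W + q) \<le> c1 * \<delta> powr (- real d / real k) * (ln (1 / \<delta>) + 1) \<and>
      (\<forall>p\<in>\<Omega>. \<bar>vec_nth (X p) i - g p\<bar> \<le> \<delta>)" for i L W F q g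
    have "\<exists>L W F q g. good i L W F q g" for i
    proof -
      have "axis i 1 \<in> (Basis :: (real ^ 'n) set)" by (auto simp: Basis_vec_def)
      from bspec[OF X this] have lp: "\<forall>h. 0 < h \<and> h \<le> \<rho> \<longrightarrow> locally_polynomial k A h \<Omega> (\<lambda>p. vec_nth (X p) i)"
        by (simp add: inner_axis \<Omega>_def)
      have "\<forall>b\<in>Basis. (\<lambda>p. p \<bullet> b) \<in> set (txe_coord_funs :: (('n, 'm) txe \<Rightarrow> real) list)"
        by (intro ballI inner_mem_txe_coord_funs)
      from rate[of "set txe_coord_funs" "\<lambda>p. vec_nth (X p) i" \<delta>, OF this lp \<delta>]
      show ?thesis unfolding good_def .
    qed
    then obtain L W F q g where N: "\<And>i. good i (L i) (W i) (F i) (q i) (g i)" by metis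
    have N': "relu_net (set txe_coord_funs) (L i) (W i) (F i)" "affine_over (F i) (q i) (g i)"
      "real (L i) \<le> c1 * (ln (1 / \<delta>) + 1)" "real (W i + q i) \<le> c1 * \<delta> powr (- real d / real k) * (ln (1 / \<delta>) + 1)"
      "\<And>p. p \<in> \<Omega> \<Longrightarrow> \<bar>vec_nth (X p) i - g i p\<bar> \<le> \<delta>" for i
      using N[of i, unfolded good_def] by blast+
    \<comment> \<open>A common depth to which all component networks are padded.\<close>
    define L' where "L' = nat \<lfloor>c1 * (ln (1 / \<delta>) + 1)\<rfloor>"
    have LL: "L i \<le> L'" for i using N'(3)[of i] unfolding L'_def by linarith
    have L'b: "real L' \<le> c1 * (ln (1 / \<delta>) + 1)" using c1 ln\<delta>0 unfolding L'_def by simp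
    have "0 < \<epsilon> / 4 \<and> \<epsilon> / 4 < 1" using \<epsilon> by simp
    from u0_app[THEN spec, THEN mp, OF this] obtain \<Phi> where \<Phi>: "is_nn CARD('n) 1 \<Phi>"
      "real (nn_layers \<Phi>) \<le> c0 * (ln (1 / (\<epsilon> / 4)) + 1)" "real (nn_weights \<Phi>) \<le> c0 * (\<epsilon> / 4) powr (- 1 / r)"
      "Linf_norm (cball 0 R') (\<lambda>x. u0 x - nn_real \<Phi> (nn_input1 x)) \<le> ennreal (\<epsilon> / 4)" by (elim exE conjE)
    have "txe_coord_funs \<noteq> ([] :: (('n, 'm) txe \<Rightarrow> real) list)" by (simp add: txe_coord_funs_def)
    then have "\<exists>\<Psi>. is_nn (length (txe_coord_funs :: (('n, 'm) txe \<Rightarrow> real) list)) 1 \<Psi> \<and> nn_layers \<Psi> = L' + nn_layers \<Phi> + 3 \<and>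
      nn_weights \<Psi> \<le> (\<Sum>i\<in>UNIV. W i + 2 * q i) + 4 * nn_weights \<Phi> \<and>
      (\<forall>p :: ('n, 'm) txe. nn_real \<Psi> (vec_of_list (map (\<lambda>f. f p) txe_coord_funs)) = nn_real \<Phi> (nn_input1 (vec_lambda (\<lambda>i. g i p)))) \<and>
      continuous_on UNIV (\<lambda>p :: ('n, 'm) txe. nn_real \<Psi> (vec_of_list (map (\<lambda>f. f p) txe_coord_funs)))"
      by (rule nn_compose_components[OF N'(1) N'(2) LL _ \<Phi>(1)]) (rule continuous_on_txe_coord_funs)
    then obtain \<Psi> where \<Psi>: "is_nn d 1 \<Psi>" "nn_layers \<Psi> = L' + nn_layers \<Phi> + 3"
      "nn_weights \<Psi> \<le> (\<Sum>i\<in>UNIV. W i + 2 * q i) + 4 * nn_weights \<Phi>"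
      "\<forall>p. nn_real \<Psi> (nn_input3 p) = nn_real \<Phi> (nn_input1 (vec_lambda (\<lambda>i. g i p)))"
      "continuous_on UNIV (\<lambda>p :: ('n, 'm) txe. nn_real \<Psi> (nn_input3 p))"
      unfolding length_txe_coord_funs d_def[symmetric] nn_input3_eq[symmetric] by (elim exE conjE)
    have u0_pt: "\<bar>u0 y - nn_real \<Phi> (nn_input1 y)\<bar> \<le> \<epsilon> / 4" if y: "y \<in> ball 0 R'" for y
    proof (rule Linf_norm_pointwise[OF _ open_ball ball_subset_cball _ \<Phi>(4) _ y])
      show "continuous_on (ball 0 R') (\<lambda>x. u0 x - nn_real \<Phi> (nn_input1 x))"
        by (intro continuous_intros continuous_on_nn_real1[OF \<Phi>(1)]
            continuous_on_subset[OF lipschitz_on_continuous_on[OF \<beta>]] ball_subset_cball)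
    qed (use \<epsilon> in auto)
    have err: "\<bar>u0 (X p) - nn_real \<Psi> (nn_input3 p)\<bar> \<le> \<epsilon> / 2" if p: "p \<in> \<Omega>" for p
    proof -
      define Y where "Y = (vec_lambda (\<lambda>i. g i p) :: real ^ 'n)"
      have XY: "norm (X p - Y) \<le> n * \<delta>"
      proof -
        have "norm (X p - Y) \<le> (\<Sum>i\<in>UNIV. \<bar>vec_nth (X p - Y) i\<bar>)" by (rule norm_le_l1_cart)
        also have "\<dots> \<le> (\<Sum>i\<in>(UNIV :: 'n set). \<delta>)" using N'(5)[OF p] by (intro sum_mono) (simp add: Y_def)
        finally show ?thesis by (simp add: n_def)
      qed
      have n\<delta>: "(\<beta> + 1) * (n * \<delta>) = \<epsilon> / 4"
      proof -
        have "c5 * \<delta> = \<epsilon>" using c5 by (simp add: \<delta>_def)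
        then have "4 * ((\<beta> + 1) * (n * \<delta>)) = \<epsilon>" unfolding c5_def by (simp add: mult_ac)
        then show ?thesis by simp
      qed
      have "n * \<delta> \<le> (\<beta> + 1) * (n * \<delta>)" 
        using mult_right_mono[of 1 "\<beta> + 1" "n * \<delta>"] n1 \<beta>0 \<delta> by simp
      then have XY1: "norm (X p - Y) \<le> 1 / 4" using XY n\<delta> \<epsilon> by linarith
      have Xp: "norm (X p) \<le> \<kappa> + T * M" using XB p by (simp add: \<Omega>_def)
      have "norm Y \<le> norm (X p) + norm (X p - Y)"
        by (metis norm_triangle_sub norm_minus_commute)
      then have Y: "Y \<in> ball 0 R'" using Xp XY1 by (simp add: R'_def)
      have "dist (u0 (X p)) (u0 Y) \<le> \<beta> * dist (X p) Y"
        by (rule lipschitz_onD[OF \<beta>]) (use Y Xp in \<open>auto simp: R'_def\<close>)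
      also have "\<dots> \<le> (\<beta> + 1) * (n * \<delta>)" using XY \<beta>0 by (intro mult_mono) (auto simp: dist_norm)
      finally have "\<bar>u0 (X p) - u0 Y\<bar> \<le> \<epsilon> / 4" unfolding n\<delta> by (simp add: dist_real_def)
      with u0_pt[OF Y] show ?thesis unfolding \<Psi>(4)[rule_format] Y_def[symmetric] by linarith
    qed
    have E1: "1 \<le> E + 1" using E by simp
    have ln4: "ln (1 / (\<epsilon> / 4)) + 1 \<le> (1 + ln 4) * (E + 1)"
    proof -
      have "ln (1 / (\<epsilon> / 4)) = E + ln 4" using \<epsilon> by (simp add: E_def ln_div)
      then show ?thesis using E by (simp add: algebra_simps)
    qed
    have "real (nn_layers \<Psi>) \<le> c1 * (ln (1 / \<delta>) + 1) + c0 * (ln (1 / (\<epsilon> / 4)) + 1) + 3"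
      using L'b \<Phi>(2) by (simp add: \<Psi>(2))
    also have "\<dots> \<le> c1 * ((1 + ln c5) * (E + 1)) + c0 * ((1 + ln 4) * (E + 1)) + 3 * (E + 1)"
      using c1 c0 E1 ln\<delta> ln4 by (intro add_mono mult_left_mono) auto
    also have "\<dots> = cL * (E + 1)" by (simp add: cL_def algebra_simps)
    also have "\<dots> \<le> (cL + cW + 1) * (E + 1)" using cW E1 by (intro mult_right_mono) auto
    finally have layers: "real (nn_layers \<Psi>) \<le> (cL + cW + 1) * (E + 1)" .
    define P where "P = \<epsilon> powr (- real d / real k)"
    define Q where "Q = \<epsilon> powr (- 1 / r)"
    have PQ: "P \<ge> 0" "Q \<ge> 0" by (auto simp: P_def Q_def)
    have \<delta>P: "\<delta> powr (- real d / real k) = c5 powr (real d / real k) * P"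
      using \<epsilon> c5 by (simp add: \<delta>_def P_def powr_divide powr_minus field_simps)
    have \<epsilon>Q: "(\<epsilon> / 4) powr (- 1 / r) = 4 powr (1 / r) * Q"
      using \<epsilon> by (simp add: Q_def powr_divide powr_minus field_simps)
    have Wq: "real (W i + 2 * q i) \<le> cP * (P * (E + 1))" for i
    proof -
      have "real (W i + 2 * q i) \<le> 2 * real (W i + q i)" by simp
      also have "\<dots> \<le> 2 * (c1 * (c5 powr (real d / real k) * P) * (ln (1 / \<delta>) + 1))"
        using N'(4)[of i] unfolding \<delta>P by (intro mult_left_mono) auto
      also have "\<dots> \<le> 2 * (c1 * (c5 powr (real d / real k) * P) * ((1 + ln c5) * (E + 1)))"
        using ln\<delta> c1 PQ by (intro mult_left_mono) auto
      finally show ?thesis by (simp add: cP_def mult_ac)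
    qed
    have "real (nn_weights \<Psi>) \<le> (\<Sum>i\<in>UNIV. real (W i + 2 * q i)) + 4 * real (nn_weights \<Phi>)"
      using of_nat_mono[OF \<Psi>(3), where 'a = real] by simp
    also have "\<dots> \<le> (\<Sum>i\<in>(UNIV :: 'n set). cP * (P * (E + 1))) + 4 * (c0 * (4 powr (1 / r) * Q))"
      using Wq \<Phi>(3) unfolding \<epsilon>Q by (intro add_mono sum_mono) auto
    also have "\<dots> = n * cP * (P * (E + 1)) + cQ * (Q * 1)" by (simp add: n_def cQ_def)
    also have "\<dots> \<le> n * cP * ((Q + P) * (E + 1)) + cQ * ((Q + P) * (E + 1))"
      using n1 cPQ PQ E1 by (intro add_mono mult_left_mono mult_mono) auto
    also have "\<dots> = cW * ((Q + P) * (E + 1))" by (simp add: cW_def distrib_right)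
    also have "\<dots> \<le> (cL + cW + 1) * ((Q + P) * (E + 1))"
      using cL PQ E1 by (intro mult_right_mono) auto
    finally have weights: "real (nn_weights \<Psi>) \<le> (cL + cW + 1) * (Q + P) * (E + 1)" by (simp add: mult.assoc)
    show "\<exists>\<Phi>. is_nn (1 + CARD('n) + CARD('m)) 1 \<Phi> \<and> real (nn_layers \<Phi>) \<le> (cL + cW + 1) * (ln (1 / \<epsilon>) + 1) \<and>
      real (nn_weights \<Phi>) \<le> (cL + cW + 1) * (\<epsilon> powr (- 1 / r) + \<epsilon> powr (- real (1 + CARD('n) + CARD('m)) / real k)) * (ln (1 / \<epsilon>) + 1) \<and>
      (\<forall>p\<in>txe_domain T (cball 0 \<kappa>). \<bar>u0 (X p) - nn_real \<Phi> (nn_input3 p)\<bar> \<le> \<epsilon> / 2) \<and>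
      continuous_on UNIV (\<lambda>p :: ('n, 'm) txe. nn_real \<Phi> (nn_input3 p))"
      using \<Psi>(1,5) layers weights err unfolding d_def[symmetric] \<Omega>_def[symmetric] P_def Q_def E_def
      by (intro exI[of _ \<Psi>]) blast
  qed
qed

text \<open>The order of quantifiers encodes the dependence of the constant: it comes after
  \<open>\<kappa>\<close> and \<open>M\<close>, but before \<open>V\<close>, \<open>C\<close> and
  \<open>K\<close>, which are then tied to these two numbers by equations.\<close>

theorem theorem4p4:
  fixes k d :: nat and T r \<kappa> M :: real and u0 :: "real ^ 'n::finite \<Rightarrow> real"
  assumes "k \<ge> 1" and "T > 0" and "r > 0"
    and "W1inf_loc u0" and "nn_approximable r u0"
    and "d = 1 + CARD('n) + CARD('m::finite)"
  shows "\<exists>c>0. \<forall>(V :: ('n, 'm) txe \<Rightarrow> real ^ 'n) C K.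
    Ck_on k (txe_domain T UNIV) V \<and>
    C > 0 \<and> (\<forall>(t, x, \<eta>) \<in> txe_domain T UNIV. norm (V (t, x, \<eta>)) \<le> C * (1 + norm x)) \<and>
    compact K \<and> set_radius K = \<kappa> \<and>
    Ck_norm k (txe_domain T UNIV) (txe_domain T (cball 0 (G0 T C \<kappa>))) V = M \<longrightarrow>
    (\<forall>\<epsilon>. 0 < \<epsilon> \<and> \<epsilon> < 1 \<longrightarrow>
      (\<exists>\<Phi>. is_nn d 1 \<Phi> \<and>
        real (nn_layers \<Phi>) \<le> c * (ln (1 / \<epsilon>) + 1) \<and>
        real (nn_weights \<Phi>) \<le>
          c * (\<epsilon> powr (- 1 / r) + \<epsilon> powr (- real d / real k)) * (ln (1 / \<epsilon>) + 1) \<and>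
        Linf_norm (txe_domain T K)
          (\<lambda>p. transport_solution T V u0 p - nn_real \<Phi> (nn_input3 p)) < ennreal \<epsilon>))"
proof -
  have field: "transport_field k T C \<kappa> M V"
    if V: "Ck_on k (txe_domain T UNIV) V" and C: "C > 0"
      and gr: "\<forall>(t, x, \<eta>) \<in> txe_domain T UNIV. norm (V (t, x, \<eta>)) \<le> C * (1 + norm x)"
      and K: "compact K" "set_radius K = \<kappa>"
      and nrm: "Ck_norm k (txe_domain T UNIV) (txe_domain T (cball 0 (G0 T C \<kappa>))) V = M"
    for V :: "('n, 'm) txe \<Rightarrow> real ^ 'n" and C and K :: "(real ^ 'n) set"
  proof
    show "\<kappa> \<ge> 0" using norm_le_set_radius[of "insert 0 K" 0] K by (simp add: set_radius_def)
    show "norm (V (t, x, \<eta>)) \<le> C * (1 + norm x)" if "t \<in> {0..T}" "\<eta> \<in> param_cube" for t x \<eta>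
      using gr that by (auto simp: txe_domain_def)
    show "norm (iter_partial (txe_domain T UNIV) w V q) \<le> M"
      if "set w \<subseteq> Basis" "length w \<le> k" "q \<in> txe_domain T (cball 0 (G0 T C \<kappa>))" for w q
      unfolding nrm[symmetric]
      by (rule Ck_norm_bound[OF V compact_txe_domain[OF compact_cball] _ that]) (auto simp: txe_domain_def)
  qed (use assms V C in auto)
  show ?thesis
  \<comment> \<open>The constants are defined through the locale, whose facts require some field
    with the given \<open>\<kappa>\<close> and \<open>M\<close>. If there is none, the claim is
    vacuous; otherwise any such field provides their properties.\<close>
  proof (cases "\<exists>(V :: ('n, 'm) txe \<Rightarrow> real ^ 'n) C. transport_field k T C \<kappa> M V")
    case False
    then have none: "\<not> (Ck_on k (txe_domain T UNIV) V \<and>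
      C > 0 \<and> (\<forall>(t, x, \<eta>) \<in> txe_domain T UNIV. norm (V (t, x, \<eta>)) \<le> C * (1 + norm x)) \<and>
      compact K \<and> set_radius K = \<kappa> \<and>
      Ck_norm k (txe_domain T UNIV) (txe_domain T (cball 0 (G0 T C \<kappa>))) V = M)"
      for V :: "('n, 'm) txe \<Rightarrow> real ^ 'n" and C and K :: "(real ^ 'n) set" using field by blast
    show ?thesis
    proof (rule exI[of _ 1], intro conjI allI impI)
      show "0 < (1::real)" by simp
    qed (rule notE[OF none], assumption)
  next
    case True
    then obtain V0 :: "('n, 'm) txe \<Rightarrow> real ^ 'n" and C0 where "transport_field k T C0 \<kappa> M V0" by blast
    then interpret tf: transport_field k T C0 \<kappa> M V0 .
    define A where "A = tf.flow_const"
    define \<rho> where "\<rho> = tf.jet_radius"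
    from transport_approximation[where 'm = 'm, OF assms(1-3) tf.M0 tf.\<kappa> assms(4,5) tf.flow_const_nonneg tf.jet_radius(1), folded A_def \<rho>_def assms(6)]
    obtain c where c: "c > 0" and main0: "\<forall>(X :: ('n, 'm) txe \<Rightarrow> real ^ 'n) \<epsilon>.
      (\<forall>j\<in>Basis. \<forall>h. 0 < h \<and> h \<le> \<rho> \<longrightarrow> locally_polynomial k A h (txe_domain T (cball 0 \<kappa>)) (\<lambda>p. X p \<bullet> j)) \<longrightarrow>
      (\<forall>p\<in>txe_domain T (cball 0 \<kappa>). norm (X p) \<le> \<kappa> + T * M) \<longrightarrow> 0 < \<epsilon> \<longrightarrow> \<epsilon> < 1 \<longrightarrow>
      (\<exists>\<Phi>. is_nn d 1 \<Phi> \<and> real (nn_layers \<Phi>) \<le> c * (ln (1 / \<epsilon>) + 1) \<and>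
        real (nn_weights \<Phi>) \<le> c * (\<epsilon> powr (- 1 / r) + \<epsilon> powr (- real d / real k)) * (ln (1 / \<epsilon>) + 1) \<and>
        (\<forall>p\<in>txe_domain T (cball 0 \<kappa>). \<bar>u0 (X p) - nn_real \<Phi> (nn_input3 p)\<bar> \<le> \<epsilon> / 2) \<and>
        continuous_on UNIV (\<lambda>p :: ('n, 'm) txe. nn_real \<Phi> (nn_input3 p)))"
      by (elim exE conjE)
    note main = main0[THEN spec, THEN spec, THEN mp, THEN mp, THEN mp, THEN mp]
    show ?thesis
    proof (rule exI[of _ c], intro conjI c allI impI, elim conjE)
      fix V :: "('n, 'm) txe \<Rightarrow> real ^ 'n" and C and K :: "(real ^ 'n) set" and \<epsilon>
      assume V: "Ck_on k (txe_domain T UNIV) V" "C > 0"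
        "\<forall>(t, x, \<eta>) \<in> txe_domain T UNIV. norm (V (t, x, \<eta>)) \<le> C * (1 + norm x)"
        and K: "compact K" "set_radius K = \<kappa>"
        and nrm: "Ck_norm k (txe_domain T UNIV) (txe_domain T (cball 0 (G0 T C \<kappa>))) V = M"
        and \<epsilon>: "0 < \<epsilon>" "\<epsilon> < (1::real)"
      interpret V: transport_field k T C \<kappa> M V by (rule field[OF V K nrm])
      define X where "X = (\<lambda>(t, x, \<eta>). char_flow T V 0 t x \<eta>)"
      have u: "transport_solution T V u0 p = u0 (X p)" for p by (cases p) (simp add: transport_solution_def X_def)
      have "(\<lambda>p. X p \<bullet> j) = (\<lambda>(t, x, \<eta>). char_flow T V 0 t x \<eta> \<bullet> j)" for j by (auto simp: X_def)
      \<comment> \<open>The constants of the two interpretations coincide, because their definitions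
        mention neither the field nor \<open>C\<close>.\<close>
      then have X1: "\<forall>j\<in>Basis. \<forall>h. 0 < h \<and> h \<le> \<rho> \<longrightarrow> locally_polynomial k A h (txe_domain T (cball 0 \<kappa>)) (\<lambda>p. X p \<bullet> j)"
        using V.flow_locally_polynomial by (simp add: A_def \<rho>_def)
      have X2: "\<forall>p\<in>txe_domain T (cball 0 \<kappa>). norm (X p) \<le> \<kappa> + T * M"
        using V.flow_bound by (auto simp: X_def)
      have sub: "txe_domain T K \<subseteq> (txe_domain T (cball 0 \<kappa>) :: ('n, 'm) txe set)"
        using norm_le_set_radius[OF K(1)] K(2) by (auto simp: txe_domain_def)
      have K_leb: "(txe_domain T K :: ('n, 'm) txe set) \<in> sets lebesgue"
        using compact_txe_domain[OF K(1), of T] by (intro lmeasurable_compact fmeasurableD)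
      from main[OF X1 X2 \<epsilon>] obtain \<Phi> where \<Phi>: "is_nn d 1 \<Phi>" "real (nn_layers \<Phi>) \<le> c * (ln (1 / \<epsilon>) + 1)"
        "real (nn_weights \<Phi>) \<le> c * (\<epsilon> powr (- 1 / r) + \<epsilon> powr (- real d / real k)) * (ln (1 / \<epsilon>) + 1)"
        "\<And>p. p\<in>txe_domain T (cball 0 \<kappa>) \<Longrightarrow> \<bar>u0 (X p) - nn_real \<Phi> (nn_input3 p)\<bar> \<le> \<epsilon> / 2"
        "continuous_on UNIV (\<lambda>p :: ('n, 'm) txe. nn_real \<Phi> (nn_input3 p))" by (elim exE conjE) (erule (2) that, blast, assumption)
      \<comment> \<open>The approximation result for all accuracies exhibits the solution as a
        uniform limit of networks, hence continuous.\<close>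
      have "continuous_on (txe_domain T K) (\<lambda>p. u0 (X p))"
      proof (rule continuous_on_of_approximants)
        fix e :: real assume e: "0 < e" "e < 1"
        from main[OF X1 X2 e] obtain \<Phi>' where \<Phi>': "\<And>p. p\<in>txe_domain T (cball 0 \<kappa>) \<Longrightarrow> \<bar>u0 (X p) - nn_real \<Phi>' (nn_input3 p)\<bar> \<le> e / 2"
          "continuous_on UNIV (\<lambda>p :: ('n, 'm) txe. nn_real \<Phi>' (nn_input3 p))" by blast
        show "\<exists>g. continuous_on (txe_domain T K) g \<and> (\<forall>p\<in>txe_domain T K. \<bar>u0 (X p) - g p\<bar> \<le> e)"
        proof (intro exI conjI ballI)
          show "continuous_on (txe_domain T K) (\<lambda>p :: ('n, 'm) txe. nn_real \<Phi>' (nn_input3 p))"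
            by (rule continuous_on_subset[OF \<Phi>'(2)]) simp
          fix p :: "('n, 'm) txe" assume "p \<in> txe_domain T K"
          with sub \<Phi>'(1)[of p] e show "\<bar>u0 (X p) - nn_real \<Phi>' (nn_input3 p)\<bar> \<le> e" by auto
        qed
      qed
      then have "Linf_norm (txe_domain T K) (\<lambda>p. u0 (X p) - nn_real \<Phi> (nn_input3 p)) \<le> ennreal (\<epsilon> / 2)"
        by (intro Linf_norm_le[OF K_leb] continuous_intros continuous_on_subset[OF \<Phi>(5)])
           (use \<Phi>(4) sub in auto)
      also have "\<dots> < ennreal \<epsilon>" using \<epsilon> by (intro ennreal_lessI) auto
      finally have "Linf_norm (txe_domain T K) (\<lambda>p. transport_solution T V u0 p - nn_real \<Phi> (nn_input3 p)) < ennreal \<epsilon>"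
        unfolding u .
      with \<Phi>(1-3) show "\<exists>\<Phi>. is_nn d 1 \<Phi> \<and>
        real (nn_layers \<Phi>) \<le> c * (ln (1 / \<epsilon>) + 1) \<and>
        real (nn_weights \<Phi>) \<le> c * (\<epsilon> powr (- 1 / r) + \<epsilon> powr (- real d / real k)) * (ln (1 / \<epsilon>) + 1) \<and>
        Linf_norm (txe_domain T K) (\<lambda>p. transport_solution T V u0 p - nn_real \<Phi> (nn_input3 p)) < ennreal \<epsilon>"
        by blast
    qed
  qed
qed

end
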